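(* Let $A=(c_{ij}x^{\alpha_{ij}})$ be a squarefree multigraded $s\times l$ matrix over $R=\Bbbk[x_1,\ldots,x_n]$, let $T=(\gamma_1,\ldots,\gamma_l,\beta_1,\ldots,\beta_s)$ be a squarefree solution of $E_A$, $M_A=\mathrm{Coker}\,\phi_T$, and let $\alpha\in\mathbb Z^n$. Then $(C^\bullet(A,\alpha),\delta^\bullet)$ is a cochain complex, and there is an isomorphism of complexes $$(C^\bullet(A,\alpha),\delta^\bullet)\cong(M_A\otimes_R K_\bullet)_\alpha .$$
   Context: $\Bbbk$ is a field of characteristic $0$, $R=\Bbbk[x_1,\ldots,x_n]$, $[t]=\{1,\ldots,t\}$. For $\alpha=(a_i)\in\mathbb Z^n$, $x^\alpha=\prod x_i^{a_i}$ and $\sigma_\alpha=\mathrm{supp}(\alpha)=\{i:a_i\ne0\}$; for $\alpha\in\mathbb N^n$, $q_\alpha\in\{0,1\}^n$ is the vector with the same support as $\alpha$. For $L\subset[n]$, $\underline L\in\{0,1\}^n$ is its indicator vector. Juxtaposition $\tau t$ means $\tau\cup\{t\}$. Multigraded squarefree matrices: $A=(c_{ij}x^{\alpha_{ij}})$ ($c_{ij}\in\Bbbk$, $\alpha_{ij}\in\mathbb N^n$) is multigraded if every minor equals $c\,x^\alpha$ for some $c\in\Bbbk$ (possibly $0$) and $\alpha\in\mathbb N^n$. $E_A$ is the system of equations $\gamma_j-\beta_i=\alpha_{ij}$, for all $(i,j)$ with $c_{ij}\neq0$, in unknown vectors $\gamma_j$ ($j\in[l]$), $\beta_i$ ($i\in[s]$);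 $A$ is squarefree if $E_A$ has a squarefree solution, i.e. one with all $\gamma_j,\beta_i\in\{0,1\}^n$. For such $T$: $F_1,F_0$ are the free multigraded modules with bases $w_j$ of degree $\gamma_j$ and $v_i$ of degree $\beta_i$, $\phi_T:F_1\to F_0$, $\phi_T(w_j)=\sum_i c_{ij}x^{\alpha_{ij}}v_i$, and $\overline g=g+\mathrm{Im}\,\phi_T$. Ideals, complexes and coefficients: fix a monomial order on $R$ and order monomials of $F_0$ by $uv_i>u'v_j$ if $v_i>v_j$, or $i=j$ and $u>u'$, where $v_s>\cdots>v_1$. Then $\mathrm{in}(\mathrm{Im}\,\phi_T)=I_1v_1\oplus\cdots\oplus I_sv_s$ with $I_j$ squarefree monomial ideals; put $\Delta_{I_j}=\{\sigma\subset[n]:\prod_{i\in\sigma}x_i\notin I_j\}$. The elements $\overline{x^\beta v_j}$ with $\beta\in\mathbb N^n$, $\sigma_\beta\in\Delta_{I_j}$, $j\in[s]$, form a $\Bbbk$-basis of $M_A$. For $\beta\in\mathbb N^n$ with $\sigma_\beta\notin\Delta_{I_j}$, the scalars $r_{j,i,\beta}\in\Bbbk$ ($i<j$) are the unique ones with $\overline{x^\beta v_j}=\sum_{i<j}r_{j,i,\beta}\overline{x^{\beta+\beta_j-\beta_i}v_i}$ and $r_{j,i,\beta}=0$ unless $\beta+\beta_j-\beta_i\in\mathbb N^n$ and $\sigma_{\beta+\beta_j-\beta_i}\in\Delta_{I_i}$. Signs: for $L=\{i_1<\cdots<i_t\}$, $\mathrm{sgn}[i_r,L]=(-1)^{r+1}$,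 and for $W\subset L$, $\mathrm{sgn}[W,L]=\prod_{w\in W}\mathrm{sgn}[w,L]$. Koszul complex: $(K_\bullet,\theta_\bullet)$ is the Koszul complex on $x_1,\ldots,x_n$, with $K_j$ free on $e_L$, $|L|=j$, $\deg e_L=\underline L$, $\theta(e_L)=\sum_{t\in L}\mathrm{sgn}[t,L]x_te_{L\setminus\{t\}}$. In comparing the cochain complex $C^\bullet(A,\alpha)$ with the complex $(M_A\otimes_R K_\bullet)_\alpha$, the term $C^t(A,\alpha)$ is matched with $(M_A\otimes_R K_{|\sigma_{\alpha_1}|-t-1})_\alpha$, where $\alpha_1=\alpha-\beta_1$. Cochains: for a simplicial complex $\Delta$ on a vertex set $V$ (not every element of $V$ need be a face; the void complex $\{\}$ is allowed), $C^j(\Delta)$ is the $\Bbbk$-vector space with basis $\{\tau^*:\tau\in\Delta,|\tau|=j+1\}$ (so $C^{-1}(\Delta)$ is spanned by $\emptyset^*$ if $\Delta\ne\{\}$). For $\tau\in\Delta$, $V_{\tau,\Delta,1}=\{t\in V\setminus\tau:\tau t\in\Delta\}$ and $V_{\tau,\Delta,2}=\{t\in V\setminus\tau:\tau t\notin\Delta\}$. The augmented cochain complex $(C^\bullet(\Delta),d)$ has $d(\tau^* )=\sum_{t\in V_{\tau,\Delta,1}}\mathrm{sgn}[t,\tau t](\tau t)^*$. The construction: for $\alpha\in\mathbb Z^n$ put $\alpha_j=\alpha-\beta_j$. If $\alpha_j\in\mathbb N^n$, $\Delta_{j,\alpha}=\{\sigma\subset\sigma_{\alpha_j}:\sigma\cup\sigma_{\alpha_j-q_{\alpha_j}}\in\Delta_{I_j}\}$,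 regarded as a simplicial complex on the vertex set $V=\sigma_{\alpha_j}$; otherwise $\Delta_{j,\alpha}=\{\}$. Let $(C^\bullet(j,\alpha),d_j)=(C^\bullet(\Delta_{j,\alpha}),d)$. For $\rho\subset[n]$ with $\sigma_{\beta_i}\subset\rho\cup\sigma_{\beta_j}$, define $f(\rho,j,i)=(\sigma_{\beta_j}\cup\rho)\setminus\sigma_{\beta_i}$. For $\tau\in\Delta_{j,\alpha}$ and $w\in V_{\tau,\Delta_{j,\alpha},2}$, define $$\chi_j(\tau^*,w)=\sum_{i<j}\mathrm{sgn}[w,\tau w]\; r_{j,i,\underline{\tau w}+\alpha_j-q_{\alpha_j}}\;\frac{\mathrm{sgn}[\tau w,\sigma_{\alpha_j}]}{\mathrm{sgn}[f(\tau w,j,i),\sigma_{\alpha_i}]}\;(f(\tau w,j,i))^*,$$ the sum being over those $i<j$ for which the coefficient $r$ is nonzero. (The construction asserts that whenever this coefficient is nonzero, $\sigma_{\beta_i}\subset\tau w\cup\sigma_{\beta_j}$ and $f(\tau w,j,i)\in\Delta_{i,\alpha}$, so that for $\tau^*\in C^r(j,\alpha)$ the element $\chi_j(\tau^*,w)$ lies in $\sum_{i<j}C^{r+1+(|\sigma_{\alpha_i}|-|\sigma_{\alpha_j}|)}(i,\alpha)$.) Put $\chi_j(\tau^* )=\sum_{w\in V_{\tau,\Delta_{j,\alpha},2}}\chi_j(\tau^*,w)$. Let $l_j=|\sigma_{\alpha_j}|-|\sigma_{\alpha_1}|$, $C^t(A,\alpha)=\bigoplus_{j=1}^sC^{t+l_j}(j,\alpha)$,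 and let $\delta^t:C^t(A,\alpha)\to C^{t+1}(A,\alpha)$ be the linear map with $\delta^t(\tau^* )=d_j(\tau^* )+\chi_j(\tau^* )$ for $\tau^*\in C^{t+l_j}(j,\alpha)$.
   Formalization: In f(ρ,j,i) the sets σ_{β_j} and σ_{β_i} are restricted to indices t with α_t ≤ 1; the printed formula agrees when all α_t ≤ 1 but can give faces of wrong degree otherwise, e.g. A=(x_2,x_1x_2)^T, β_1=(1,0), β_2=0, γ_1=(1,1), α=(2,1). *)

theory Defs
  imports "HOL-Algebra.AbelCoset" "Jordan_Normal_Form.VS_Connect" "HOL-Library.Poly_Mapping"
begin

section \<open>Free modules, quotients and tensor products\<close>

text \<open>The base rings are types of class \<^class>\<open>comm_ring_1\<close>, passed to the HOL-Algebra
  notions as \<^const>\<open>class_ring\<close>.\<close>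

definition pscale :: "'r::comm_ring_1 \<Rightarrow> ('b \<Rightarrow>\<^sub>0 'r) \<Rightarrow> ('b \<Rightarrow>\<^sub>0 'r)" where
  "pscale r = Poly_Mapping.map ((*) r)"

definition free_module :: "'b set \<Rightarrow> ('r::comm_ring_1, 'b \<Rightarrow>\<^sub>0 'r) module" where
  "free_module B =
    \<lparr>carrier = {f. Poly_Mapping.keys f \<subseteq> B}, mult = undefined, one = undefined,
     zero = 0, add = (+), smult = pscale\<rparr>"

text \<open>The basis element \<open>b\<close> of a free module.\<close>

definition basis_elt :: "'b \<Rightarrow> ('b \<Rightarrow>\<^sub>0 'r::comm_ring_1)" where
  "basis_elt b = Poly_Mapping.single b 1"

text \<open>The linear map between free modules with prescribed values on the basis.\<close>

definition lin_ext :: "('b \<Rightarrow> ('c \<Rightarrow>\<^sub>0 'r)) \<Rightarrow> ('b \<Rightarrow>\<^sub>0 'r::comm_ring_1) \<Rightarrow> ('c \<Rightarrow>\<^sub>0 'r)" where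
  "lin_ext \<phi> f = (\<Sum>b\<in>Poly_Mapping.keys f. pscale (Poly_Mapping.lookup f b) (\<phi> b))"

definition quotient_module :: "('r, 'm) module \<Rightarrow> 'm set \<Rightarrow> ('r, 'm set) module" where
  "quotient_module M N =
    \<lparr>carrier = A_RCOSETS M N, mult = undefined, one = undefined,
     zero = N, add = set_add M,
     smult = (\<lambda>r X. \<Union>x\<in>X. a_r_coset M N (r \<odot>\<^bsub>M\<^esub> x))\<rparr>"

text \<open>The tensor product of two modules over a commutative ring: the free module on
  the product of the carriers modulo the submodule generated by the bilinearity relations.\<close>

definition tensor_relations ::
  "('r::comm_ring_1, 'm) module \<Rightarrow> ('r, 'p) module \<Rightarrow> ('m \<times> 'p \<Rightarrow>\<^sub>0 'r) set" where
  "tensor_relations M N =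
     {basis_elt (x \<oplus>\<^bsub>M\<^esub> x', y) - basis_elt (x, y) - basis_elt (x', y) | x x' y.
        x \<in> carrier M \<and> x' \<in> carrier M \<and> y \<in> carrier N}
   \<union> {basis_elt (x, y \<oplus>\<^bsub>N\<^esub> y') - basis_elt (x, y) - basis_elt (x, y') | x y y'.
        x \<in> carrier M \<and> y \<in> carrier N \<and> y' \<in> carrier N}
   \<union> {basis_elt (r \<odot>\<^bsub>M\<^esub> x, y) - pscale r (basis_elt (x, y)) | r x y.
        x \<in> carrier M \<and> y \<in> carrier N}
   \<union> {basis_elt (x, r \<odot>\<^bsub>N\<^esub> y) - pscale r (basis_elt (x, y)) | r x y.
        x \<in> carrier M \<and> y \<in> carrier N}"

definition tensor_kernel ::
  "('r::comm_ring_1, 'm) module \<Rightarrow> ('r, 'p) module \<Rightarrow> ('m \<times> 'p \<Rightarrow>\<^sub>0 'r) set" where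
  "tensor_kernel M N =
     LinearCombinations.module.span class_ring (free_module (carrier M \<times> carrier N)) (tensor_relations M N)"

definition tensor_product ::
  "('r::comm_ring_1, 'm) module \<Rightarrow> ('r, 'p) module \<Rightarrow> ('r, ('m \<times> 'p \<Rightarrow>\<^sub>0 'r) set) module" where
  "tensor_product M N =
     quotient_module (free_module (carrier M \<times> carrier N)) (tensor_kernel M N)"

definition pure_tensor ::
  "('r::comm_ring_1, 'm) module \<Rightarrow> ('r, 'p) module \<Rightarrow> 'm \<Rightarrow> 'p \<Rightarrow> ('m \<times> 'p \<Rightarrow>\<^sub>0 'r) set" where
  "pure_tensor M N x y =
     a_r_coset (free_module (carrier M \<times> carrier N)) (tensor_kernel M N) (basis_elt (x, y))"

text \<open>The map \<open>f \<otimes> g\<close> for homomorphisms \<open>f : M \<rightarrow> M'\<close> and \<open>g : N \<rightarrow> N'\<close>. The cosets in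
  the union all coincide, since \<open>f\<close> and \<open>g\<close> are homomorphisms.\<close>

definition tensor_map ::
  "('r::comm_ring_1, 'm') module \<Rightarrow> ('r, 'p') module \<Rightarrow> ('m \<Rightarrow> 'm') \<Rightarrow> ('p \<Rightarrow> 'p')
    \<Rightarrow> ('m \<times> 'p \<Rightarrow>\<^sub>0 'r) set \<Rightarrow> ('m' \<times> 'p' \<Rightarrow>\<^sub>0 'r) set" where
  "tensor_map M' N' f g X =
     (\<Union>z\<in>X. a_r_coset (free_module (carrier M' \<times> carrier N')) (tensor_kernel M' N')
        (lin_ext (\<lambda>(x, y). basis_elt (f x, g y)) z))"


section \<open>Cochain complexes of vector spaces\<close>

definition cochain_complex ::
  "(int \<Rightarrow> ('k::field, 'v) module) \<Rightarrow> (int \<Rightarrow> 'v \<Rightarrow> 'v) \<Rightarrow> bool" where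
  "cochain_complex V d \<longleftrightarrow>
     (\<forall>t. vectorspace class_ring (V t)
        \<and> d t \<in> LinearCombinations.module_hom class_ring (V t) (V (t + 1))
        \<and> (\<forall>x\<in>carrier (V t). d (t + 1) (d t x) = \<zero>\<^bsub>V (t + 1 + 1)\<^esub>))"

definition cochain_isomorphic ::
  "(int \<Rightarrow> ('k::field, 'v) module) \<Rightarrow> (int \<Rightarrow> 'v \<Rightarrow> 'v)
    \<Rightarrow> (int \<Rightarrow> ('k, 'w) module) \<Rightarrow> (int \<Rightarrow> 'w \<Rightarrow> 'w) \<Rightarrow> bool" where
  "cochain_isomorphic V d W e \<longleftrightarrow>
     cochain_complex V d \<and> cochain_complex W e \<and>
     (\<exists>\<Phi>. \<forall>t. \<Phi> t \<in> LinearCombinations.module_hom class_ring (V t) (W t)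
        \<and> bij_betw (\<Phi> t) (carrier (V t)) (carrier (W t))
        \<and> (\<forall>x\<in>carrier (V t). \<Phi> (t + 1) (d t x) = e t (\<Phi> t x)))"


section \<open>Polynomials, degrees and gradings\<close>

text \<open>The variables are indexed by a finite linearly ordered type \<open>'n\<close>; multidegrees are the
  elements of \<open>'n \<Rightarrow>\<^sub>0 int\<close>, exponents of monomials those of \<open>'n \<Rightarrow>\<^sub>0 nat\<close>, and the support
  of a vector is its set of \<^const>\<open>Poly_Mapping.keys\<close>. The library order on these types is
  lexicographic and plays no role here.\<close>

type_synonym ('n, 'k) mpoly = "('n \<Rightarrow>\<^sub>0 nat) \<Rightarrow>\<^sub>0 'k"

abbreviation xpow :: "('n \<Rightarrow>\<^sub>0 nat) \<Rightarrow> ('n, 'k::comm_ring_1) mpoly" where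
  "xpow u \<equiv> Poly_Mapping.single u 1"

definition nonneg :: "('n \<Rightarrow>\<^sub>0 int) \<Rightarrow> bool" where
  "nonneg v \<longleftrightarrow> (\<forall>t. 0 \<le> Poly_Mapping.lookup v t)"

definition to_int :: "('n \<Rightarrow>\<^sub>0 nat) \<Rightarrow> ('n \<Rightarrow>\<^sub>0 int)" where
  "to_int = Poly_Mapping.map int"

text \<open>Only used on vectors satisfying \<^const>\<open>nonneg\<close>.\<close>

definition to_nat :: "('n \<Rightarrow>\<^sub>0 int) \<Rightarrow> ('n \<Rightarrow>\<^sub>0 nat)" where
  "to_nat = Poly_Mapping.map nat"

definition zero_one_vec :: "('n \<Rightarrow>\<^sub>0 int) \<Rightarrow> bool" where
  "zero_one_vec v \<longleftrightarrow> (\<forall>t. Poly_Mapping.lookup v t \<in> {0, 1})"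

definition ind_vec :: "'n::finite set \<Rightarrow> ('n \<Rightarrow>\<^sub>0 'a::comm_semiring_1)" where
  "ind_vec L = (\<Sum>t\<in>L. Poly_Mapping.single t 1)"

text \<open>The homogeneous component of degree \<open>\<mu>\<close> of the free module on \<open>B\<close> whose basis
  element \<open>b\<close> has degree \<open>deg b\<close>.\<close>

definition free_component ::
  "'b set \<Rightarrow> ('b \<Rightarrow> ('n \<Rightarrow>\<^sub>0 int)) \<Rightarrow> ('n \<Rightarrow>\<^sub>0 int) \<Rightarrow> ('b \<Rightarrow>\<^sub>0 ('n, 'k::field) mpoly) set" where
  "free_component B deg \<mu> =
     {f. Poly_Mapping.keys f \<subseteq> B \<and>
         (\<forall>b\<in>Poly_Mapping.keys f. \<forall>u\<in>Poly_Mapping.keys (Poly_Mapping.lookup f b).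
            to_int u + deg b = \<mu>)}"

definition restrict_scalars :: "(('n, 'k::field) mpoly, 'm) module \<Rightarrow> ('k, 'm) module" where
  "restrict_scalars M =
    \<lparr>carrier = carrier M, mult = mult M, one = one M, zero = zero M, add = add M,
     smult = (\<lambda>c x. Poly_Mapping.single 0 c \<odot>\<^bsub>M\<^esub> x)\<rparr>"

text \<open>The degree \<open>\<alpha>\<close> component of \<open>M \<otimes> N\<close>, where \<open>MG\<close> and \<open>NG\<close> are the gradings of \<open>M\<close>
  and \<open>N\<close>: the span over the field of all \<open>x \<otimes> y\<close> with \<open>deg x + deg y = \<alpha>\<close>.\<close>

definition tensor_component ::
  "(('n, 'k::field) mpoly, 'm) module \<Rightarrow> (('n \<Rightarrow>\<^sub>0 int) \<Rightarrow> 'm set)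
    \<Rightarrow> (('n, 'k) mpoly, 'p) module \<Rightarrow> (('n \<Rightarrow>\<^sub>0 int) \<Rightarrow> 'p set) \<Rightarrow> ('n \<Rightarrow>\<^sub>0 int)
    \<Rightarrow> ('k, ('m \<times> 'p \<Rightarrow>\<^sub>0 ('n, 'k) mpoly) set) module" where
  "tensor_component M MG N NG \<alpha> =
     (restrict_scalars (tensor_product M N))
       \<lparr>carrier := LinearCombinations.module.span class_ring (restrict_scalars (tensor_product M N))
          {pure_tensor M N x y | x y \<mu> \<nu>. x \<in> MG \<mu> \<and> y \<in> NG \<nu> \<and> \<mu> + \<nu> = \<alpha>}\<rparr>"

definition monomial_order :: "(('n \<Rightarrow>\<^sub>0 nat) \<Rightarrow> ('n \<Rightarrow>\<^sub>0 nat) \<Rightarrow> bool) \<Rightarrow> bool" where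
  "monomial_order mle \<longleftrightarrow>
     reflp mle \<and> transp mle \<and> antisymp mle \<and> totalp mle \<and>
     (\<forall>u. mle 0 u) \<and> (\<forall>u v w. mle u v \<longrightarrow> mle (u + w) (v + w))"


section \<open>Signs and the Koszul complex\<close>

text \<open>If \<open>t\<close> is the \<open>r\<close>-th smallest element of \<open>L\<close> then \<open>r = card {u \<in> L. u \<le> t}\<close>.\<close>

definition sgn_elt :: "'n::{finite,linorder} \<Rightarrow> 'n set \<Rightarrow> 'k::comm_ring_1" where
  "sgn_elt t L = (- 1) ^ (card {u \<in> L. u \<le> t} + 1)"

definition sgn_set :: "'n::{finite,linorder} set \<Rightarrow> 'n set \<Rightarrow> 'k::comm_ring_1" where
  "sgn_set W L = (\<Prod>w\<in>W. sgn_elt w L)"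

text \<open>Basis index set of \<open>K\<^sub>p\<close>, empty when \<open>p\<close> is negative.\<close>

definition koszul_basis :: "int \<Rightarrow> 'n::finite set set" where
  "koszul_basis p = {L. int (card L) = p}"

definition koszul :: "int \<Rightarrow> (('n::{finite,linorder}, 'k::field) mpoly, 'n set \<Rightarrow>\<^sub>0 ('n, 'k) mpoly) module" where
  "koszul p = free_module (koszul_basis p)"

definition koszul_grading ::
  "int \<Rightarrow> ('n::{finite,linorder} \<Rightarrow>\<^sub>0 int) \<Rightarrow> ('n set \<Rightarrow>\<^sub>0 ('n, 'k::field) mpoly) set" where
  "koszul_grading p = free_component (koszul_basis p) ind_vec"

definition koszul_diff ::
  "('n::{finite,linorder} set \<Rightarrow>\<^sub>0 ('n, 'k::field) mpoly) \<Rightarrow> ('n set \<Rightarrow>\<^sub>0 ('n, 'k) mpoly)" where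
  "koszul_diff = lin_ext (\<lambda>L. \<Sum>t\<in>L.
     Poly_Mapping.single (L - {t}) (sgn_elt t L * xpow (Poly_Mapping.single t 1)))"


section \<open>Multigraded squarefree matrices\<close>

text \<open>Matrices are indexed by \<open>{1..s} \<times> {1..l}\<close>.\<close>

definition monomial_entry ::
  "(nat \<Rightarrow> nat \<Rightarrow> 'k::field) \<Rightarrow> (nat \<Rightarrow> nat \<Rightarrow> ('n \<Rightarrow>\<^sub>0 nat)) \<Rightarrow> nat \<Rightarrow> nat \<Rightarrow> ('n, 'k) mpoly" where
  "monomial_entry c a i j = Poly_Mapping.single (a i j) (c i j)"

text \<open>The minor with row set \<open>I\<close> and column set \<open>J\<close>, of the same cardinality.\<close>

definition minor :: "(nat \<Rightarrow> nat \<Rightarrow> 'r::comm_ring_1) \<Rightarrow> nat set \<Rightarrow> nat set \<Rightarrow> 'r" where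
  "minor A I J = det (mat (card I) (card J)
     (\<lambda>(p, q). A (sorted_list_of_set I ! p) (sorted_list_of_set J ! q)))"

definition multigraded ::
  "(nat \<Rightarrow> nat \<Rightarrow> 'k::field) \<Rightarrow> (nat \<Rightarrow> nat \<Rightarrow> ('n \<Rightarrow>\<^sub>0 nat)) \<Rightarrow> nat \<Rightarrow> nat \<Rightarrow> bool" where
  "multigraded c a s l \<longleftrightarrow>
     (\<forall>I J. I \<subseteq> {1..s} \<and> J \<subseteq> {1..l} \<and> card I = card J \<longrightarrow>
        (\<exists>b u. minor (monomial_entry c a) I J = Poly_Mapping.single u b))"

text \<open>A solution with entries 0 and 1 of the system \<open>\<gamma>\<^sub>j - \<beta>\<^sub>i = \<alpha>\<^sub>i\<^sub>j\<close>.\<close>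

definition squarefree_solution ::
  "(nat \<Rightarrow> nat \<Rightarrow> 'k::field) \<Rightarrow> (nat \<Rightarrow> nat \<Rightarrow> ('n \<Rightarrow>\<^sub>0 nat)) \<Rightarrow> nat \<Rightarrow> nat
    \<Rightarrow> (nat \<Rightarrow> ('n \<Rightarrow>\<^sub>0 int)) \<Rightarrow> (nat \<Rightarrow> ('n \<Rightarrow>\<^sub>0 int)) \<Rightarrow> bool" where
  "squarefree_solution c a s l \<gamma> \<beta> \<longleftrightarrow>
     (\<forall>i\<in>{1..s}. \<forall>j\<in>{1..l}. c i j \<noteq> 0 \<longrightarrow> \<gamma> j - \<beta> i = to_int (a i j))
     \<and> (\<forall>j\<in>{1..l}. zero_one_vec (\<gamma> j)) \<and> (\<forall>i\<in>{1..s}. zero_one_vec (\<beta> i))"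

definition squarefree_matrix ::
  "(nat \<Rightarrow> nat \<Rightarrow> 'k::field) \<Rightarrow> (nat \<Rightarrow> nat \<Rightarrow> ('n \<Rightarrow>\<^sub>0 nat)) \<Rightarrow> nat \<Rightarrow> nat \<Rightarrow> bool" where
  "squarefree_matrix c a s l \<longleftrightarrow> (\<exists>\<gamma> \<beta>. squarefree_solution c a s l \<gamma> \<beta>)"


section \<open>Cochains of simplicial complexes\<close>

definition face_ext :: "'n set \<Rightarrow> 'n set set \<Rightarrow> 'n set \<Rightarrow> 'n set" where
  "face_ext V \<Delta> \<tau> = {t \<in> V - \<tau>. insert t \<tau> \<in> \<Delta>}"

definition nonface_ext :: "'n set \<Rightarrow> 'n set set \<Rightarrow> 'n set \<Rightarrow> 'n set" where
  "nonface_ext V \<Delta> \<tau> = {t \<in> V - \<tau>. insert t \<tau> \<notin> \<Delta>}"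

text \<open>Index set of the basis of \<open>C\<^sup>m(\<Delta>)\<close>.\<close>

definition faces :: "'n set set \<Rightarrow> int \<Rightarrow> 'n set set" where
  "faces \<Delta> m = {\<tau> \<in> \<Delta>. int (card \<tau>) = m + 1}"

definition coboundary ::
  "'n::{finite,linorder} set \<Rightarrow> 'n set set \<Rightarrow> 'n set \<Rightarrow> ('n set \<Rightarrow>\<^sub>0 'k::field)" where
  "coboundary V \<Delta> \<tau> =
     (\<Sum>t\<in>face_ext V \<Delta> \<tau>. Poly_Mapping.single (insert t \<tau>) (sgn_elt t (insert t \<tau>)))"


section \<open>The construction\<close>

text \<open>The locale has no assumptions and only collects parameters; \<open>mle\<close> is the monomial
  order.\<close>

locale monomial_presentation =
  fixes mle :: "('n::{finite,linorder} \<Rightarrow>\<^sub>0 nat) \<Rightarrow> ('n \<Rightarrow>\<^sub>0 nat) \<Rightarrow> bool"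
    and c :: "nat \<Rightarrow> nat \<Rightarrow> 'k::field_char_0"
    and a :: "nat \<Rightarrow> nat \<Rightarrow> ('n \<Rightarrow>\<^sub>0 nat)"
    and s l :: nat
    and \<beta> :: "nat \<Rightarrow> ('n \<Rightarrow>\<^sub>0 int)"
begin

subsection \<open>The module and its initial ideals\<close>

definition F1 :: "(('n, 'k) mpoly, nat \<Rightarrow>\<^sub>0 ('n, 'k) mpoly) module" where
  "F1 = free_module {1..l}"

definition F0 :: "(('n, 'k) mpoly, nat \<Rightarrow>\<^sub>0 ('n, 'k) mpoly) module" where
  "F0 = free_module {1..s}"

definition phi :: "(nat \<Rightarrow>\<^sub>0 ('n, 'k) mpoly) \<Rightarrow> (nat \<Rightarrow>\<^sub>0 ('n, 'k) mpoly)" where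
  "phi = lin_ext (\<lambda>j. \<Sum>i\<in>{1..s}. Poly_Mapping.single i (monomial_entry c a i j))"

definition im_phi :: "(nat \<Rightarrow>\<^sub>0 ('n, 'k) mpoly) set" where
  "im_phi = phi ` carrier F1"

definition M_A :: "(('n, 'k) mpoly, (nat \<Rightarrow>\<^sub>0 ('n, 'k) mpoly) set) module" where
  "M_A = quotient_module F0 im_phi"

definition cls :: "(nat \<Rightarrow>\<^sub>0 ('n, 'k) mpoly) \<Rightarrow> (nat \<Rightarrow>\<^sub>0 ('n, 'k) mpoly) set" where
  "cls g = a_r_coset F0 im_phi g"

definition M_A_grading :: "('n \<Rightarrow>\<^sub>0 int) \<Rightarrow> (nat \<Rightarrow>\<^sub>0 ('n, 'k) mpoly) set set" where
  "M_A_grading \<mu> = cls ` free_component {1..s} \<beta> \<mu>"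

text \<open>The pair \<open>(u, i)\<close> stands for the monomial \<open>x\<^sup>u v\<^sub>i\<close> of \<open>F\<^sub>0\<close>.\<close>

definition term_le :: "('n \<Rightarrow>\<^sub>0 nat) \<times> nat \<Rightarrow> ('n \<Rightarrow>\<^sub>0 nat) \<times> nat \<Rightarrow> bool" where
  "term_le = (\<lambda>(u, i) (u', j). i < j \<or> (i = j \<and> mle u u'))"

definition terms :: "(nat \<Rightarrow>\<^sub>0 ('n, 'k) mpoly) \<Rightarrow> (('n \<Rightarrow>\<^sub>0 nat) \<times> nat) set" where
  "terms g = {(u, i). u \<in> Poly_Mapping.keys (Poly_Mapping.lookup g i)}"

definition is_leading :: "(nat \<Rightarrow>\<^sub>0 ('n, 'k) mpoly) \<Rightarrow> ('n \<Rightarrow>\<^sub>0 nat) \<times> nat \<Rightarrow> bool" where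
  "is_leading g m \<longleftrightarrow> m \<in> terms g \<and> (\<forall>m'\<in>terms g. term_le m' m)"

definition initial_module :: "(nat \<Rightarrow>\<^sub>0 ('n, 'k) mpoly) set" where
  "initial_module = LinearCombinations.module.span class_ring F0
     {Poly_Mapping.single i (xpow u) | u i. \<exists>g\<in>im_phi. is_leading g (u, i)}"

definition initial_ideal :: "nat \<Rightarrow> ('n, 'k) mpoly set" where
  "initial_ideal j = {p. Poly_Mapping.single j p \<in> initial_module}"

definition Delta_I :: "nat \<Rightarrow> 'n set set" where
  "Delta_I j = {\<sigma>. (xpow (ind_vec \<sigma>) :: ('n, 'k) mpoly) \<notin> initial_ideal j}"

text \<open>The class of \<open>x\<^sup>b v\<^sub>j\<close> in \<open>M\<^sub>A\<close>, for a vector \<open>b\<close> with nonnegative entries.\<close>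

definition mon_cls :: "('n \<Rightarrow>\<^sub>0 int) \<Rightarrow> nat \<Rightarrow> (nat \<Rightarrow>\<^sub>0 ('n, 'k) mpoly) set" where
  "mon_cls b j = cls (Poly_Mapping.single j (xpow (to_nat b)))"

text \<open>\<open>rcoef j b i\<close> is the scalar \<open>r\<^sub>j\<^sub>,\<^sub>i\<^sub>,\<^sub>b\<close>; only used when the support of \<open>b\<close> is
  not in \<open>Delta_I j\<close>.\<close>

definition rcoef :: "nat \<Rightarrow> ('n \<Rightarrow>\<^sub>0 int) \<Rightarrow> nat \<Rightarrow> 'k" where
  "rcoef j b = (THE r.
     (\<forall>i. r i \<noteq> 0 \<longrightarrow> 1 \<le> i \<and> i < j \<and> nonneg (b + \<beta> j - \<beta> i)
        \<and> Poly_Mapping.keys (b + \<beta> j - \<beta> i) \<in> Delta_I i)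
     \<and> mon_cls b j =
        (\<Oplus>\<^bsub>M_A\<^esub>i\<in>{1..<j}. Poly_Mapping.single 0 (r i) \<odot>\<^bsub>M_A\<^esub> mon_cls (b + \<beta> j - \<beta> i) i))"

subsection \<open>The complex of degree \<open>\<alpha>\<close>\<close>

definition sigma :: "('n \<Rightarrow>\<^sub>0 int) \<Rightarrow> nat \<Rightarrow> 'n set" where
  "sigma \<alpha> j = Poly_Mapping.keys (\<alpha> - \<beta> j)"

text \<open>The vector \<open>\<alpha>\<^sub>j - q\<close>, where \<open>q\<close> is the 0-1 vector with the same support as
  \<open>\<alpha>\<^sub>j = \<alpha> - \<beta>\<^sub>j\<close>.\<close>

definition excess :: "('n \<Rightarrow>\<^sub>0 int) \<Rightarrow> nat \<Rightarrow> ('n \<Rightarrow>\<^sub>0 int)" where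
  "excess \<alpha> j = \<alpha> - \<beta> j - ind_vec (sigma \<alpha> j)"

definition Delta :: "('n \<Rightarrow>\<^sub>0 int) \<Rightarrow> nat \<Rightarrow> 'n set set" where
  "Delta \<alpha> j = (if nonneg (\<alpha> - \<beta> j)
     then {\<sigma>. \<sigma> \<subseteq> sigma \<alpha> j \<and> \<sigma> \<union> Poly_Mapping.keys (excess \<alpha> j) \<in> Delta_I j} else {})"

text \<open>If \<open>x\<^sup>b v\<^sub>i\<close> with \<open>b = ind \<rho> + excess \<alpha> j + \<beta>\<^sub>j - \<beta>\<^sub>i\<close> is a monomial occurring in the
  reduction of \<open>x\<close> to the power \<open>ind \<rho> + excess \<alpha> j\<close> times \<open>v\<^sub>j\<close>, then \<open>face_shift \<alpha> \<rho> j i\<close>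
  is the subset of \<open>sigma \<alpha> i\<close> whose indicator vector is \<open>b - excess \<alpha> i\<close>.

  For degrees \<open>\<alpha>\<close> with all entries at most 1 this is the set \<open>(\<sigma>\<^sub>\<beta>\<^sub>j \<union> \<rho>) - \<sigma>\<^sub>\<beta>\<^sub>i\<close>,
  see \<open>face_shift_le_one\<close> below. For larger degrees that formula does not work: an index \<open>t\<close>
  with \<open>\<alpha>\<^sub>t \<ge> 2\<close> lies in both \<open>sigma \<alpha> j\<close> and \<open>sigma \<alpha> i\<close>, and membership of \<open>t\<close> in the face
  must not be affected by \<open>\<beta>\<^sub>i\<close> and \<open>\<beta>\<^sub>j\<close>. For example let \<open>n = 2\<close> and let \<open>A\<close> be the column
  with entries \<open>x\<^sub>2\<close> and \<open>x\<^sub>1x\<^sub>2\<close>, with \<open>\<beta>\<^sub>1 = (1,0)\<close>, \<open>\<beta>\<^sub>2 = (0,0)\<close>, \<open>\<gamma>\<^sub>1 = (1,1)\<close>, and let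
  \<open>\<alpha> = (2,1)\<close>. For \<open>j = 2\<close>, \<open>\<tau> = {1}\<close>, \<open>w = 2\<close> the reduction of \<open>x\<^sub>1\<^sup>2x\<^sub>2v\<^sub>2\<close> is \<open>-x\<^sub>1x\<^sub>2v\<^sub>1\<close>, so
  the target face is \<open>{1,2}\<close>, whereas the formula without the restriction to \<open>\<alpha>\<^sub>t \<le> 1\<close>
  gives \<open>{2}\<close>, whose cochain degree is that of \<open>\<tau>\<close>.\<close>

definition face_shift :: "('n \<Rightarrow>\<^sub>0 int) \<Rightarrow> 'n set \<Rightarrow> nat \<Rightarrow> nat \<Rightarrow> 'n set" where
  "face_shift \<alpha> \<rho> j i =
     (let S = {t. Poly_Mapping.lookup \<alpha> t \<le> 1}
      in ((Poly_Mapping.keys (\<beta> j) \<inter> S) \<union> \<rho>) - (Poly_Mapping.keys (\<beta> i) \<inter> S))"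

lemma face_shift_le_one:
  assumes "\<And>t. Poly_Mapping.lookup \<alpha> t \<le> 1"
  shows "face_shift \<alpha> \<rho> j i = (Poly_Mapping.keys (\<beta> j) \<union> \<rho>) - Poly_Mapping.keys (\<beta> i)"
  using assms by (auto simp: face_shift_def Let_def)

text \<open>The basis cochain \<open>\<tau>\<^sup>*\<close> in the summand with index \<open>j\<close> is the basis element
  \<open>(j, \<tau>)\<close>.\<close>

definition chi_at :: "('n \<Rightarrow>\<^sub>0 int) \<Rightarrow> nat \<Rightarrow> 'n set \<Rightarrow> 'n \<Rightarrow> (nat \<times> 'n set \<Rightarrow>\<^sub>0 'k)" where
  "chi_at \<alpha> j \<tau> w =
     (let \<rho> = insert w \<tau>; r = rcoef j (ind_vec \<rho> + excess \<alpha> j)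
      in \<Sum>i\<in>{i. 1 \<le> i \<and> i < j \<and> r i \<noteq> 0}.
           Poly_Mapping.single (i, face_shift \<alpha> \<rho> j i)
             (sgn_elt w \<rho> * r i *
               (sgn_set \<rho> (sigma \<alpha> j) / sgn_set (face_shift \<alpha> \<rho> j i) (sigma \<alpha> i))))"

definition chi :: "('n \<Rightarrow>\<^sub>0 int) \<Rightarrow> nat \<Rightarrow> 'n set \<Rightarrow> (nat \<times> 'n set \<Rightarrow>\<^sub>0 'k)" where
  "chi \<alpha> j \<tau> = (\<Sum>w\<in>nonface_ext (sigma \<alpha> j) (Delta \<alpha> j) \<tau>. chi_at \<alpha> j \<tau> w)"

definition shift :: "('n \<Rightarrow>\<^sub>0 int) \<Rightarrow> nat \<Rightarrow> int" where
  "shift \<alpha> j = int (card (sigma \<alpha> j)) - int (card (sigma \<alpha> 1))"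

definition C :: "('n \<Rightarrow>\<^sub>0 int) \<Rightarrow> int \<Rightarrow> ('k, nat \<times> 'n set \<Rightarrow>\<^sub>0 'k) module" where
  "C \<alpha> t = free_module (SIGMA j:{1..s}. faces (Delta \<alpha> j) (t + shift \<alpha> j))"

definition delta :: "('n \<Rightarrow>\<^sub>0 int) \<Rightarrow> (nat \<times> 'n set \<Rightarrow>\<^sub>0 'k) \<Rightarrow> (nat \<times> 'n set \<Rightarrow>\<^sub>0 'k)" where
  "delta \<alpha> = lin_ext (\<lambda>(j, \<tau>).
     lin_ext (\<lambda>\<rho>. basis_elt (j, \<rho>)) (coboundary (sigma \<alpha> j) (Delta \<alpha> j) \<tau>) + chi \<alpha> j \<tau>)"

subsection \<open>The Koszul complex of the module in degree \<open>\<alpha>\<close>\<close>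

text \<open>Reindexed as a cochain complex: \<open>M\<^sub>A \<otimes> K\<^sub>p\<close> sits in cochain degree \<open>t\<close> for
  \<open>p = koszul_index \<alpha> t\<close>.\<close>

definition koszul_index :: "('n \<Rightarrow>\<^sub>0 int) \<Rightarrow> int \<Rightarrow> int" where
  "koszul_index \<alpha> t = int (card (sigma \<alpha> 1)) - t - 1"

definition MK :: "('n \<Rightarrow>\<^sub>0 int) \<Rightarrow> int
    \<Rightarrow> ('k, ((nat \<Rightarrow>\<^sub>0 ('n, 'k) mpoly) set \<times> ('n set \<Rightarrow>\<^sub>0 ('n, 'k) mpoly) \<Rightarrow>\<^sub>0 ('n, 'k) mpoly) set) module" where
  "MK \<alpha> t = (let p = koszul_index \<alpha> t
     in tensor_component M_A M_A_grading (koszul p) (koszul_grading p) \<alpha>)"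

definition MK_diff :: "('n \<Rightarrow>\<^sub>0 int) \<Rightarrow> int
    \<Rightarrow> ((nat \<Rightarrow>\<^sub>0 ('n, 'k) mpoly) set \<times> ('n set \<Rightarrow>\<^sub>0 ('n, 'k) mpoly) \<Rightarrow>\<^sub>0 ('n, 'k) mpoly) set
    \<Rightarrow> ((nat \<Rightarrow>\<^sub>0 ('n, 'k) mpoly) set \<times> ('n set \<Rightarrow>\<^sub>0 ('n, 'k) mpoly) \<Rightarrow>\<^sub>0 ('n, 'k) mpoly) set" where
  "MK_diff \<alpha> t = tensor_map M_A (koszul (koszul_index \<alpha> t - 1)) id koszul_diff"

end

end

theory Submission
  imports Defs
begin

text \<open>All degrees \<open>\<beta>\<^sub>i\<close> and \<open>\<gamma>\<^sub>k\<close> are 0-1 vectors, so in a multidegree \<open>\<mu>\<close> the module \<open>M\<^sub>A\<close>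
  is the space of scalar vectors on the positions \<open>i\<close> with \<open>\<beta>\<^sub>i \<le> \<mu>\<close> modulo the columns \<open>k\<close> of
  \<open>c\<close> with \<open>\<gamma>\<^sub>k \<le> \<mu>\<close>, and for \<open>\<mu> \<ge> 0\<close> those columns depend only on the support of \<open>\<mu>\<close>. Hence the
  initial ideals are squarefree, and the standard positions (those which are not leading
  positions of a vector in the span of the columns) give a basis. Since \<open>M\<^sub>A \<otimes> K\<^sub>p\<close> is a sum of
  copies of \<open>M\<^sub>A\<close> indexed by the sets \<open>L\<close> with \<open>p\<close> elements, its component of degree \<open>\<alpha>\<close> has as
  basis the pairs \<open>(j, L)\<close> with \<open>j\<close> standard in degree \<open>\<alpha> - L\<close>. Under \<open>\<tau> = \<sigma>\<^sub>j - L\<close>, where \<open>\<sigma>\<^sub>j\<close> is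
  the support of \<open>\<alpha> - \<beta>\<^sub>j\<close>, and up to the sign of \<open>\<tau>\<close> in \<open>\<sigma>\<^sub>j\<close>, these are the faces of the
  complexes \<open>\<Delta>\<^sub>j\<^sub>,\<^sub>\<alpha>\<close>. Removing \<open>w\<close> from \<open>L\<close> in the Koszul differential adds \<open>w\<close> to \<open>\<tau>\<close>: this is the
  coboundary if \<open>\<tau> \<union> {w}\<close> is a face, and otherwise \<open>\<chi>\<close> is the reduction of the resulting monomial to
  standard ones.\<close>

section \<open>Free modules and linear extension\<close>

text \<open>A direct check that the cochain differential squares to zero would need identities
  between the reduction coefficients of different faces. None is proved: injectivity of the
  comparison map and its compatibility with the differentials give the relation from the Koszul
  complex. Compatibility holds only in the quotient, since \<open>chi\<close> replaces a monomial by
  its reduction; the error is a vector of \<open>colspace\<close>. Hence equalities of tensors are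
  tested on coordinates along the Koszul basis, read modulo \<open>im_phi\<close>. The coordinates
  use representatives chosen by \<open>rep\<close>, which need not be homogeneous, so homogeneity is
  also stated up to \<open>im_phi\<close>. The signs come from one count: the position of
  \<open>w\<close> in \<open>\<sigma>_j\<close> is its position in \<open>L\<close> plus the number
  of smaller elements of \<open>\<tau>\<close>, so weighting \<open>\<tau>\<close> by its sign in
  \<open>\<sigma>_j\<close> turns the Koszul sign into the coboundary sign. A reduction from
  position \<open>j\<close> to position \<open>i\<close> keeps the Koszul set \<open>L\<close>; only
  its complement changes, from \<open>\<sigma>_j - L\<close> to \<open>\<sigma>_i - L\<close>, which
  is where \<open>face_shift\<close> comes from.\<close>

lemma lookup_pscale [simp]: "Poly_Mapping.lookup (pscale r f) b = r * Poly_Mapping.lookup f b"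
  by (cases "Poly_Mapping.lookup f b = 0") (simp_all add: pscale_def map.rep_eq)

lemma keys_pscale: "Poly_Mapping.keys (pscale r f) \<subseteq> Poly_Mapping.keys f"
  by (auto simp: in_keys_iff)

lemma pscale_zero_left [simp]: "pscale 0 f = 0"
  and pscale_zero_right [simp]: "pscale r 0 = 0"
  and pscale_one [simp]: "pscale 1 f = f"
  and pscale_minus_one: "pscale (- 1) f = - f"
  and pscale_pscale [simp]: "pscale r (pscale r' f) = pscale (r * r') f"
  and pscale_add_left: "pscale (r + r') f = pscale r f + pscale r' f"
  and pscale_add_right: "pscale r (f + g) = pscale r f + pscale r g"
  and pscale_diff_right: "pscale r (f - g) = pscale r f - pscale r g"
  by (auto intro!: poly_mapping_eqI simp: lookup_add lookup_minus algebra_simps)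

lemma pscale_single [simp]: "pscale r (Poly_Mapping.single b x) = Poly_Mapping.single b (r * x)"
  by (rule poly_mapping_eqI) (simp add: lookup_single when_def)

lemma pscale_basis_elt: "pscale r (basis_elt b) = Poly_Mapping.single b r"
  by (simp add: basis_elt_def)

lemma pscale_sum_right: "pscale r (\<Sum>i\<in>A. f i) = (\<Sum>i\<in>A. pscale r (f i))"
  by (rule poly_mapping_eqI) (simp add: lookup_sum sum_distrib_left)

lemma pscale_sum_left: "pscale (\<Sum>i\<in>A. r i) f = (\<Sum>i\<in>A. pscale (r i) f)"
  by (rule poly_mapping_eqI) (simp add: lookup_sum sum_distrib_right)

lemma poly_mapping_eq_sum_single:
  "f = (\<Sum>b\<in>Poly_Mapping.keys f. Poly_Mapping.single b (Poly_Mapping.lookup f b))"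
  by (rule poly_mapping_eqI) (auto simp: lookup_sum lookup_single when_def in_keys_iff)

lemma lin_ext_eq_sum:
  assumes "finite A" "Poly_Mapping.keys f \<subseteq> A"
  shows "lin_ext \<phi> f = (\<Sum>b\<in>A. pscale (Poly_Mapping.lookup f b) (\<phi> b))"
  unfolding lin_ext_def using assms
  by (intro sum.mono_neutral_left) (auto simp: in_keys_iff)

lemma lin_ext_add: "lin_ext \<phi> (f + g) = lin_ext \<phi> f + lin_ext \<phi> g"
proof -
  let ?A = "Poly_Mapping.keys f \<union> Poly_Mapping.keys g"
  have "lin_ext \<phi> (f + g) = (\<Sum>b\<in>?A. pscale (Poly_Mapping.lookup (f + g) b) (\<phi> b))"
    by (rule lin_ext_eq_sum) (auto simp: keys_add)
  moreover have "lin_ext \<phi> f = (\<Sum>b\<in>?A. pscale (Poly_Mapping.lookup f b) (\<phi> b))"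
    "lin_ext \<phi> g = (\<Sum>b\<in>?A. pscale (Poly_Mapping.lookup g b) (\<phi> b))"
    by (auto intro!: lin_ext_eq_sum)
  ultimately show ?thesis
    by (simp add: lookup_add pscale_add_left sum.distrib)
qed

lemma lin_ext_pscale: "lin_ext \<phi> (pscale r f) = pscale r (lin_ext \<phi> f)"
proof -
  have "lin_ext \<phi> (pscale r f) = (\<Sum>b\<in>Poly_Mapping.keys f. pscale (Poly_Mapping.lookup (pscale r f) b) (\<phi> b))"
    by (rule lin_ext_eq_sum) (auto simp: keys_pscale[THEN subsetD])
  then show ?thesis
    by (simp add: lin_ext_def pscale_sum_right)
qed

lemma lin_ext_zero [simp]: "lin_ext \<phi> 0 = 0"
  by (simp add: lin_ext_def)

lemma lin_ext_diff: "lin_ext \<phi> (f - g) = lin_ext \<phi> f - lin_ext \<phi> g"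
  using lin_ext_add[of \<phi> f "pscale (- 1) g"]
  unfolding lin_ext_pscale by (simp add: pscale_minus_one)

lemma lin_ext_sum: "lin_ext \<phi> (\<Sum>i\<in>A. f i) = (\<Sum>i\<in>A. lin_ext \<phi> (f i))"
  by (induction A rule: infinite_finite_induct) (simp_all add: lin_ext_add)

lemma lin_ext_single [simp]: "lin_ext \<phi> (Poly_Mapping.single b r) = pscale r (\<phi> b)"
  using lin_ext_eq_sum[of "{b}" "Poly_Mapping.single b r" \<phi>] by simp

lemma lin_ext_basis_elt [simp]: "lin_ext \<phi> (basis_elt b) = \<phi> b"
  by (simp add: basis_elt_def)

lemma lin_ext_lin_ext: "lin_ext \<psi> (lin_ext \<phi> f) = lin_ext (\<lambda>b. lin_ext \<psi> (\<phi> b)) f"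
  unfolding lin_ext_def[of \<phi>] lin_ext_def[of "\<lambda>b. lin_ext \<psi> (\<phi> b)"]
  by (simp add: lin_ext_sum lin_ext_pscale)

lemma keys_lin_ext:
  assumes "\<And>b. b \<in> Poly_Mapping.keys f \<Longrightarrow> Poly_Mapping.keys (\<phi> b) \<subseteq> B"
  shows "Poly_Mapping.keys (lin_ext \<phi> f) \<subseteq> B"
  unfolding lin_ext_def
  by (rule order_trans[OF keys_sum], rule UN_least, rule order_trans[OF keys_pscale]) (rule assms)

lemma free_module_simps [simp]:
  "carrier (free_module B) = {f. Poly_Mapping.keys f \<subseteq> B}"
  "add (free_module B) = (+)"
  "zero (free_module B) = 0"
  "Module.smult (free_module B) = pscale"
  by (simp_all add: free_module_def)

lemma module_free_module: "Module.module class_ring (free_module B)"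
proof (rule LinearCombinations.module_criteria, goal_cases)
  case 1
  show ?case by (rule class_cring.is_cring)
next
  case 4
  show ?case
    by (auto intro!: exI[of _ "- v" for v])
qed (auto simp: add_ac pscale_add_left pscale_add_right keys_pscale[THEN subsetD]
      dest: keys_add[THEN subsetD])

lemma module_restrict_scalars:
  assumes "Module.module class_ring M"
  shows "Module.module class_ring (restrict_scalars M)"
proof -
  interpret M: Module.module class_ring M by fact
  have [simp]: "Poly_Mapping.single 0 1 = 1"
    by (simp flip: single_one)
  show ?thesis
  proof (rule LinearCombinations.module_criteria, goal_cases)
    case 1
    show ?case by (rule class_cring.is_cring)
  next
    case 4
    show ?case
      using M.M.r_neg M.M.a_inv_closed by (fastforce simp: restrict_scalars_def)
  next
    case 9
    show ?case
      by (simp add: restrict_scalars_def mult_single flip: M.smult_assoc1)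
  next
    case 11
    show ?case
      using M.smult_l_distr by (simp add: restrict_scalars_def single_add)
  qed (use M.smult_one in \<open>auto simp: restrict_scalars_def M.M.a_ac M.smult_r_distr intro!: M.smult_closed\<close>)
qed

lemma restrict_scalars_simps [simp]:
  "carrier (restrict_scalars M) = carrier M"
  "add (restrict_scalars M) = add M"
  "zero (restrict_scalars M) = zero M"
  "Module.smult (restrict_scalars M) c x = Poly_Mapping.single 0 c \<odot>\<^bsub>M\<^esub> x"
  by (simp_all add: restrict_scalars_def)

lemma vectorspaceI:
  "Module.module (class_ring :: 'k::field ring) V \<Longrightarrow> vectorspace class_ring V"
  by (simp add: vectorspace_def class_field)

text \<open>The elements of the carrier satisfying \<open>P\<close> form a submodule containing
  \<open>S\<close>. Used for the tensor kernel, the initial module and the homogeneous component of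
  the tensor product.\<close>

lemma span_induct_gen:
  assumes "Module.module class_ring V" "S \<subseteq> carrier V"
    and "x \<in> LinearCombinations.module.span class_ring V S"
    and zero: "P \<zero>\<^bsub>V\<^esub>"
    and add: "\<And>x y. x \<in> carrier V \<Longrightarrow> y \<in> carrier V \<Longrightarrow> P x \<Longrightarrow> P y \<Longrightarrow> P (x \<oplus>\<^bsub>V\<^esub> y)"
    and smult: "\<And>r x. x \<in> carrier V \<Longrightarrow> P x \<Longrightarrow> P (r \<odot>\<^bsub>V\<^esub> x)"
    and base: "\<And>x. x \<in> S \<Longrightarrow> P x"
  shows "P x"
proof -
  interpret V: Module.module class_ring V by fact
  have "LinearCombinations.submodule class_ring {x \<in> carrier V. P x} V"
    unfolding LinearCombinations.submodule_def using assms by auto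
  then have "V.span S \<subseteq> {x \<in> carrier V. P x}"
    using assms(2) base by (intro V.span_is_subset) auto
  then show ?thesis using assms(3) by auto
qed

section \<open>Quotients of free modules\<close>

text \<open>Instantiated twice: \<open>N = im_phi\<close> gives \<open>M_A\<close>, and the span of
  the bilinearity relations gives the tensor product.\<close>

locale free_quotient =
  fixes B :: "'b set" and N :: "('b \<Rightarrow>\<^sub>0 'r::comm_ring_1) set"
  assumes N_submodule: "LinearCombinations.submodule class_ring N (free_module B)"
begin

abbreviation Q :: "('r, ('b \<Rightarrow>\<^sub>0 'r) set) module" where
  "Q \<equiv> quotient_module (free_module B) N"

abbreviation coset :: "('b \<Rightarrow>\<^sub>0 'r) \<Rightarrow> ('b \<Rightarrow>\<^sub>0 'r) set" where
  "coset \<equiv> a_r_coset (free_module B) N"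

lemma N_sub: "f \<in> N \<Longrightarrow> Poly_Mapping.keys f \<subseteq> B"
  using N_submodule by (auto simp: LinearCombinations.submodule_def)

lemma N_zero [simp]: "0 \<in> N"
  using N_submodule by (auto simp: LinearCombinations.submodule_def)

lemma N_add: "f \<in> N \<Longrightarrow> g \<in> N \<Longrightarrow> f + g \<in> N"
  using N_submodule by (auto simp: LinearCombinations.submodule_def)

lemma N_pscale: "f \<in> N \<Longrightarrow> pscale r f \<in> N"
  using N_submodule by (auto simp: LinearCombinations.submodule_def)

lemma N_minus: "f \<in> N \<Longrightarrow> - f \<in> N"
  using N_pscale[of f "- 1"] by (simp add: pscale_minus_one)

lemma N_diff: "f \<in> N \<Longrightarrow> g \<in> N \<Longrightarrow> f - g \<in> N"
  using N_add[of f "- g"] N_minus by simp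

lemma N_sum: "(\<And>i. i \<in> A \<Longrightarrow> f i \<in> N) \<Longrightarrow> (\<Sum>i\<in>A. f i) \<in> N"
  by (induction A rule: infinite_finite_induct) (auto intro: N_add)

lemma N_diff_trans: "f - g \<in> N \<Longrightarrow> g - h \<in> N \<Longrightarrow> f - h \<in> N"
  using N_add[of "f - g" "g - h"] by simp

lemma N_diff_sym: "f - g \<in> N \<Longrightarrow> g - f \<in> N"
  using N_minus[of "f - g"] by simp

lemma coset_eq: "coset g = {f. f - g \<in> N}"
  by (auto simp: a_r_coset_def r_coset_def intro: bexI[of _ "x - g" for x])

lemma coset_eq_iff: "coset f = coset g \<longleftrightarrow> f - g \<in> N"
proof
  assume "coset f = coset g"
  moreover have "f \<in> coset f" by (simp add: coset_eq)
  ultimately show "f - g \<in> N" by (simp add: coset_eq)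
qed (auto simp: coset_eq intro: N_diff_trans N_diff_sym)

lemma coset_zero: "coset 0 = N"
  by (simp add: coset_eq)

lemma Q_carrier: "carrier Q = coset ` {f. Poly_Mapping.keys f \<subseteq> B}"
  by (auto simp: quotient_module_def A_RCOSETS_def RCOSETS_def a_r_coset_def)

lemma coset_in_carrier: "Poly_Mapping.keys f \<subseteq> B \<Longrightarrow> coset f \<in> carrier Q"
  by (auto simp: Q_carrier)

lemma Q_zero: "zero Q = coset 0"
  by (simp add: quotient_module_def coset_zero)

lemma Q_add: "coset f \<oplus>\<^bsub>Q\<^esub> coset g = coset (f + g)"
proof -
  have "\<exists>h. h - f \<in> N \<and> (\<exists>k. k - g \<in> N \<and> x = h + k)" if "x - (f + g) \<in> N" for x
    using that by (intro exI[of _ "x - g"] conjI exI[of _ g]) (auto simp: algebra_simps)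
  moreover have "h + k - (f + g) \<in> N" if "h - f \<in> N" "k - g \<in> N" for h k
    using N_add[OF that] by (simp add: algebra_simps)
  ultimately show ?thesis
    by (auto simp: quotient_module_def set_add_def set_mult_def coset_eq)
qed

text \<open>The definition takes a union over all representatives. They all give the same coset and
  there is at least one of them, so the union collapses.\<close>

lemma Q_smult: "r \<odot>\<^bsub>Q\<^esub> coset f = coset (pscale r f)"
proof -
  have "coset (pscale r g) = coset (pscale r f)" if "g \<in> coset f" for g
    using that N_pscale[of "g - f" r]
    unfolding coset_eq_iff by (simp add: coset_eq pscale_diff_right)
  then have "(\<Union>g\<in>coset f. coset (pscale r g)) = (\<Union>g\<in>coset f. coset (pscale r f))"
    by (rule SUP_cong[OF refl])
  moreover have "coset f \<noteq> {}"
    by (auto simp: coset_eq intro: exI[of _ f])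
  ultimately show ?thesis
    by (simp add: quotient_module_def)
qed

lemmas Q_simps = Q_zero Q_add Q_smult

lemma module_Q: "Module.module class_ring Q"
proof (rule LinearCombinations.module_criteria, goal_cases)
  case 1
  show ?case by (rule class_cring.is_cring)
next
  case 4
  show ?case
  proof
    fix X assume "X \<in> carrier Q"
    then obtain f where "Poly_Mapping.keys f \<subseteq> B" "X = coset f" by (auto simp: Q_carrier)
    then show "\<exists>Y\<in>carrier Q. X \<oplus>\<^bsub>Q\<^esub> Y = \<zero>\<^bsub>Q\<^esub>"
      by (intro bexI[of _ "coset (- f)"]) (auto simp: Q_simps intro!: coset_in_carrier)
  qed
qed (auto simp: Q_carrier Q_simps add_ac pscale_add_left pscale_add_right
      intro!: imageI order_trans[OF keys_add] order_trans[OF keys_pscale])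

lemma Q_finsum:
  assumes "finite A" "\<And>i. i \<in> A \<Longrightarrow> Poly_Mapping.keys (f i) \<subseteq> B"
  shows "(\<Oplus>\<^bsub>Q\<^esub>i\<in>A. coset (f i)) = coset (\<Sum>i\<in>A. f i)"
proof -
  interpret Q: Module.module class_ring Q by (rule module_Q)
  from assms show ?thesis
  proof (induction A rule: finite_induct)
    case (insert i A)
    then have "(\<lambda>i. coset (f i)) \<in> A \<rightarrow> carrier Q"
      by (auto intro: coset_in_carrier)
    with insert show ?case
      by (simp add: Q.M.finsum_insert coset_in_carrier Q_add)
  qed (simp add: Q_zero)
qed

text \<open>Coordinates on the tensor product need a function from cosets back to the free module.
  Such a choice is linear only modulo \<open>N\<close>.\<close>

definition rep :: "('b \<Rightarrow>\<^sub>0 'r) set \<Rightarrow> ('b \<Rightarrow>\<^sub>0 'r)" where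
  "rep X = (SOME f. Poly_Mapping.keys f \<subseteq> B \<and> X = coset f)"

lemma rep:
  assumes "X \<in> carrier Q"
  shows "Poly_Mapping.keys (rep X) \<subseteq> B" "coset (rep X) = X"
  using someI_ex[of "\<lambda>f. Poly_Mapping.keys f \<subseteq> B \<and> X = coset f"] assms
  by (auto simp: rep_def Q_carrier)

lemma rep_coset: "Poly_Mapping.keys f \<subseteq> B \<Longrightarrow> rep (coset f) - f \<in> N"
  using rep(2)[of "coset f"] by (simp add: coset_in_carrier coset_eq_iff)

end

section \<open>Tensoring with a finite free module\<close>

lemma keys_basis_elt: "Poly_Mapping.keys (basis_elt b :: 'b \<Rightarrow>\<^sub>0 'r::comm_ring_1) = {b}"
  by (simp add: basis_elt_def)

lemma keys_diff_subset:
  "Poly_Mapping.keys f \<subseteq> A \<Longrightarrow> Poly_Mapping.keys g \<subseteq> A \<Longrightarrow> Poly_Mapping.keys (f - g) \<subseteq> A"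
  for f g :: "'b \<Rightarrow>\<^sub>0 'r::comm_ring_1"
  using keys_diff[of f g] by blast

lemma basis_elt_eq_sum:
  assumes "finite D" "Poly_Mapping.keys y \<subseteq> D"
  shows "y = (\<Sum>L\<in>D. pscale (Poly_Mapping.lookup y L) (basis_elt L))"
  using assms
  by (intro poly_mapping_eqI) (auto simp: lookup_sum basis_elt_def lookup_single when_def in_keys_iff)

locale free_tensor = free_quotient B N
  for B :: "'b set" and N :: "('b \<Rightarrow>\<^sub>0 'r::comm_ring_1) set" +
  fixes D :: "'d set"
  assumes finite_D: "finite D"
begin

abbreviation P :: "('r, 'd \<Rightarrow>\<^sub>0 'r) module" where
  "P \<equiv> free_module D"

abbreviation Ker where
  "Ker \<equiv> tensor_kernel Q P"

abbreviation TC :: "(('b \<Rightarrow>\<^sub>0 'r) set \<times> ('d \<Rightarrow>\<^sub>0 'r)) set" where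
  "TC \<equiv> carrier Q \<times> carrier P"

lemma tensor_relations_carrier: "tensor_relations Q P \<subseteq> carrier (free_module TC)"
proof -
  interpret Q: Module.module class_ring Q by (rule module_Q)
  interpret P: Module.module class_ring P by (rule module_free_module)
  define E where "E = carrier (free_module TC :: ('r, _) module)"
  have basis: "basis_elt (X, y) \<in> E" if "X \<in> carrier Q" "y \<in> carrier P" for X y
    using that by (simp add: E_def keys_basis_elt)
  have diff: "f - g \<in> E" if "f \<in> E" "g \<in> E" for f g
    using that keys_diff_subset[of f TC g] unfolding E_def free_module_simps(1)[of TC] by blast
  have scale: "pscale r f \<in> E" if "f \<in> E" for f r
    using that keys_pscale[of r f] unfolding E_def free_module_simps(1)[of TC] by blast
  show ?thesis
    unfolding E_def[symmetric]
  proof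
    fix z assume "z \<in> tensor_relations Q P"
    then show "z \<in> E"
      unfolding tensor_relations_def
      by (elim UnE CollectE exE conjE)
        (simp_all only: diff scale basis Q.M.a_closed P.M.a_closed Q.smult_closed P.smult_closed class_ring_simps UNIV_I)
  qed
qed

lemma tensor_kernel_submodule: "LinearCombinations.submodule class_ring Ker (free_module TC)"
  unfolding tensor_kernel_def
  by (rule LinearCombinations.module.span_is_submodule[OF module_free_module tensor_relations_carrier])

sublocale T: free_quotient TC Ker
  by (rule free_quotient.intro) (rule tensor_kernel_submodule)

lemma tensor_relations_kernel: "tensor_relations Q P \<subseteq> Ker"
  unfolding tensor_kernel_def
  by (rule LinearCombinations.module.in_own_span[OF module_free_module tensor_relations_carrier])

section \<open>Bilinear identities modulo the tensor kernel\<close>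

lemma Ker_add_left:
  assumes "X \<in> carrier Q" "X' \<in> carrier Q" "Poly_Mapping.keys y \<subseteq> D"
  shows "basis_elt (X \<oplus>\<^bsub>Q\<^esub> X', y) - (basis_elt (X, y) + basis_elt (X', y)) \<in> Ker"
proof -
  have "basis_elt (X \<oplus>\<^bsub>Q\<^esub> X', y) - basis_elt (X, y) - basis_elt (X', y) \<in> tensor_relations Q P"
    unfolding tensor_relations_def using assms by auto
  then show ?thesis using tensor_relations_kernel by (auto simp: algebra_simps)
qed

lemma Ker_add_right:
  assumes "X \<in> carrier Q" "Poly_Mapping.keys y \<subseteq> D" "Poly_Mapping.keys y' \<subseteq> D"
  shows "basis_elt (X, y + y') - (basis_elt (X, y) + basis_elt (X, y')) \<in> Ker"
proof -
  have "basis_elt (X, y + y') - basis_elt (X, y) - basis_elt (X, y') \<in> tensor_relations Q P"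
    unfolding tensor_relations_def using assms by auto
  then show ?thesis using tensor_relations_kernel by (auto simp: algebra_simps)
qed

lemma Ker_smult_left:
  assumes "X \<in> carrier Q" "Poly_Mapping.keys y \<subseteq> D"
  shows "basis_elt (r \<odot>\<^bsub>Q\<^esub> X, y) - pscale r (basis_elt (X, y)) \<in> Ker"
proof -
  have "basis_elt (r \<odot>\<^bsub>Q\<^esub> X, y) - pscale r (basis_elt (X, y)) \<in> tensor_relations Q P"
    unfolding tensor_relations_def using assms by auto
  then show ?thesis using tensor_relations_kernel by auto
qed

lemma Ker_smult_right:
  assumes "X \<in> carrier Q" "Poly_Mapping.keys y \<subseteq> D"
  shows "basis_elt (X, pscale r y) - pscale r (basis_elt (X, y)) \<in> Ker"
proof -
  have "basis_elt (X, pscale r y) - pscale r (basis_elt (X, y)) \<in> tensor_relations Q P"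
    unfolding tensor_relations_def using assms by auto
  then show ?thesis using tensor_relations_kernel by auto
qed

lemma Ker_zero_right:
  assumes "X \<in> carrier Q"
  shows "basis_elt (X, 0) \<in> Ker"
  using Ker_smult_right[OF assms, of 0 0] by simp

lemma Ker_zero_left:
  assumes "Poly_Mapping.keys y \<subseteq> D"
  shows "basis_elt (coset 0, y) \<in> Ker"
  using Ker_smult_left[OF coset_in_carrier assms, of 0 0] by (simp add: Q_simps)

lemma Ker_sum_right:
  assumes "X \<in> carrier Q" "finite A" "\<And>i. i \<in> A \<Longrightarrow> Poly_Mapping.keys (y i) \<subseteq> D"
  shows "basis_elt (X, \<Sum>i\<in>A. y i) - (\<Sum>i\<in>A. basis_elt (X, y i)) \<in> Ker"
  using assms(2,3)
proof (induction A rule: finite_induct)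
  case (insert i A)
  have "Poly_Mapping.keys (\<Sum>i\<in>A. y i) \<subseteq> D"
    using insert.prems by (intro order_trans[OF keys_sum]) auto
  then have "basis_elt (X, y i + (\<Sum>i\<in>A. y i)) - (basis_elt (X, y i) + basis_elt (X, \<Sum>i\<in>A. y i)) \<in> Ker"
    using assms(1) insert.prems by (intro Ker_add_right) auto
  moreover have "basis_elt (X, \<Sum>i\<in>A. y i) - (\<Sum>i\<in>A. basis_elt (X, y i)) \<in> Ker"
    using insert by auto
  ultimately show ?case
    using T.N_add insert.hyps by (fastforce simp: algebra_simps)
qed (use Ker_zero_right[OF assms(1)] in auto)

text \<open>A lift of the coordinate of a tensor at the basis element \<open>L\<close> of the second
  factor. It is linear in \<open>z\<close>, but because of \<open>rep\<close> its value is
  meaningful only modulo \<open>N\<close>.\<close>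

definition Lam :: "(('b \<Rightarrow>\<^sub>0 'r) set \<times> ('d \<Rightarrow>\<^sub>0 'r) \<Rightarrow>\<^sub>0 'r) \<Rightarrow> 'd \<Rightarrow> ('b \<Rightarrow>\<^sub>0 'r)" where
  "Lam z L = lin_ext (\<lambda>(X, y). pscale (Poly_Mapping.lookup y L) (rep X)) z"

lemma Lam_add: "Lam (z + z') L = Lam z L + Lam z' L"
  and Lam_diff: "Lam (z - z') L = Lam z L - Lam z' L"
  and Lam_pscale: "Lam (pscale r z) L = pscale r (Lam z L)"
  and Lam_zero: "Lam 0 L = 0"
  and Lam_basis_elt: "Lam (basis_elt (X, y)) L = pscale (Poly_Mapping.lookup y L) (rep X)"
  by (simp_all add: Lam_def lin_ext_add lin_ext_diff lin_ext_pscale)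

lemma keys_Lam:
  assumes "Poly_Mapping.keys z \<subseteq> TC"
  shows "Poly_Mapping.keys (Lam z L) \<subseteq> B"
proof -
  have "Poly_Mapping.keys (pscale (Poly_Mapping.lookup y L) (rep X)) \<subseteq> B" if "X \<in> carrier Q" for X y
    by (rule order_trans[OF keys_pscale rep(1)[OF that]])
  then show ?thesis
    unfolding Lam_def using assms by (intro keys_lin_ext) (auto split: prod.splits)
qed

lemma rep_add:
  assumes "X \<in> carrier Q" "X' \<in> carrier Q"
  shows "rep (X \<oplus>\<^bsub>Q\<^esub> X') - (rep X + rep X') \<in> N"
proof -
  have "X \<oplus>\<^bsub>Q\<^esub> X' = coset (rep X + rep X')"
    using assms by (simp add: rep(2) flip: Q_add)
  moreover have "Poly_Mapping.keys (rep X + rep X') \<subseteq> B"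
    using rep(1) assms by (intro order_trans[OF keys_add]) blast
  ultimately show ?thesis
    by (simp add: rep_coset)
qed

lemma rep_smult:
  assumes "X \<in> carrier Q"
  shows "rep (r \<odot>\<^bsub>Q\<^esub> X) - pscale r (rep X) \<in> N"
proof -
  have "r \<odot>\<^bsub>Q\<^esub> X = coset (pscale r (rep X))"
    using assms by (simp add: rep(2) flip: Q_smult)
  moreover have "Poly_Mapping.keys (pscale r (rep X)) \<subseteq> B"
    using rep(1) assms by (intro order_trans[OF keys_pscale]) blast
  ultimately show ?thesis
    by (simp add: rep_coset)
qed

text \<open>Modulo \<open>N\<close> the assignment on pairs \<open>(X, y)\<close> is bilinear, so
  each of the four kinds of relations is sent into \<open>N\<close>.\<close>

lemma Lam_kernel:
  assumes "z \<in> Ker"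
  shows "Lam z L \<in> N"
proof (rule span_induct_gen[OF module_free_module tensor_relations_carrier assms[unfolded tensor_kernel_def]])
  fix z assume "z \<in> tensor_relations Q P"
  then show "Lam z L \<in> N"
    unfolding tensor_relations_def
  proof (elim UnE, goal_cases)
    case 1
    then obtain X X' y where "z = basis_elt (X \<oplus>\<^bsub>Q\<^esub> X', y) - basis_elt (X, y) - basis_elt (X', y)"
      and "X \<in> carrier Q" "X' \<in> carrier Q"
      by blast
    then show ?case
      using N_pscale[OF rep_add, of X X' "Poly_Mapping.lookup y L"]
      by (simp add: Lam_diff Lam_add Lam_basis_elt pscale_diff_right pscale_add_right diff_diff_eq)
  next
    case 2
    then obtain X y y' where "z = basis_elt (X, y \<oplus>\<^bsub>P\<^esub> y') - basis_elt (X, y) - basis_elt (X, y')"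
      by blast
    then show ?case
      by (simp add: Lam_diff Lam_basis_elt lookup_add pscale_add_left)
  next
    case 3
    then obtain X r y where "z = basis_elt (r \<odot>\<^bsub>Q\<^esub> X, y) - pscale r (basis_elt (X, y))" "X \<in> carrier Q"
      by blast
    then show ?case
      using N_pscale[OF rep_smult, of X "Poly_Mapping.lookup y L" r]
      by (simp add: Lam_diff Lam_basis_elt Lam_pscale pscale_diff_right mult.commute)
  next
    case 4
    then obtain X r y where "z = basis_elt (X, r \<odot>\<^bsub>P\<^esub> y) - pscale r (basis_elt (X, y))"
      by blast
    then show ?case
      by (simp add: Lam_diff Lam_basis_elt Lam_pscale)
  qed
qed (auto simp: Lam_zero Lam_add Lam_pscale N_add N_pscale)

text \<open>The expansion of a tensor along the basis of the second factor. Being congruent to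
  \<open>z\<close>, it shows that the coordinates of \<open>z\<close> determine its coset.\<close>

definition normal_form where
  "normal_form z = (\<Sum>L\<in>D. basis_elt (coset (Lam z L), basis_elt L :: 'd \<Rightarrow>\<^sub>0 'r) :: _ \<Rightarrow>\<^sub>0 'r)"

lemma normal_form_add:
  assumes "Poly_Mapping.keys z \<subseteq> TC" "Poly_Mapping.keys z' \<subseteq> TC"
  shows "normal_form (z + z') - (normal_form z + normal_form z') \<in> Ker"
proof -
  have "basis_elt (coset (Lam (z + z') L), basis_elt L)
      - (basis_elt (coset (Lam z L), basis_elt L) + basis_elt (coset (Lam z' L), basis_elt L)) \<in> Ker"
    if "L \<in> D" for L
    using Ker_add_left[of "coset (Lam z L)" "coset (Lam z' L)" "basis_elt L"] that keys_Lam assms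
    by (auto simp: Q_add Lam_add keys_basis_elt coset_in_carrier)
  then have "(\<Sum>L\<in>D. basis_elt (coset (Lam (z + z') L), basis_elt L)
      - (basis_elt (coset (Lam z L), basis_elt L) + basis_elt (coset (Lam z' L), basis_elt L))) \<in> Ker"
    by (rule T.N_sum)
  then show ?thesis
    by (simp add: normal_form_def sum_subtractf sum.distrib)
qed

lemma normal_form_pscale:
  assumes "Poly_Mapping.keys z \<subseteq> TC"
  shows "normal_form (pscale r z) - pscale r (normal_form z) \<in> Ker"
proof -
  have "basis_elt (coset (Lam (pscale r z) L), basis_elt L)
      - pscale r (basis_elt (coset (Lam z L), basis_elt L)) \<in> Ker"
    if "L \<in> D" for L
    using Ker_smult_left[of "coset (Lam z L)" "basis_elt L"] that keys_Lam assms
    by (auto simp: Q_smult Lam_pscale keys_basis_elt coset_in_carrier)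
  then have "(\<Sum>L\<in>D. basis_elt (coset (Lam (pscale r z) L), basis_elt L)
      - pscale r (basis_elt (coset (Lam z L), basis_elt L))) \<in> Ker"
    by (rule T.N_sum)
  then show ?thesis
    by (simp add: normal_form_def sum_subtractf pscale_sum_right)
qed

text \<open>Expand \<open>y\<close> in the basis and use the two scalar relations to move each
  coefficient of \<open>y\<close> to the left factor.\<close>

lemma normal_form_basis_elt:
  assumes "X \<in> carrier Q" "Poly_Mapping.keys y \<subseteq> D"
  shows "normal_form (basis_elt (X, y)) - basis_elt (X, y) \<in> Ker"
proof -
  let ?y = "\<lambda>L. Poly_Mapping.lookup y L"
  have keys: "Poly_Mapping.keys (pscale (?y L) (basis_elt L :: 'd \<Rightarrow>\<^sub>0 'r)) \<subseteq> D" if "L \<in> D" for L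
    using that by (intro order_trans[OF keys_pscale]) (simp add: keys_basis_elt)
  have "basis_elt (coset (Lam (basis_elt (X, y)) L), basis_elt L) - basis_elt (X, pscale (?y L) (basis_elt L)) \<in> Ker"
    if "L \<in> D" for L
  proof -
    have "coset (Lam (basis_elt (X, y)) L) = ?y L \<odot>\<^bsub>Q\<^esub> X"
      using assms by (simp add: Lam_basis_elt rep flip: Q_smult)
    then show ?thesis
      using Ker_smult_left[OF assms(1), of "basis_elt L" "?y L"]
        T.N_diff_sym[OF Ker_smult_right[OF assms(1), of "basis_elt L" "?y L"]] that
      by (auto intro: T.N_diff_trans simp: keys_basis_elt)
  qed
  then have "(\<Sum>L\<in>D. basis_elt (coset (Lam (basis_elt (X, y)) L), basis_elt L)
      - basis_elt (X, pscale (?y L) (basis_elt L))) \<in> Ker"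
    by (rule T.N_sum)
  then have "normal_form (basis_elt (X, y)) - (\<Sum>L\<in>D. basis_elt (X, pscale (?y L) (basis_elt L))) \<in> Ker"
    by (simp add: normal_form_def sum_subtractf)
  moreover have "basis_elt (X, \<Sum>L\<in>D. pscale (?y L) (basis_elt L))
      - (\<Sum>L\<in>D. basis_elt (X, pscale (?y L) (basis_elt L))) \<in> Ker"
    using keys by (intro Ker_sum_right assms finite_D)
  ultimately show ?thesis
    unfolding basis_elt_eq_sum[OF finite_D assms(2), symmetric]
    by (blast intro: T.N_diff_trans T.N_diff_sym)
qed

lemma normal_form:
  assumes "Poly_Mapping.keys z \<subseteq> TC"
  shows "normal_form z - z \<in> Ker"
proof -
  define f where "f b = pscale (Poly_Mapping.lookup z b) (basis_elt b :: _ \<Rightarrow>\<^sub>0 'r)" for b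
  have f: "Poly_Mapping.keys (f b) \<subseteq> TC" "normal_form (f b) - f b \<in> Ker" if "b \<in> Poly_Mapping.keys z" for b
  proof -
    obtain X y where b: "b = (X, y)" by (cases b)
    have Xy: "X \<in> carrier Q" "Poly_Mapping.keys y \<subseteq> D"
      using that assms by (auto simp: b)
    show "Poly_Mapping.keys (f b) \<subseteq> TC"
      using Xy unfolding f_def by (intro order_trans[OF keys_pscale]) (simp add: keys_basis_elt b)
    have "normal_form (f b) - pscale (Poly_Mapping.lookup z b) (normal_form (basis_elt b)) \<in> Ker"
      unfolding f_def using Xy by (intro normal_form_pscale) (simp add: keys_basis_elt b)
    moreover have "pscale (Poly_Mapping.lookup z b) (normal_form (basis_elt b)) - f b \<in> Ker"
      using T.N_pscale[OF normal_form_basis_elt[OF Xy]] by (simp add: f_def b flip: pscale_diff_right)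
    ultimately show "normal_form (f b) - f b \<in> Ker"
      by (rule T.N_diff_trans)
  qed
  \<comment> \<open>Additivity of \<open>normal_form\<close> modulo \<open>Ker\<close> requires
    summands supported in \<open>TC\<close>, so the induction carries this bound along.\<close>
  have "Poly_Mapping.keys (\<Sum>b\<in>A. f b) \<subseteq> TC \<and> normal_form (\<Sum>b\<in>A. f b) - (\<Sum>b\<in>A. f b) \<in> Ker"
    if "finite A" "A \<subseteq> Poly_Mapping.keys z" for A
    using that
  proof (induction A rule: finite_induct)
    case empty
    \<comment> \<open>\<open>normal_form 0\<close> is a sum of generators whose left entry is the
      zero coset; it need not be literally 0, but scaling by 0 puts it in
      \<open>Ker\<close>.\<close>
    have "normal_form 0 = normal_form (pscale 0 0)" by simp
    also have "\<dots> - pscale 0 (normal_form 0) \<in> Ker" by (rule normal_form_pscale) simp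
    finally show ?case by simp
  next
    case (insert b A)
    let ?S = "\<Sum>b\<in>A. f b"
    have IH: "Poly_Mapping.keys ?S \<subseteq> TC" "normal_form ?S - ?S \<in> Ker"
      and b: "b \<in> Poly_Mapping.keys z"
      using insert by auto
    have "normal_form (f b + ?S) - (normal_form (f b) + normal_form ?S) \<in> Ker"
      by (rule normal_form_add[OF f(1)[OF b] IH(1)])
    moreover have "normal_form (f b) + normal_form ?S - (f b + ?S) \<in> Ker"
      using T.N_add[OF f(2)[OF b] IH(2)] by (simp add: algebra_simps)
    ultimately have "normal_form (f b + ?S) - (f b + ?S) \<in> Ker"
      by (rule T.N_diff_trans)
    moreover have "Poly_Mapping.keys (f b + ?S) \<subseteq> TC"
      using f(1)[OF b] IH(1) by (intro order_trans[OF keys_add]) blast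
    ultimately show ?case
      using insert.hyps by simp
  qed
  from this[of "Poly_Mapping.keys z"] show ?thesis
    using poly_mapping_eq_sum_single[of z] by (simp add: f_def pscale_basis_elt)
qed

text \<open>The coordinates with respect to the basis of the second factor identify \<open>(F / N) \<otimes> P\<close>
  with a power of \<open>F / N\<close>.\<close>

lemma Ker_iff_Lam:
  assumes "Poly_Mapping.keys z \<subseteq> TC"
  shows "z \<in> Ker \<longleftrightarrow> (\<forall>L\<in>D. Lam z L \<in> N)"
proof
  assume *: "\<forall>L\<in>D. Lam z L \<in> N"
  have "normal_form z \<in> Ker"
    unfolding normal_form_def
  proof (rule T.N_sum)
    fix L assume "L \<in> D"
    with * have "coset (Lam z L) = coset 0" by (simp add: coset_eq_iff)
    then show "basis_elt (coset (Lam z L), basis_elt L) \<in> Ker"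
      using Ker_zero_left[of "basis_elt L"] \<open>L \<in> D\<close> by (simp add: keys_basis_elt)
  qed
  then show "z \<in> Ker"
    using T.N_diff[OF _ normal_form[OF assms]] by fastforce
qed (use Lam_kernel in blast)

lemma T_coset_eq_iff_Lam:
  assumes "Poly_Mapping.keys z \<subseteq> TC" "Poly_Mapping.keys z' \<subseteq> TC"
  shows "T.coset z = T.coset z' \<longleftrightarrow> (\<forall>L\<in>D. Lam z L - Lam z' L \<in> N)"
proof -
  have "Poly_Mapping.keys (z - z') \<subseteq> TC"
    using assms by (rule keys_diff_subset)
  then show ?thesis
    unfolding T.coset_eq_iff by (simp only: Ker_iff_Lam Lam_diff)
qed

end

section \<open>Squarefree multidegrees\<close>

lemma lookup_to_int [simp]: "Poly_Mapping.lookup (to_int u) t = int (Poly_Mapping.lookup u t)"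
  by (cases "Poly_Mapping.lookup u t = 0") (simp_all add: to_int_def map.rep_eq)

lemma lookup_to_nat [simp]: "Poly_Mapping.lookup (to_nat v) t = nat (Poly_Mapping.lookup v t)"
  by (cases "Poly_Mapping.lookup v t = 0") (simp_all add: to_nat_def map.rep_eq)

lemma lookup_ind_vec [simp]:
  "Poly_Mapping.lookup (ind_vec L) t = (if t \<in> L then 1 else 0)"
  by (simp add: ind_vec_def lookup_sum lookup_single when_def)

lemma to_nat_to_int [simp]: "to_nat (to_int u) = u"
  by (rule poly_mapping_eqI) simp

lemma to_int_to_nat: "nonneg v \<Longrightarrow> to_int (to_nat v) = v"
  by (rule poly_mapping_eqI) (simp add: nonneg_def)

lemma nonneg_to_int [simp]: "nonneg (to_int u)"
  by (simp add: nonneg_def)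

lemma to_nat_inject: "nonneg v \<Longrightarrow> nonneg w \<Longrightarrow> to_nat v = to_nat w \<longleftrightarrow> v = w"
  by (metis to_int_to_nat)

lemma to_nat_add: "nonneg v \<Longrightarrow> nonneg w \<Longrightarrow> to_nat (v + w) = to_nat v + to_nat w"
  by (rule poly_mapping_eqI) (simp add: nonneg_def lookup_add nat_add_distrib)

lemma keys_to_int [simp]: "Poly_Mapping.keys (to_int u) = Poly_Mapping.keys u"
  by (auto simp: in_keys_iff)

lemma keys_ind_vec [simp]: "Poly_Mapping.keys (ind_vec L :: 'n::finite \<Rightarrow>\<^sub>0 'a::comm_semiring_1) = L"
  by (auto simp: in_keys_iff split: if_splits)

lemma to_int_ind_vec [simp]: "to_int (ind_vec L) = ind_vec L"
  by (rule poly_mapping_eqI) simp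

lemma nonneg_add: "nonneg v \<Longrightarrow> nonneg w \<Longrightarrow> nonneg (v + w)"
  by (simp add: nonneg_def lookup_add)

lemma nonneg_diff_trans: "nonneg (u - v) \<Longrightarrow> nonneg (v - w) \<Longrightarrow> nonneg (u - w)"
  using nonneg_add[of "u - v" "v - w"] by simp

lemma zero_one_nonneg: "zero_one_vec v \<Longrightarrow> nonneg v"
proof -
  assume *: "zero_one_vec v"
  have "0 \<le> Poly_Mapping.lookup v t" for t
    using *[unfolded zero_one_vec_def, rule_format, of t] by auto
  then show ?thesis by (simp add: nonneg_def)
qed

lemma keys_add_nonneg:
  "nonneg v \<Longrightarrow> nonneg w \<Longrightarrow> Poly_Mapping.keys (v + w) = Poly_Mapping.keys v \<union> Poly_Mapping.keys w"
  by (auto simp: nonneg_def in_keys_iff lookup_add add_nonneg_eq_0_iff)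

text \<open>Where \<open>v\<close> is 1, a nonnegative integer entry of \<open>\<mu>\<close> is
  large enough exactly when it is nonzero. This is how conditions on degrees become conditions on
  supports.\<close>

lemma zero_one_le_iff:
  assumes "zero_one_vec v" "nonneg \<mu>"
  shows "nonneg (\<mu> - v) \<longleftrightarrow> Poly_Mapping.keys v \<subseteq> Poly_Mapping.keys \<mu>"
proof -
  have "0 \<le> Poly_Mapping.lookup (\<mu> - v) t \<longleftrightarrow> (t \<in> Poly_Mapping.keys v \<longrightarrow> t \<in> Poly_Mapping.keys \<mu>)" for t
  proof -
    have "Poly_Mapping.lookup v t = 0 \<or> Poly_Mapping.lookup v t = 1" "0 \<le> Poly_Mapping.lookup \<mu> t"
      using assms by (auto simp: zero_one_vec_def nonneg_def)
    then show ?thesis by (auto simp: in_keys_iff lookup_minus)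
  qed
  then show ?thesis by (auto simp: nonneg_def)
qed

locale squarefree_presentation = monomial_presentation mle c a s l \<beta>
  for mle :: "('n::{finite,linorder} \<Rightarrow>\<^sub>0 nat) \<Rightarrow> ('n \<Rightarrow>\<^sub>0 nat) \<Rightarrow> bool"
    and c :: "nat \<Rightarrow> nat \<Rightarrow> 'k::field_char_0"
    and a :: "nat \<Rightarrow> nat \<Rightarrow> ('n \<Rightarrow>\<^sub>0 nat)"
    and s l :: nat
    and \<beta> :: "nat \<Rightarrow> ('n \<Rightarrow>\<^sub>0 int)" +
  fixes \<gamma> :: "nat \<Rightarrow> ('n \<Rightarrow>\<^sub>0 int)"
  assumes order: "monomial_order mle"
    and solution: "squarefree_solution c a s l \<gamma> \<beta>"
begin

lemma degree_entry:
  "i \<in> {1..s} \<Longrightarrow> k \<in> {1..l} \<Longrightarrow> c i k \<noteq> 0 \<Longrightarrow> \<gamma> k = to_int (a i k) + \<beta> i"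
  using solution by (auto simp: squarefree_solution_def algebra_simps)

lemma zero_one_\<gamma>: "k \<in> {1..l} \<Longrightarrow> zero_one_vec (\<gamma> k)"
  and zero_one_\<beta>: "i \<in> {1..s} \<Longrightarrow> zero_one_vec (\<beta> i)"
  using solution by (auto simp: squarefree_solution_def)

text \<open>In a fixed multidegree \<open>\<mu>\<close> the module \<open>F\<^sub>0\<close> has at most one monomial in each position, so
  its component is a space of scalar vectors, in which the image of \<open>\<phi>\<close> is spanned by the
  columns of the scalar matrix \<open>c\<close> whose degree divides \<open>\<mu>\<close>.\<close>

definition rows :: "('n \<Rightarrow>\<^sub>0 int) \<Rightarrow> nat set" where
  "rows \<mu> = {i \<in> {1..s}. nonneg (\<mu> - \<beta> i)}"

definition cols :: "('n \<Rightarrow>\<^sub>0 int) \<Rightarrow> nat set" where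
  "cols \<mu> = {k \<in> {1..l}. nonneg (\<mu> - \<gamma> k)}"

definition homog :: "('n \<Rightarrow>\<^sub>0 int) \<Rightarrow> (nat \<Rightarrow> 'k) \<Rightarrow> (nat \<Rightarrow>\<^sub>0 ('n, 'k) mpoly)" where
  "homog \<mu> v = (\<Sum>i\<in>rows \<mu>. Poly_Mapping.single i (Poly_Mapping.single (to_nat (\<mu> - \<beta> i)) (v i)))"

text \<open>Vectors are functions on all natural numbers; the value 0 outside \<open>{1..s}\<close>
  makes equality of vectors equality of functions.\<close>

definition colspace :: "('n \<Rightarrow>\<^sub>0 int) \<Rightarrow> (nat \<Rightarrow> 'k) set" where
  "colspace \<mu> = range (\<lambda>d i. if i \<in> {1..s} then \<Sum>k\<in>cols \<mu>. d k * c i k else 0)"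

text \<open>Applies to arbitrary elements, extracting the part of degree \<open>\<mu>\<close>; on
  vectors supported in \<open>rows \<mu>\<close> it inverts \<open>homog \<mu>\<close>.\<close>

definition coord :: "('n \<Rightarrow>\<^sub>0 int) \<Rightarrow> (nat \<Rightarrow>\<^sub>0 ('n, 'k) mpoly) \<Rightarrow> nat \<Rightarrow> 'k" where
  "coord \<mu> f i = (if i \<in> rows \<mu> then Poly_Mapping.lookup (Poly_Mapping.lookup f i) (to_nat (\<mu> - \<beta> i)) else 0)"

lemma finite_rows [simp]: "finite (rows \<mu>)"
  and finite_cols [simp]: "finite (cols \<mu>)"
  by (simp_all add: rows_def cols_def)

lemma colspaceI: "v = (\<lambda>i. if i \<in> {1..s} then \<Sum>k\<in>cols \<mu>. d k * c i k else 0) \<Longrightarrow> v \<in> colspace \<mu>"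
  by (simp add: colspace_def)

lemma colspaceE:
  assumes "v \<in> colspace \<mu>"
  obtains d where "v = (\<lambda>i. if i \<in> {1..s} then \<Sum>k\<in>cols \<mu>. d k * c i k else 0)"
  using assms by (auto simp: colspace_def)

lemma colspace_add: "v \<in> colspace \<mu> \<Longrightarrow> w \<in> colspace \<mu> \<Longrightarrow> (\<lambda>i. v i + w i) \<in> colspace \<mu>"
  by (elim colspaceE, rule_tac d = "\<lambda>k. d k + da k" in colspaceI)
    (auto simp: fun_eq_iff algebra_simps sum.distrib)

lemma colspace_scale: "v \<in> colspace \<mu> \<Longrightarrow> (\<lambda>i. r * v i) \<in> colspace \<mu>"
  by (elim colspaceE, rule_tac d = "\<lambda>k. r * d k" in colspaceI)
    (auto simp: fun_eq_iff algebra_simps sum_distrib_left)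

lemma colspace_zero [simp]: "(\<lambda>i. 0) \<in> colspace \<mu>"
  by (rule_tac d = "\<lambda>k. 0" in colspaceI) auto

lemma colspace_diff: "v \<in> colspace \<mu> \<Longrightarrow> w \<in> colspace \<mu> \<Longrightarrow> (\<lambda>i. v i - w i) \<in> colspace \<mu>"
  using colspace_add[of v \<mu> "\<lambda>i. - 1 * w i"] colspace_scale[of w \<mu> "- 1"] by simp

lemma colspace_sum:
  "(\<And>x. x \<in> A \<Longrightarrow> v x \<in> colspace \<mu>) \<Longrightarrow> (\<lambda>i. \<Sum>x\<in>A. v x i) \<in> colspace \<mu>"
  by (induction A rule: infinite_finite_induct) (auto intro: colspace_add)

lemma colspace_col:
  "k \<in> cols \<mu> \<Longrightarrow> (\<lambda>i. if i \<in> {1..s} then d * c i k else 0) \<in> colspace \<mu>"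
  by (rule colspaceI[where d = "\<lambda>k'. if k' = k then d else 0"])
    (auto simp: fun_eq_iff if_distrib[of "\<lambda>x. x * _"] cong: if_cong)

lemma colspace_mono: "cols \<mu> \<subseteq> cols \<nu> \<Longrightarrow> colspace \<mu> \<subseteq> colspace \<nu>"
proof
  fix v assume sub: "cols \<mu> \<subseteq> cols \<nu>" and "v \<in> colspace \<mu>"
  then obtain d where v: "v = (\<lambda>i. if i \<in> {1..s} then \<Sum>k\<in>cols \<mu>. d k * c i k else 0)"
    by (auto elim: colspaceE)
  have eq: "(\<Sum>k\<in>cols \<mu>. d k * c i k) = (\<Sum>k\<in>cols \<nu>. (if k \<in> cols \<mu> then d k else 0) * c i k)" for i
    using sub by (intro sum.mono_neutral_cong_left) auto
  then show "v \<in> colspace \<nu>"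
    unfolding v by (intro colspaceI[where d = "\<lambda>k. if k \<in> cols \<mu> then d k else 0"]) (simp only: eq)
qed

text \<open>The exponent of a nonzero entry is \<open>\<gamma> k - \<beta> i\<close>, so
  \<open>\<beta> i \<le> \<gamma> k \<le> \<mu>\<close>.\<close>

lemma cols_entry_rows:
  assumes "k \<in> cols \<mu>" "i \<in> {1..s}" "c i k \<noteq> 0"
  shows "i \<in> rows \<mu>"
proof -
  have "nonneg (\<gamma> k - \<beta> i)"
    using degree_entry[of i k] assms by (simp add: cols_def)
  with assms show ?thesis
    by (auto simp: rows_def cols_def intro: nonneg_diff_trans)
qed

text \<open>Guarantees that \<open>homog\<close>, which ignores entries outside
  \<open>rows \<mu>\<close>, loses nothing on the column space.\<close>

lemma colspace_rows:
  assumes "v \<in> colspace \<mu>" "v i \<noteq> 0"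
  shows "i \<in> rows \<mu>"
proof -
  from assms(1) obtain d where v: "v = (\<lambda>i. if i \<in> {1..s} then \<Sum>k\<in>cols \<mu>. d k * c i k else 0)"
    by (rule colspaceE)
  with assms(2) have i: "i \<in> {1..s}" and "(\<Sum>k\<in>cols \<mu>. d k * c i k) \<noteq> 0"
    by (auto split: if_splits)
  from sum.not_neutral_contains_not_neutral[OF this(2)] obtain k
    where "k \<in> cols \<mu>" "c i k \<noteq> 0" by auto
  with i show ?thesis by (intro cols_entry_rows)
qed

section \<open>Passage between homogeneous elements and scalar vectors\<close>

lemma lookup_homog:
  "Poly_Mapping.lookup (homog \<mu> v) i =
    (if i \<in> rows \<mu> then Poly_Mapping.single (to_nat (\<mu> - \<beta> i)) (v i) else 0)"
  by (simp add: homog_def lookup_sum lookup_single when_def)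

lemma homog_add: "homog \<mu> (\<lambda>i. v i + w i) = homog \<mu> v + homog \<mu> w"
  by (intro poly_mapping_eqI) (simp add: lookup_homog lookup_add single_add)

lemma homog_diff: "homog \<mu> (\<lambda>i. v i - w i) = homog \<mu> v - homog \<mu> w"
  by (intro poly_mapping_eqI) (simp add: lookup_homog lookup_minus single_diff)

lemma homog_zero [simp]: "homog \<mu> (\<lambda>i. 0) = 0"
  by (simp add: homog_def)

lemma homog_sum: "homog \<mu> (\<lambda>i. \<Sum>x\<in>A. v x i) = (\<Sum>x\<in>A. homog \<mu> (v x))"
  by (induction A rule: infinite_finite_induct) (simp_all add: homog_add)

lemma keys_homog: "Poly_Mapping.keys (homog \<mu> v) \<subseteq> {1..s}"
  by (auto simp: in_keys_iff lookup_homog rows_def split: if_splits)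

lemma rows_add: "rows \<mu> \<subseteq> rows (\<mu> + to_int u)"
  and cols_add: "cols \<mu> \<subseteq> cols (\<mu> + to_int u)"
  by (auto simp: rows_def cols_def nonneg_def lookup_add lookup_minus)
    (smt (verit) of_nat_0_le_iff)+

text \<open>Multiplication by a monomial enlarges \<open>rows\<close>; without the support
  assumption, entries that are cut off on the left could reappear on the right.\<close>

lemma pscale_homog:
  assumes "\<And>i. v i \<noteq> 0 \<Longrightarrow> i \<in> rows \<mu>"
  shows "pscale (Poly_Mapping.single u r) (homog \<mu> v) = homog (\<mu> + to_int u) (\<lambda>i. r * v i)"
proof (rule poly_mapping_eqI)
  fix i
  show "Poly_Mapping.lookup (pscale (Poly_Mapping.single u r) (homog \<mu> v)) i =
    Poly_Mapping.lookup (homog (\<mu> + to_int u) (\<lambda>i. r * v i)) i"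
  proof (cases "i \<in> rows \<mu>")
    case True
    then have "to_nat (\<mu> + to_int u - \<beta> i) = u + to_nat (\<mu> - \<beta> i)"
      using to_nat_add[of "to_int u" "\<mu> - \<beta> i"] by (simp add: rows_def algebra_simps)
    with True show ?thesis
      using rows_add[of \<mu> u] by (auto simp: lookup_homog mult_single)
  next
    case False
    with assms have "v i = 0" by auto
    with False show ?thesis by (simp add: lookup_homog)
  qed
qed

lemma pscale_homog_scalar: "pscale (Poly_Mapping.single 0 r) (homog \<mu> v) = homog \<mu> (\<lambda>i. r * v i)"
  by (intro poly_mapping_eqI) (simp add: lookup_homog mult_single)

lemma coord_add: "coord \<mu> (f + g) = (\<lambda>i. coord \<mu> f i + coord \<mu> g i)"
  by (simp add: coord_def lookup_add fun_eq_iff)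

lemma coord_zero [simp]: "coord \<mu> 0 = (\<lambda>i. 0)"
  by (simp add: coord_def fun_eq_iff)

lemma coord_homog:
  assumes "\<And>i. v i \<noteq> 0 \<Longrightarrow> i \<in> rows \<mu>"
  shows "coord \<mu> (homog \<mu> v) = v"
  using assms by (auto simp: coord_def lookup_homog fun_eq_iff)

lemma coord_homog_other: "\<nu> \<noteq> \<mu> \<Longrightarrow> coord \<mu> (homog \<nu> v) = (\<lambda>i. 0)"
  by (auto simp: coord_def lookup_homog fun_eq_iff lookup_single when_def to_nat_inject rows_def)

subsection \<open>The image of the presentation map\<close>

text \<open>By the equations of the squarefree solution, column \<open>k\<close> of the matrix is
  homogeneous of degree \<open>\<gamma> k\<close>.\<close>

lemma phi_monomial:
  assumes "k \<in> {1..l}"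
  shows "phi (Poly_Mapping.single k (Poly_Mapping.single u d)) =
    homog (to_int u + \<gamma> k) (\<lambda>i. if i \<in> {1..s} then d * c i k else 0)"
proof (rule poly_mapping_eqI)
  fix i
  have k: "k \<in> cols (to_int u + \<gamma> k)"
    using assms by (simp add: cols_def)
  show "Poly_Mapping.lookup (phi (Poly_Mapping.single k (Poly_Mapping.single u d))) i =
    Poly_Mapping.lookup (homog (to_int u + \<gamma> k) (\<lambda>i. if i \<in> {1..s} then d * c i k else 0)) i"
  proof (cases "i \<in> {1..s} \<and> c i k \<noteq> 0")
    case True
    then have "i \<in> rows (to_int u + \<gamma> k)" "to_int u + \<gamma> k - \<beta> i = to_int (u + a i k)"
      using cols_entry_rows[OF k] degree_entry[of i k] assms
      by (auto intro!: poly_mapping_eqI simp: lookup_add lookup_minus)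
    with True show ?thesis
      by (simp add: phi_def lookup_sum lookup_single when_def lookup_homog monomial_entry_def mult_single)
  next
    case False
    then show ?thesis
      by (auto simp: phi_def lookup_sum lookup_single when_def lookup_homog monomial_entry_def)
  qed
qed

lemma im_phi_submodule: "LinearCombinations.submodule class_ring im_phi (free_module {1..s})"
proof -
  have keys: "Poly_Mapping.keys (phi g) \<subseteq> {1..s}" for g
    unfolding phi_def
    by (intro keys_lin_ext order_trans[OF keys_sum] UN_least) simp
  have "phi f + phi g = phi (f + g)" "pscale r (phi f) = phi (pscale r f)" for f g r
    by (simp_all add: phi_def lin_ext_add lin_ext_pscale)
  moreover have "0 = phi 0" by (simp add: phi_def)
  moreover have "Poly_Mapping.keys (f + g) \<subseteq> {1..l}" "Poly_Mapping.keys (pscale r f) \<subseteq> {1..l}"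
    if "Poly_Mapping.keys f \<subseteq> {1..l}" "Poly_Mapping.keys g \<subseteq> {1..l}"
    for f g :: "nat \<Rightarrow>\<^sub>0 ('n, 'k) mpoly" and r
    using that keys_add[of f g] keys_pscale[of r f] by auto
  ultimately have closed: "phi f + phi g \<in> im_phi" "pscale r (phi f) \<in> im_phi" "0 \<in> im_phi"
    if "Poly_Mapping.keys f \<subseteq> {1..l}" "Poly_Mapping.keys g \<subseteq> {1..l}" for f g r
    using that unfolding im_phi_def F1_def free_module_simps
    by (simp_all only: image_eqI mem_Collect_eq keys_zero empty_subsetI)
  show ?thesis
  proof (rule LinearCombinations.submodule.intro)
    show "im_phi \<subseteq> carrier (free_module {1..s})"
      unfolding im_phi_def free_module_simps using keys by blast
    show "\<zero>\<^bsub>free_module {1..s}\<^esub> \<in> im_phi"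
      using closed(3)[of 0 0] by simp
  next
    fix v w assume "v \<in> im_phi" "w \<in> im_phi"
    then show "v \<oplus>\<^bsub>free_module {1..s}\<^esub> w \<in> im_phi"
      using closed(1) by (auto simp: im_phi_def F1_def)
  next
    fix r v assume "v \<in> im_phi"
    then show "r \<odot>\<^bsub>free_module {1..s}\<^esub> v \<in> im_phi"
      using closed(2) by (auto simp: im_phi_def F1_def)
  qed (rule module_free_module)
qed

sublocale M: free_quotient "{1..s}" im_phi
  by (rule free_quotient.intro) (rule im_phi_submodule)

lemma M_A_eq: "M_A = M.Q"
  by (simp add: M_A_def F0_def)

lemma cls_eq: "cls g = M.coset g"
  by (simp add: cls_def F0_def)

text \<open>A column \<open>k\<close> with \<open>\<gamma> k \<le> \<mu>\<close> reaches degree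
  \<open>\<mu>\<close> after multiplication by the monomial with exponent
  \<open>\<mu> - \<gamma> k\<close>.\<close>

lemma phi_colspace:
  assumes "v \<in> colspace \<mu>"
  shows "homog \<mu> v \<in> im_phi"
proof -
  from assms obtain d where v: "v = (\<lambda>i. if i \<in> {1..s} then \<Sum>k\<in>cols \<mu>. d k * c i k else 0)"
    by (rule colspaceE)
  have v': "v = (\<lambda>i. \<Sum>k\<in>cols \<mu>. if i \<in> {1..s} then d k * c i k else 0)"
    by (auto simp: v fun_eq_iff)
  have "homog \<mu> (\<lambda>i. if i \<in> {1..s} then d k * c i k else 0) \<in> im_phi" if "k \<in> cols \<mu>" for k
  proof -
    have "to_int (to_nat (\<mu> - \<gamma> k)) + \<gamma> k = \<mu>" and k: "k \<in> {1..l}"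
      using that by (auto simp: cols_def to_int_to_nat)
    then have "homog \<mu> (\<lambda>i. if i \<in> {1..s} then d k * c i k else 0)
        = phi (Poly_Mapping.single k (Poly_Mapping.single (to_nat (\<mu> - \<gamma> k)) (d k)))"
      using phi_monomial[OF k, of "to_nat (\<mu> - \<gamma> k)" "d k"] by simp
    then show ?thesis
      using k by (simp add: im_phi_def F1_def)
  qed
  then show ?thesis
    unfolding v' homog_sum by (rule M.N_sum)
qed

text \<open>The image is a graded submodule: split the preimage into monomials times basis elements.
  Those of total degree \<open>\<mu>\<close> contribute a multiple of a column, all others
  contribute 0.\<close>

lemma coord_im_phi:
  assumes "f \<in> im_phi"
  shows "coord \<mu> f \<in> colspace \<mu>"
proof -
  obtain g where g: "Poly_Mapping.keys g \<subseteq> {1..l}" "f = phi g"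
    using assms by (auto simp: im_phi_def F1_def)
  have phi_add: "phi (f + g) = phi f + phi g" for f g
    by (simp add: phi_def lin_ext_add)
  have single: "coord \<mu> (phi (Poly_Mapping.single k (Poly_Mapping.single u d))) \<in> colspace \<mu>"
    if "k \<in> {1..l}" for k u d
  proof (cases "to_int u + \<gamma> k = \<mu>")
    case True
    then have "k \<in> cols \<mu>" using that by (auto simp: cols_def)
    then have "(\<lambda>i. if i \<in> {1..s} then d * c i k else 0) \<in> colspace \<mu>"
      by (rule colspace_col)
    moreover from this have "coord \<mu> (homog \<mu> (\<lambda>i. if i \<in> {1..s} then d * c i k else 0))
        = (\<lambda>i. if i \<in> {1..s} then d * c i k else 0)"
      by (intro coord_homog) (rule colspace_rows)
    ultimately show ?thesis
      using phi_monomial[OF that, of u d] True by simp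
  next
    case False
    then show ?thesis
      using phi_monomial[OF that, of u d] by (simp add: coord_homog_other)
  qed
  have sum_closed: "coord \<mu> (phi (\<Sum>x\<in>A. h x)) \<in> colspace \<mu>"
    if "\<And>x. x \<in> A \<Longrightarrow> coord \<mu> (phi (h x)) \<in> colspace \<mu>" for h :: "'x \<Rightarrow> _" and A
    using that
    by (induction A rule: infinite_finite_induct)
      (auto simp: phi_def lin_ext_add coord_add colspace_add)
  have "Poly_Mapping.single k p = (\<Sum>u\<in>Poly_Mapping.keys p.
      Poly_Mapping.single k (Poly_Mapping.single u (Poly_Mapping.lookup p u)))"
    for k :: nat and p :: "('n, 'k) mpoly"
  proof -
    have "Poly_Mapping.single k (\<Sum>u\<in>A. h u) = (\<Sum>u\<in>A. Poly_Mapping.single k (h u))"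
      for h :: "_ \<Rightarrow> ('n, 'k) mpoly" and A :: "('n \<Rightarrow>\<^sub>0 nat) set"
      by (induction A rule: infinite_finite_induct) (simp_all add: single_add)
    then show ?thesis
      by (metis poly_mapping_eq_sum_single)
  qed
  then have "coord \<mu> (phi (Poly_Mapping.single k p)) \<in> colspace \<mu>" if "k \<in> {1..l}" for k p
    using single[OF that] by (metis (no_types, lifting) sum_closed)
  then have "coord \<mu> (phi (\<Sum>k\<in>Poly_Mapping.keys g. Poly_Mapping.single k (Poly_Mapping.lookup g k))) \<in> colspace \<mu>"
    using g(1) by (intro sum_closed) blast
  then show ?thesis
    using g(2) by (metis poly_mapping_eq_sum_single)
qed

lemma homog_in_im_phi_iff:
  assumes "\<And>i. v i \<noteq> 0 \<Longrightarrow> i \<in> rows \<mu>"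
  shows "homog \<mu> v \<in> im_phi \<longleftrightarrow> v \<in> colspace \<mu>"
  using phi_colspace coord_im_phi[of "homog \<mu> v" \<mu>] coord_homog[OF assms] by auto

subsection \<open>Standard positions\<close>

text \<open>The pivots of the column space, read from the largest position down because the term
  order compares positions first.\<close>

definition leading :: "('n \<Rightarrow>\<^sub>0 int) \<Rightarrow> nat \<Rightarrow> bool" where
  "leading \<mu> j \<longleftrightarrow> (\<exists>w\<in>colspace \<mu>. w j \<noteq> 0 \<and> (\<forall>i>j. w i = 0))"

definition standard :: "('n \<Rightarrow>\<^sub>0 int) \<Rightarrow> nat set" where
  "standard \<mu> = {j \<in> rows \<mu>. \<not> leading \<mu> j}"

text \<open>Gaussian elimination from the top: an entry at a leading position is cleared by a
  multiple of a vector of the column space that changes only lower entries. The bound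
  \<open>m\<close> is kept because the reduction coefficients must live below
  \<open>j\<close>.\<close>

lemma reduce_to_standard:
  assumes "\<And>i. v i \<noteq> 0 \<Longrightarrow> i \<in> rows \<mu>" "\<And>i. m \<le> i \<Longrightarrow> v i = 0"
  obtains v' where "\<And>i. v' i \<noteq> 0 \<Longrightarrow> i \<in> standard \<mu>" "\<And>i. m \<le> i \<Longrightarrow> v' i = 0"
    "(\<lambda>i. v i - v' i) \<in> colspace \<mu>"
proof -
  have "\<exists>v'. (\<forall>i. v' i \<noteq> 0 \<longrightarrow> i \<in> standard \<mu>) \<and> (\<forall>i\<ge>m. v' i = 0) \<and> (\<lambda>i. v i - v' i) \<in> colspace \<mu>"
    using assms
  proof (induction m arbitrary: v)
    case 0
    then show ?case by (intro exI[of _ "\<lambda>i. 0"]) simp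
  next
    case (Suc m)
    show ?case
    proof (cases "v m = 0 \<or> m \<in> standard \<mu>")
      case True
      \<comment> \<open>Set the entry at \<open>m\<close> aside, reduce the rest, then put it
        back.\<close>
      let ?u = "v(m := 0)"
      have "\<exists>u'. (\<forall>i. u' i \<noteq> 0 \<longrightarrow> i \<in> standard \<mu>) \<and> (\<forall>i\<ge>m. u' i = 0) \<and> (\<lambda>i. ?u i - u' i) \<in> colspace \<mu>"
        by (rule Suc.IH) (use Suc.prems in \<open>auto split: if_splits\<close>)
      then obtain u' where u': "\<forall>i. u' i \<noteq> 0 \<longrightarrow> i \<in> standard \<mu>"
        "\<forall>i\<ge>m. u' i = 0" "(\<lambda>i. ?u i - u' i) \<in> colspace \<mu>"
        by blast
      have "(\<lambda>i. v i - (u'(m := v m)) i) = (\<lambda>i. ?u i - u' i)"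
        using u'(2) by (auto simp: fun_eq_iff)
      then show ?thesis
        using u' True by (intro exI[of _ "u'(m := v m)"]) auto
    next
      case False
      then have "leading \<mu> m"
        using Suc.prems(1)[of m] by (simp add: standard_def)
      then obtain w where w: "w \<in> colspace \<mu>" "w m \<noteq> 0" "\<forall>i>m. w i = 0"
        by (auto simp: leading_def)
      let ?w = "\<lambda>i. v m / w m * w i"
      have sw: "?w \<in> colspace \<mu>"
        by (rule colspace_scale[OF w(1)])
      have rows: "i \<in> rows \<mu>" if "v i - ?w i \<noteq> 0" for i
        using that Suc.prems(1)[of i] colspace_rows[OF w(1), of i] by fastforce
      have zero: "v i - ?w i = 0" if "m \<le> i" for i
        using that Suc.prems(2)[of i] w by (cases "i = m") auto
      obtain u' where u': "\<forall>i. u' i \<noteq> 0 \<longrightarrow> i \<in> standard \<mu>"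
        "\<forall>i\<ge>m. u' i = 0" "(\<lambda>i. v i - ?w i - u' i) \<in> colspace \<mu>"
        using Suc.IH[of "\<lambda>i. v i - ?w i", OF rows zero] by blast
      have "(\<lambda>i. v i - u' i) = (\<lambda>i. (v i - ?w i - u' i) + ?w i)"
        by auto
      then have "(\<lambda>i. v i - u' i) \<in> colspace \<mu>"
        using colspace_add[OF u'(3) sw] by simp
      then show ?thesis
        using u' by (intro exI[of _ u']) auto
    qed
  qed
  then show thesis using that by blast
qed

text \<open>The largest nonzero position of a nonzero vector of the column space is leading.\<close>

lemma standard_zero:
  assumes "\<And>i. v i \<noteq> 0 \<Longrightarrow> i \<in> standard \<mu>" "v \<in> colspace \<mu>"
  shows "v i = 0"
proof (rule ccontr)
  assume "v i \<noteq> 0"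
  let ?A = "{i. v i \<noteq> 0}"
  have "finite ?A"
    using assms(1) by (rule_tac finite_subset[OF _ finite_rows[of \<mu>]]) (auto simp: standard_def)
  define j where "j = Max ?A"
  have "j \<in> ?A"
    unfolding j_def using \<open>finite ?A\<close> \<open>v i \<noteq> 0\<close> by (intro Max_in) auto
  moreover have "\<forall>i>j. v i = 0"
    using Max_ge[OF \<open>finite ?A\<close>] unfolding j_def by (meson leD mem_Collect_eq)
  ultimately have "leading \<mu> j"
    using assms(2) by (auto simp: leading_def)
  with assms(1)[of j] \<open>j \<in> ?A\<close> show False
    by (simp add: standard_def)
qed

lemma standard_unique:
  assumes "\<And>i. v i \<noteq> 0 \<Longrightarrow> i \<in> standard \<mu>" "\<And>i. w i \<noteq> 0 \<Longrightarrow> i \<in> standard \<mu>"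
    and "(\<lambda>i. v i - w i) \<in> colspace \<mu>"
  shows "v = w"
proof
  fix i
  have "i \<in> standard \<mu>" if "v i - w i \<noteq> 0" for i
    using that assms(1)[of i] assms(2)[of i] by (cases "v i = 0") auto
  then have "v i - w i = 0"
    by (intro standard_zero[OF _ assms(3)])
  then show "v i = w i" by simp
qed

lemma homog_support:
  "i \<in> {1..s} \<Longrightarrow> homog (to_int u + \<beta> i) (\<lambda>i'. if i' = i then r else 0)
    = Poly_Mapping.single i (Poly_Mapping.single u r)"
  by (rule poly_mapping_eqI) (auto simp: lookup_homog lookup_single when_def rows_def)

subsection \<open>Initial ideals\<close>

lemma leading_mono: "leading \<mu> j \<Longrightarrow> leading (\<mu> + to_int u) j"
  using colspace_mono[OF cols_add] unfolding leading_def by blast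

lemma mle_refl: "mle u u"
  using order by (simp add: monomial_order_def reflpD)

text \<open>\<open>g\<close> may be inhomogeneous, but its component in the degree of the leading
  monomial lies in the column space. No later position occurs in \<open>g\<close>, so
  \<open>i\<close> is its last nonzero entry.\<close>

lemma leading_of_is_leading:
  assumes "g \<in> im_phi" "is_leading g (u, i)"
  shows "i \<in> {1..s} \<and> leading (to_int u + \<beta> i) i"
proof -
  let ?\<mu> = "to_int u + \<beta> i"
  have u: "u \<in> Poly_Mapping.keys (Poly_Mapping.lookup g i)"
    and max: "\<And>u' i'. u' \<in> Poly_Mapping.keys (Poly_Mapping.lookup g i') \<Longrightarrow> i' \<le> i"
    using assms(2) by (force simp: is_leading_def terms_def term_le_def)+
  then have "i \<in> Poly_Mapping.keys g" by (auto simp: in_keys_iff)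
  then have i: "i \<in> {1..s}" using M.N_sub[OF assms(1)] by auto
  moreover have "coord ?\<mu> g \<in> colspace ?\<mu>"
    by (rule coord_im_phi[OF assms(1)])
  moreover have "coord ?\<mu> g i \<noteq> 0"
    using i u by (simp add: coord_def rows_def in_keys_iff)
  moreover have "coord ?\<mu> g i' = 0" if "i < i'" for i'
    using max[of _ i'] that by (auto simp: coord_def in_keys_iff not_le[symmetric])
  ultimately show ?thesis
    by (auto simp: leading_def)
qed

lemma is_leading_homog:
  assumes "i \<in> {1..s}" "leading (to_int u + \<beta> i) i"
  shows "\<exists>g\<in>im_phi. is_leading g (u, i)"
proof -
  let ?\<mu> = "to_int u + \<beta> i"
  obtain w where w: "w \<in> colspace ?\<mu>" "w i \<noteq> 0" "\<forall>i'>i. w i' = 0"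
    using assms(2) by (auto simp: leading_def)
  have "i \<in> rows ?\<mu>" using assms(1) by (simp add: rows_def)
  then have "(u, i) \<in> terms (homog ?\<mu> w)"
    using w(2) by (simp add: terms_def lookup_homog)
  moreover have "term_le (u', i') (u, i)" if "(u', i') \<in> terms (homog ?\<mu> w)" for u' i'
  proof -
    from that have "w i' \<noteq> 0" "u' = to_nat (?\<mu> - \<beta> i')"
      by (auto simp: terms_def lookup_homog split: if_splits)
    moreover from this(1) have "i' \<le> i" using w(3) by (meson not_le)
    \<comment> \<open>A homogeneous element has one monomial per position, so for
      \<open>i' = i\<close> the monomial is compared with itself.\<close>
    ultimately show ?thesis
      by (cases "i' = i") (auto simp: term_le_def mle_refl)
  qed
  ultimately have "is_leading (homog ?\<mu> w) (u, i)"
    by (auto simp: is_leading_def)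
  then show ?thesis
    using phi_colspace[OF w(1)] by blast
qed

text \<open>Leading positions persist under multiplication by monomials, so passing from the leading
  monomials to their span creates no further monomials.\<close>

lemma single_in_initial_module_iff:
  assumes "i \<in> {1..s}"
  shows "Poly_Mapping.single i (xpow u) \<in> initial_module \<longleftrightarrow> leading (to_int u + \<beta> i) i"
proof
  define G :: "(nat \<Rightarrow>\<^sub>0 ('n, 'k) mpoly) set" where
    "G = {Poly_Mapping.single i (xpow u) | u i. \<exists>g\<in>im_phi. is_leading g (u, i)}"
  have mod: "Module.module class_ring F0" by (simp add: F0_def module_free_module)
  have G: "G \<subseteq> carrier F0"
  proof
    fix x assume "x \<in> G"
    then obtain u i g where "x = Poly_Mapping.single i (xpow u)" "g \<in> im_phi" "is_leading g (u, i)"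
      by (auto simp: G_def)
    with leading_of_is_leading show "x \<in> carrier F0"
      by (simp add: F0_def)
  qed
  {
    assume "leading (to_int u + \<beta> i) i"
    then have "Poly_Mapping.single i (xpow u) \<in> G"
      using is_leading_homog[OF assms] unfolding G_def by blast
    then show "Poly_Mapping.single i (xpow u) \<in> initial_module"
      using LinearCombinations.module.in_own_span[OF mod G] unfolding initial_module_def G_def by blast
  next
    assume "Poly_Mapping.single i (xpow u) \<in> initial_module"
    then have "Poly_Mapping.single i (xpow u) \<in> LinearCombinations.module.span class_ring F0 G"
      by (simp add: initial_module_def G_def)
    \<comment> \<open>Strengthened to every monomial occurring in an element of the span, since the
      span also contains elements that are not monomials.\<close>
    then have "\<forall>i' u'. u' \<in> Poly_Mapping.keys (Poly_Mapping.lookup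
        (Poly_Mapping.single i (xpow u) :: nat \<Rightarrow>\<^sub>0 ('n, 'k) mpoly) i') \<longrightarrow> leading (to_int u' + \<beta> i') i'"
    proof (rule span_induct_gen[OF mod G], goal_cases)
      case 1
      show ?case by (simp add: F0_def)
    next
      case (2 x y)
      then show ?case
        using keys_add by (fastforce simp: F0_def lookup_add)
    next
      case (3 p x)
      show ?case
      proof (intro allI impI)
        fix i' u' assume "u' \<in> Poly_Mapping.keys (Poly_Mapping.lookup (p \<odot>\<^bsub>F0\<^esub> x) i')"
        then have "u' \<in> Poly_Mapping.keys (p * Poly_Mapping.lookup x i')"
          by (simp add: F0_def)
        then obtain u1 u2 where u': "u' = u1 + u2" "u2 \<in> Poly_Mapping.keys (Poly_Mapping.lookup x i')"
          using keys_mult by blast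
        then have "leading (to_int u2 + \<beta> i') i'" using 3 by blast
        then have "leading (to_int u2 + \<beta> i' + to_int u1) i'" by (rule leading_mono)
        moreover have "to_int u2 + \<beta> i' + to_int u1 = to_int u' + \<beta> i'"
          by (rule poly_mapping_eqI) (simp add: u' lookup_add)
        ultimately show "leading (to_int u' + \<beta> i') i'" by simp
      qed
    next
      case (4 x)
      then show ?case
        using leading_of_is_leading by (auto simp: G_def lookup_single when_def split: if_splits)
    qed
    then show "leading (to_int u + \<beta> i) i"
      by (simp add: lookup_single)
  }
qed

lemma cols_keys_cong:
  assumes "nonneg \<mu>" "nonneg \<nu>" "Poly_Mapping.keys \<mu> = Poly_Mapping.keys \<nu>"
  shows "cols \<mu> = cols \<nu>"
  using assms zero_one_le_iff[OF zero_one_\<gamma>] by (auto simp: cols_def)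

text \<open>\<open>Delta_I\<close> tests only the squarefree monomial with the support of
  \<open>b\<close>. After adding \<open>\<beta> i\<close> both degrees still have equal supports,
  hence the same columns and the same leading positions: the initial ideal is squarefree.\<close>

lemma Delta_I_iff:
  assumes "i \<in> {1..s}" "nonneg b"
  shows "Poly_Mapping.keys b \<in> Delta_I i \<longleftrightarrow> i \<in> standard (b + \<beta> i)"
proof -
  have \<beta>: "nonneg (\<beta> i)"
    using assms(1) by (intro zero_one_nonneg zero_one_\<beta>)
  have ind: "nonneg (ind_vec (Poly_Mapping.keys b) :: 'n \<Rightarrow>\<^sub>0 int)"
    by (simp add: nonneg_def)
  have "cols (b + \<beta> i) = cols (ind_vec (Poly_Mapping.keys b) + \<beta> i)"
    using assms(2) \<beta> ind by (intro cols_keys_cong) (auto simp: nonneg_add keys_add_nonneg)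
  then have "leading (b + \<beta> i) i \<longleftrightarrow> leading (ind_vec (Poly_Mapping.keys b) + \<beta> i) i"
    by (simp add: leading_def colspace_def)
  moreover have "i \<in> rows (b + \<beta> i)"
    using assms by (simp add: rows_def)
  ultimately show ?thesis
    using single_in_initial_module_iff[OF assms(1), of "ind_vec (Poly_Mapping.keys b)"]
    by (simp add: Delta_I_def initial_ideal_def standard_def)
qed

subsection \<open>Reduction coefficients\<close>

text \<open>Position \<open>j\<close> is leading in this degree, so the unit vector at
  \<open>j\<close> can be moved below \<open>j\<close> modulo the column space and then reduced to
  standard positions. Independence of the standard positions gives uniqueness, so the
  \<open>THE\<close> in the definition is justified.\<close>

lemma rcoef:
  assumes "j \<in> {1..s}" "nonneg b" "Poly_Mapping.keys b \<notin> Delta_I j"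
  shows "\<And>i. rcoef j b i \<noteq> 0 \<Longrightarrow> 1 \<le> i \<and> i < j \<and> i \<in> standard (b + \<beta> j)"
    and "(\<lambda>i. (if i = j then 1 else 0) - rcoef j b i) \<in> colspace (b + \<beta> j)"
proof -
  let ?\<mu> = "b + \<beta> j" and ?e = "\<lambda>i. if i = j then 1 else 0 :: 'k"
  define R1 where "R1 r \<longleftrightarrow> (\<forall>i. r i \<noteq> 0 \<longrightarrow> 1 \<le> i \<and> i < j \<and> nonneg (?\<mu> - \<beta> i)
        \<and> Poly_Mapping.keys (?\<mu> - \<beta> i) \<in> Delta_I i)" for r :: "nat \<Rightarrow> 'k"
  define R2 where "R2 r \<longleftrightarrow> mon_cls b j = (\<Oplus>\<^bsub>M_A\<^esub>i\<in>{1..<j}. Poly_Mapping.single 0 (r i) \<odot>\<^bsub>M_A\<^esub> mon_cls (?\<mu> - \<beta> i) i)"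
    for r :: "nat \<Rightarrow> 'k"
  have j: "j \<in> rows ?\<mu>" "j \<notin> standard ?\<mu>"
    using assms Delta_I_iff by (auto simp: rows_def)
  have R1: "R1 r \<longleftrightarrow> (\<forall>i. r i \<noteq> 0 \<longrightarrow> i < j \<and> i \<in> standard ?\<mu>)" for r
  proof -
    have "1 \<le> i \<and> i < j \<and> nonneg (?\<mu> - \<beta> i) \<and> Poly_Mapping.keys (?\<mu> - \<beta> i) \<in> Delta_I i
        \<longleftrightarrow> i < j \<and> i \<in> standard ?\<mu>" for i
      using Delta_I_iff[of i "?\<mu> - \<beta> i"] assms(1) by (auto simp: standard_def rows_def)
    then show ?thesis by (simp add: R1_def)
  qed
  have R2: "R2 r \<longleftrightarrow> (\<lambda>i. ?e i - r i) \<in> colspace ?\<mu>" if "R1 r" for r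
  proof -
    have r: "i < j \<and> i \<in> standard ?\<mu>" if "r i \<noteq> 0" for i
      using that \<open>R1 r\<close> R1 by blast
    have "mon_cls b j = M.coset (homog ?\<mu> ?e)"
      using homog_support[OF assms(1), of "to_nat b" 1] assms(2)
      by (simp add: mon_cls_def cls_eq to_int_to_nat)
    moreover have "(\<Oplus>\<^bsub>M_A\<^esub>i\<in>{1..<j}. Poly_Mapping.single 0 (r i) \<odot>\<^bsub>M_A\<^esub> mon_cls (?\<mu> - \<beta> i) i)
      = M.coset (\<Sum>i\<in>{1..<j}. Poly_Mapping.single i (Poly_Mapping.single (to_nat (?\<mu> - \<beta> i)) (r i)))"
    proof -
      have "(\<Oplus>\<^bsub>M.Q\<^esub>i\<in>{1..<j}. M.coset (Poly_Mapping.single i (Poly_Mapping.single (to_nat (?\<mu> - \<beta> i)) (r i))))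
        = M.coset (\<Sum>i\<in>{1..<j}. Poly_Mapping.single i (Poly_Mapping.single (to_nat (?\<mu> - \<beta> i)) (r i)))"
        using assms(1) by (intro M.Q_finsum) auto
      then show ?thesis
        unfolding M_A_eq mon_cls_def cls_eq M.Q_smult by (simp add: mult_single)
    qed
    \<comment> \<open>The reduction sums over \<open>{1..<j}\<close> and \<open>homog\<close> over
      \<open>rows\<close>; \<open>r\<close> vanishes on the indices in only one of the two
      sets.\<close>
    moreover have "(\<Sum>i\<in>{1..<j}. Poly_Mapping.single i (Poly_Mapping.single (to_nat (?\<mu> - \<beta> i)) (r i)))
      = homog ?\<mu> r"
    proof -
      have "r i = 0" if "\<not> i < j" for i using that r by blast
      moreover have "r i = 0" if "\<not> nonneg (?\<mu> - \<beta> i)" for i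
        using that r[of i] by (auto simp: standard_def rows_def)
      ultimately show ?thesis
        unfolding homog_def using assms(1)
        by (intro sum.mono_neutral_cong) (auto simp: rows_def)
    qed
    ultimately have eq: "R2 r \<longleftrightarrow> homog ?\<mu> (\<lambda>i. ?e i - r i) \<in> im_phi"
      unfolding R2_def by (simp only: M.coset_eq_iff homog_diff)
    have "i \<in> rows ?\<mu>" if "?e i - r i \<noteq> 0" for i
      using that r[of i] j by (auto simp: standard_def split: if_splits)
    then show ?thesis
      unfolding eq by (rule homog_in_im_phi_iff)
  qed
  have "leading ?\<mu> j" using j by (simp add: standard_def)
  then obtain w where w: "w \<in> colspace ?\<mu>" "w j \<noteq> 0" "\<forall>i>j. w i = 0"
    by (auto simp: leading_def)
  \<comment> \<open>Normalized to have entry 1 at \<open>j\<close>, so that subtracting it from the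
    unit vector leaves only entries below \<open>j\<close>.\<close>
  let ?w = "\<lambda>i. 1 / w j * w i"
  have sw: "?w \<in> colspace ?\<mu>"
    by (rule colspace_scale[OF w(1)])
  have "i \<in> rows ?\<mu>" if "?e i - ?w i \<noteq> 0" for i
    using that j colspace_rows[OF w(1), of i] by (cases "i = j") auto
  moreover have "?e i - ?w i = 0" if "j \<le> i" for i
    using that w by (cases "i = j") auto
  ultimately obtain r where r: "\<And>i. r i \<noteq> 0 \<Longrightarrow> i \<in> standard ?\<mu>" "\<And>i. j \<le> i \<Longrightarrow> r i = 0"
    "(\<lambda>i. ?e i - ?w i - r i) \<in> colspace ?\<mu>"
    using reduce_to_standard[of "\<lambda>i. ?e i - ?w i" ?\<mu> j] by auto
  have "(\<lambda>i. ?e i - r i) = (\<lambda>i. (?e i - ?w i - r i) + ?w i)"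
    by auto
  then have "(\<lambda>i. ?e i - r i) \<in> colspace ?\<mu>"
    using colspace_add[OF r(3) sw] by simp
  moreover have "R1 r"
    unfolding R1 using r(1,2) by (meson not_le)
  ultimately have "R1 r \<and> R2 r"
    using R2 by blast
  moreover have "r' = r" if "R1 r' \<and> R2 r'" for r'
  proof (rule standard_unique)
    show "r' i \<noteq> 0 \<Longrightarrow> i \<in> standard ?\<mu>" "r i \<noteq> 0 \<Longrightarrow> i \<in> standard ?\<mu>" for i
      using that r(1) R1 by auto
    have "(\<lambda>i. ?e i - r i) \<in> colspace ?\<mu>" "(\<lambda>i. ?e i - r' i) \<in> colspace ?\<mu>"
      using that \<open>R1 r \<and> R2 r\<close> R2 by auto
    from colspace_diff[OF this] show "(\<lambda>i. r' i - r i) \<in> colspace ?\<mu>"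
      by simp
  qed
  ultimately have "\<exists>!r. R1 r \<and> R2 r" by blast
  moreover have "rcoef j b = (THE r. R1 r \<and> R2 r)"
    by (simp add: rcoef_def R1_def R2_def)
  ultimately have "R1 (rcoef j b) \<and> R2 (rcoef j b)"
    by (metis (no_types, lifting) theI')
  then show "\<And>i. rcoef j b i \<noteq> 0 \<Longrightarrow> 1 \<le> i \<and> i < j \<and> i \<in> standard (b + \<beta> j)"
    and "(\<lambda>i. (if i = j then 1 else 0) - rcoef j b i) \<in> colspace (b + \<beta> j)"
    using R1 R2 by (auto simp: R1_def)
qed

end

section \<open>The Koszul complex with coefficients\<close>

lemma poly_mapping_induct_keys [consumes 1, case_names zero single add]:
  fixes f :: "'b \<Rightarrow>\<^sub>0 'r::comm_ring_1"
  assumes "Poly_Mapping.keys f \<subseteq> B"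
    and zero: "P 0"
    and single: "\<And>b r. b \<in> B \<Longrightarrow> P (Poly_Mapping.single b r)"
    and add: "\<And>f g. P f \<Longrightarrow> P g \<Longrightarrow> P (f + g)"
  shows "P f"
proof -
  have "P (\<Sum>b\<in>A. Poly_Mapping.single b (Poly_Mapping.lookup f b))" if "finite A" "A \<subseteq> B" for A
    using that by (induction A rule: finite_induct) (auto intro: assms)
  from this[OF finite_keys assms(1)] show ?thesis
    by (simp flip: poly_mapping_eq_sum_single)
qed

text \<open>Two rings at once, because the same sign occurs as a polynomial in
  \<open>koszul_diff\<close> and as a scalar in the cochains.\<close>

lemma sgn_elt_cases: "(sgn_elt t L :: 'a::comm_ring_1) = 1 \<and> (sgn_elt t L :: 'b::comm_ring_1) = 1
    \<or> (sgn_elt t L :: 'a) = - 1 \<and> (sgn_elt t L :: 'b) = - 1"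
  unfolding sgn_elt_def by (cases "even (card {u \<in> L. u \<le> t} + 1)") simp_all

lemma sgn_elt_mult_xpow:
  "(sgn_elt t L :: ('n::{finite,linorder}, 'k::comm_ring_1) mpoly) * xpow u = Poly_Mapping.single u (sgn_elt t L)"
  using sgn_elt_cases[of t L, where ?'a = "('n, 'k) mpoly" and ?'b = 'k] by (auto simp: single_uminus)

lemma sgn_elt_square [simp]: "sgn_elt t L * sgn_elt t L = (1 :: 'a::comm_ring_1)"
  using sgn_elt_cases[of t L, where ?'a = 'a and ?'b = 'a] by auto

lemma sgn_set_square [simp]: "sgn_set W L * sgn_set W L = (1 :: 'a::comm_ring_1)"
  by (simp add: sgn_set_def flip: prod.distrib)

lemma sgn_set_nonzero [simp]: "sgn_set W L \<noteq> (0 :: 'a::comm_ring_1)"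
  using sgn_set_square[of W L, where ?'a = 'a] by (metis mult_zero_left zero_neq_one)

section \<open>Coefficients and square of the Koszul differential\<close>

lemma koszul_basis_insert:
  "t \<notin> L \<Longrightarrow> insert t L \<in> koszul_basis p \<longleftrightarrow> L \<in> koszul_basis (p - 1)"
  by (auto simp: koszul_basis_def)

text \<open>Regroups the double sum by its target: \<open>L\<close> is reached exactly from the sets
  \<open>insert t L\<close> with \<open>t\<close> outside \<open>L\<close>.\<close>

lemma lookup_koszul_diff:
  "Poly_Mapping.lookup (koszul_diff y) L =
    (\<Sum>t\<in>- L. Poly_Mapping.single (Poly_Mapping.single t 1) (sgn_elt t (insert t L)) * Poly_Mapping.lookup y (insert t L))"
  for y :: "'n::{finite,linorder} set \<Rightarrow>\<^sub>0 ('n, 'k::field) mpoly"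
proof -
  define F where "F L' t = Poly_Mapping.single (Poly_Mapping.single t 1) (sgn_elt t L') * Poly_Mapping.lookup y L'" for L' t
  have "Poly_Mapping.lookup (koszul_diff y) L =
    (\<Sum>L'\<in>UNIV. Poly_Mapping.lookup y L' * (\<Sum>t\<in>L'. if L' - {t} = L then Poly_Mapping.single (Poly_Mapping.single t 1) (sgn_elt t L') else 0))"
    unfolding koszul_diff_def
    by (subst lin_ext_eq_sum[of UNIV])
      (simp_all add: lookup_sum lookup_single when_def sgn_elt_mult_xpow del: One_nat_def)
  also have "\<dots> = (\<Sum>L'\<in>UNIV. \<Sum>t\<in>L'. if L' - {t} = L then F L' t else 0)"
    by (intro sum.cong refl) (auto simp: F_def sum_distrib_left mult.commute intro!: sum.cong)
  also have "\<dots> = (\<Sum>L'\<in>UNIV. \<Sum>t\<in>UNIV. if t \<notin> L \<and> L' = insert t L then F L' t else 0)"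
    by (intro sum.cong refl sum.mono_neutral_cong_left) auto
  also have "\<dots> = (\<Sum>t\<in>UNIV. \<Sum>L'\<in>UNIV. if t \<notin> L \<and> L' = insert t L then F L' t else 0)"
    by (rule sum.swap)
  also have "\<dots> = (\<Sum>t\<in>UNIV. if t \<notin> L then F (insert t L) t else 0)"
    by (intro sum.cong refl) auto
  also have "\<dots> = (\<Sum>t\<in>- L. F (insert t L) t)"
    by (intro sum.mono_neutral_cong_right) auto
  finally show ?thesis
    by (simp add: F_def)
qed

lemma keys_koszul_diff:
  assumes "Poly_Mapping.keys y \<subseteq> koszul_basis p"
  shows "Poly_Mapping.keys (koszul_diff y) \<subseteq> koszul_basis (p - 1)"
proof
  fix L assume "L \<in> Poly_Mapping.keys (koszul_diff y)"
  then have "(\<Sum>t\<in>- L. Poly_Mapping.single (Poly_Mapping.single t 1) (sgn_elt t (insert t L))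
      * Poly_Mapping.lookup y (insert t L)) \<noteq> 0"
    by (simp add: in_keys_iff lookup_koszul_diff)
  from sum.not_neutral_contains_not_neutral[OF this] obtain t
    where "t \<notin> L" "Poly_Mapping.lookup y (insert t L) \<noteq> 0"
    by auto
  then show "L \<in> koszul_basis (p - 1)"
    using assms by (auto simp: in_keys_iff simp flip: koszul_basis_insert)
qed

text \<open>Inserting an element shifts the position of the larger elements only, so exactly one of
  the two signs changes.\<close>

lemma sgn_elt_swap:
  assumes "t \<noteq> u" "t \<notin> L" "u \<notin> L"
  shows "sgn_elt t (insert t L) * sgn_elt u (insert u (insert t L)) =
    - (sgn_elt u (insert u L) * sgn_elt t (insert t (insert u L)) :: 'a::comm_ring_1)"
proof -
  have *: "card {v \<in> insert x A. v \<le> y} = (if x \<le> y then 1 else 0) + card {v \<in> A. v \<le> y}"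
    if "x \<notin> A" for x y and A :: "'b::{finite,linorder} set"
  proof -
    have "{v \<in> insert x A. v \<le> y} = (if x \<le> y then insert x {v \<in> A. v \<le> y} else {v \<in> A. v \<le> y})"
      by auto
    with that show ?thesis by simp
  qed
  have step: "sgn_elt y (insert y (insert x L)) = (if x \<le> y then - 1 else 1) * (sgn_elt y (insert y L) :: 'a)"
    if "x \<noteq> y" "x \<notin> L" for x y
    using that *[of x "insert y L" y] unfolding sgn_elt_def insert_commute[of y x] by simp
  have "sgn_elt u (insert u (insert t L)) = (if t \<le> u then - 1 else 1) * (sgn_elt u (insert u L) :: 'a)"
    "sgn_elt t (insert t (insert u L)) = (if u \<le> t then - 1 else 1) * (sgn_elt t (insert t L) :: 'a)"
    by (rule step; use assms in simp)+
  then show ?thesis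
    using assms(1) by (auto simp: mult.commute)
qed

lemma koszul_diff_koszul_diff: "koszul_diff (koszul_diff y) = 0"
  for y :: "'n::{finite,linorder} set \<Rightarrow>\<^sub>0 ('n, 'k::field) mpoly"
proof (rule poly_mapping_eqI)
  fix L :: "'n set"
  \<comment> \<open>Extension by 0 lets both sums run over \<open>UNIV\<close>, where they can be
    exchanged.\<close>
  define G where "G t u = (if t \<in> L \<or> u \<in> L \<or> t = u then 0
    else Poly_Mapping.single (Poly_Mapping.single t 1 + Poly_Mapping.single u 1)
        (sgn_elt t (insert t L) * sgn_elt u (insert u (insert t L)))
      * Poly_Mapping.lookup y (insert u (insert t L)))" for t u
  have anti: "G t u = - G u t" for t u
    using sgn_elt_swap[of t u L, where ?'a = 'k]
    by (auto simp: G_def insert_commute add.commute single_uminus)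
  have "Poly_Mapping.lookup (koszul_diff (koszul_diff y)) L = (\<Sum>t\<in>- L. \<Sum>u\<in>- insert t L. G t u)"
    by (simp add: lookup_koszul_diff sum_distrib_left G_def mult.assoc[symmetric] mult_single del: One_nat_def)
      (auto intro!: sum.cong split: if_splits simp del: One_nat_def)
  also have "\<dots> = (\<Sum>t\<in>UNIV. \<Sum>u\<in>UNIV. G t u)"
  proof -
    have "(\<Sum>u\<in>- insert t L. G t u) = (\<Sum>u\<in>UNIV. G t u)" for t
      by (rule sum.mono_neutral_left) (auto simp: G_def)
    then have "(\<Sum>t\<in>- L. \<Sum>u\<in>- insert t L. G t u) = (\<Sum>t\<in>- L. \<Sum>u\<in>UNIV. G t u)"
      by simp
    also have "\<dots> = (\<Sum>t\<in>UNIV. \<Sum>u\<in>UNIV. G t u)"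
      by (rule sum.mono_neutral_left) (auto simp: G_def)
    finally show ?thesis .
  qed
  \<comment> \<open>Antisymmetry alone would only give that twice the sum is 0. Pairing
    \<open>t < u\<close> with \<open>u < t\<close> is valid over any field.\<close>
  also have "\<dots> = (\<Sum>t\<in>UNIV. (\<Sum>u | u < t. G t u) + (\<Sum>u | t < u. G t u))"
  proof (intro sum.cong refl)
    fix t
    have "(\<Sum>u\<in>UNIV. G t u) = (\<Sum>u\<in>{u. u < t} \<union> {u. t < u}. G t u)"
      by (intro sum.mono_neutral_right) (auto simp: G_def)
    also have "\<dots> = (\<Sum>u | u < t. G t u) + (\<Sum>u | t < u. G t u)"
      by (intro sum.union_disjoint) auto
    finally show "(\<Sum>u\<in>UNIV. G t u) = \<dots>" .
  qed
  also have "\<dots> = (\<Sum>t\<in>UNIV. \<Sum>u\<in>UNIV. if u < t then G t u else 0) + (\<Sum>t\<in>UNIV. \<Sum>u\<in>UNIV. if t < u then G t u else 0)"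
    by (simp add: sum.distrib sum.If_cases)
  also have "(\<Sum>t\<in>UNIV. \<Sum>u\<in>UNIV. if t < u then G t u else 0) = (\<Sum>u\<in>UNIV. \<Sum>t\<in>UNIV. if t < u then G t u else 0)"
    by (rule sum.swap)
  also have "\<dots> = - (\<Sum>t\<in>UNIV. \<Sum>u\<in>UNIV. if u < t then G t u else 0)"
  proof -
    have "(if t < u then G t u else 0) = - (if t < u then G u t else 0)" for t u
      using anti[of t u] by simp
    then show ?thesis
      by (simp only: sum_negf)
  qed
  finally show "Poly_Mapping.lookup (koszul_diff (koszul_diff y)) L = Poly_Mapping.lookup 0 L"
    by simp
qed

context squarefree_presentation
begin

section \<open>The differential of the tensor complex in coordinates\<close>

lemma free_tensor_koszul: "free_tensor {1..s} im_phi (koszul_basis p :: 'n set set)"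
  by (intro free_tensor.intro free_tensor_axioms.intro M.free_quotient_axioms) simp

text \<open>The coordinate map does not involve the basis set of the second factor, so one
  \<open>lam\<close> serves all Koszul degrees.\<close>

abbreviation lam where
  "lam \<equiv> free_tensor.Lam {1..s} im_phi"

abbreviation tensor_carrier where
  "tensor_carrier p \<equiv> carrier M.Q \<times> carrier (free_module (koszul_basis p :: 'n set set))"

abbreviation tcoset where
  "tcoset p \<equiv> a_r_coset (free_module (tensor_carrier p)) (tensor_kernel M.Q (free_module (koszul_basis p :: 'n set set)))"

abbreviation tensor where
  "tensor p \<equiv> quotient_module (free_module (tensor_carrier p)) (tensor_kernel M.Q (free_module (koszul_basis p :: 'n set set)))"

definition diff_rep where
  "diff_rep = lin_ext (\<lambda>(X, y). basis_elt (id X, koszul_diff y))"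

lemma tensor_product_koszul: "tensor_product M_A (koszul p) = tensor p"
  by (simp add: tensor_product_def M_A_eq koszul_def)

lemma keys_diff_rep:
  assumes "Poly_Mapping.keys z \<subseteq> tensor_carrier p"
  shows "Poly_Mapping.keys (diff_rep z) \<subseteq> tensor_carrier (p - 1)"
  unfolding diff_rep_def
  using assms keys_koszul_diff[of _ p]
  by (intro keys_lin_ext) (fastforce simp: keys_basis_elt split: prod.splits)

lemma lam_diff_rep:
  "lam (diff_rep z) L = (\<Sum>t\<in>- L. pscale (Poly_Mapping.single (Poly_Mapping.single t 1) (sgn_elt t (insert t L)))
    (lam z (insert t L)))"
proof -
  \<comment> \<open>The Koszul degree 0 is an arbitrary choice; it does not enter
    \<open>lam\<close>.\<close>
  interpret T: free_tensor "{1..s}" im_phi "koszul_basis 0 :: 'n set set" by (rule free_tensor_koszul)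
  have "lam (diff_rep z) L = lin_ext (\<lambda>(X, y). pscale (Poly_Mapping.lookup (koszul_diff y) L) (M.rep X)) z"
    unfolding diff_rep_def T.Lam_def lin_ext_lin_ext by (simp add: split_def)
  then show ?thesis
    unfolding T.Lam_def lin_ext_def
    by (simp add: split_def lookup_koszul_diff pscale_sum_left pscale_sum_right mult.left_commute del: One_nat_def)
      (rule sum.swap)
qed

text \<open>Well-definedness of the differential on tensors: the coordinates of the image are
  combinations of coordinates of \<open>z\<close>, which lie in \<open>im_phi\<close>.\<close>

lemma diff_rep_kernel:
  assumes "z \<in> tensor_kernel M.Q (free_module (koszul_basis p))"
  shows "diff_rep z \<in> tensor_kernel M.Q (free_module (koszul_basis (p - 1)))"
proof -
  interpret T: free_tensor "{1..s}" im_phi "koszul_basis p :: 'n set set" by (rule free_tensor_koszul)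
  interpret T': free_tensor "{1..s}" im_phi "koszul_basis (p - 1) :: 'n set set" by (rule free_tensor_koszul)
  have keys: "Poly_Mapping.keys z \<subseteq> tensor_carrier p"
    by (rule T.T.N_sub[OF assms])
  have "lam (diff_rep z) L \<in> im_phi" for L
    unfolding lam_diff_rep using T.Lam_kernel[OF assms] by (intro M.N_sum M.N_pscale)
  then show ?thesis
    using T'.Ker_iff_Lam[OF keys_diff_rep[OF keys]] by blast
qed

lemma tensor_map_tcoset:
  assumes "Poly_Mapping.keys z \<subseteq> tensor_carrier p"
  shows "tensor_map M_A (koszul (p - 1)) id koszul_diff (tcoset p z) = tcoset (p - 1) (diff_rep z)"
proof -
  interpret T: free_tensor "{1..s}" im_phi "koszul_basis p :: 'n set set" by (rule free_tensor_koszul)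
  interpret T': free_tensor "{1..s}" im_phi "koszul_basis (p - 1) :: 'n set set" by (rule free_tensor_koszul)
  have "tensor_map M_A (koszul (p - 1)) id koszul_diff (tcoset p z) = (\<Union>z'\<in>tcoset p z. tcoset (p - 1) (diff_rep z'))"
    by (simp only: tensor_map_def M_A_eq koszul_def diff_rep_def)
  also have "tcoset (p - 1) (diff_rep z') = tcoset (p - 1) (diff_rep z)" if "z' \<in> tcoset p z" for z'
  proof -
    have "z' - z \<in> tensor_kernel M.Q (free_module (koszul_basis p))"
      using that unfolding T.T.coset_eq by blast
    from diff_rep_kernel[OF this] show ?thesis
      unfolding T'.T.coset_eq_iff by (simp add: diff_rep_def lin_ext_diff)
  qed
  then have "(\<Union>z'\<in>tcoset p z. tcoset (p - 1) (diff_rep z')) = (\<Union>z'\<in>tcoset p z. tcoset (p - 1) (diff_rep z))"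
    by (rule SUP_cong[OF refl])
  also have "tcoset p z \<noteq> {}"
    using T.T.N_zero unfolding T.T.coset_eq by (auto intro: exI[of _ z])
  then have "(\<Union>z'\<in>tcoset p z. tcoset (p - 1) (diff_rep z)) = tcoset (p - 1) (diff_rep z)"
    by simp
  finally show ?thesis .
qed

text \<open>On representatives the result is a combination of generators \<open>(X, 0)\<close>,
  which vanish only in the tensor product.\<close>

lemma diff_rep_diff_rep:
  assumes "Poly_Mapping.keys z \<subseteq> tensor_carrier p"
  shows "diff_rep (diff_rep z) \<in> tensor_kernel M.Q (free_module (koszul_basis (p - 1 - 1)))"
proof -
  interpret T: free_tensor "{1..s}" im_phi "koszul_basis (p - 1 - 1) :: 'n set set" by (rule free_tensor_koszul)
  have "diff_rep (diff_rep z) = lin_ext (\<lambda>(X, y). basis_elt (X, 0)) z"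
    unfolding diff_rep_def lin_ext_lin_ext
    by (simp add: split_def koszul_diff_koszul_diff)
  also have "\<dots> = (\<Sum>b\<in>Poly_Mapping.keys z. pscale (Poly_Mapping.lookup z b) (basis_elt (fst b, 0)))"
    by (simp add: lin_ext_def split_def)
  also have "\<dots> \<in> tensor_kernel M.Q (free_module (koszul_basis (p - 1 - 1)))"
    using assms by (intro T.T.N_sum T.T.N_pscale T.Ker_zero_right) auto
  finally show ?thesis .
qed

end

section \<open>Comparison of the two complexes\<close>

lemma homogeneous_poly:
  fixes p :: "('n, 'k::field) mpoly"
  assumes "\<And>u. u \<in> Poly_Mapping.keys p \<Longrightarrow> to_int u = v"
  shows "p = Poly_Mapping.single (to_nat v) (Poly_Mapping.lookup p (to_nat v))"
proof (rule poly_mapping_eqI)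
  fix u
  show "Poly_Mapping.lookup p u =
    Poly_Mapping.lookup (Poly_Mapping.single (to_nat v) (Poly_Mapping.lookup p (to_nat v))) u"
    using assms[of u] by (cases "u \<in> Poly_Mapping.keys p") (auto simp: lookup_single when_def in_keys_iff)
qed

text \<open>The elements of \<open>S\<close> up to \<open>w\<close> split into those in
  \<open>\<tau>\<close> and those outside. This is why a face is weighted by its sign in
  \<open>S\<close>: the weight converts the coboundary sign into the Koszul sign on the
  complement.\<close>

lemma sgn_elt_compare:
  assumes "\<tau> \<subseteq> S" "w \<in> S - \<tau>"
  shows "sgn_elt w (insert w \<tau>) * sgn_set (insert w \<tau>) S =
    (sgn_elt w (S - \<tau>) * sgn_set \<tau> S :: 'a::comm_ring_1)"
proof -
  have "{u \<in> S. u \<le> w} = {u \<in> S - \<tau>. u \<le> w} \<union> {u \<in> \<tau>. u \<le> w}"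
    using assms by auto
  then have S: "card {u \<in> S. u \<le> w} = card {u \<in> S - \<tau>. u \<le> w} + card {u \<in> \<tau>. u \<le> w}"
    by (simp add: card_Un_disjoint disjoint_iff)
  have "{u \<in> insert w \<tau>. u \<le> w} = insert w {u \<in> \<tau>. u \<le> w}"
    by auto
  then have "card {u \<in> insert w \<tau>. u \<le> w} = Suc (card {u \<in> \<tau>. u \<le> w})"
    using assms by simp
  with S have "sgn_elt w (insert w \<tau>) * sgn_elt w S = (sgn_elt w (S - \<tau>) :: 'a)"
    unfolding sgn_elt_def by (simp add: power_add mult.commute mult.left_commute flip: power_mult_distrib)
  moreover have "sgn_set (insert w \<tau>) S = (sgn_elt w S * sgn_set \<tau> S :: 'a)"
    using assms by (simp add: sgn_set_def)
  ultimately show ?thesis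
    by (simp add: mult.assoc[symmetric])
qed

locale squarefree_degree = squarefree_presentation mle c a s l \<beta> \<gamma>
  for mle :: "('n::{finite,linorder} \<Rightarrow>\<^sub>0 nat) \<Rightarrow> ('n \<Rightarrow>\<^sub>0 nat) \<Rightarrow> bool"
    and c :: "nat \<Rightarrow> nat \<Rightarrow> 'k::field_char_0"
    and a :: "nat \<Rightarrow> nat \<Rightarrow> ('n \<Rightarrow>\<^sub>0 nat)"
    and s l :: nat
    and \<beta> \<gamma> :: "nat \<Rightarrow> ('n \<Rightarrow>\<^sub>0 int)" +
  fixes \<alpha> :: "'n \<Rightarrow>\<^sub>0 int"
begin

abbreviation S :: "nat \<Rightarrow> 'n set" where
  "S \<equiv> sigma \<alpha>"

abbreviation deg :: "'n set \<Rightarrow> ('n \<Rightarrow>\<^sub>0 int)" where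
  "deg L \<equiv> \<alpha> - ind_vec L"

subsection \<open>Faces and standard positions\<close>

lemma nonneg_degree:
  assumes "nonneg (deg L - \<beta> i)"
  shows "nonneg (\<alpha> - \<beta> i)" "L \<subseteq> S i"
proof -
  have *: "(if t \<in> L then 1 else 0) \<le> Poly_Mapping.lookup (\<alpha> - \<beta> i) t" for t
    using assms[unfolded nonneg_def, rule_format, of t] by (simp add: lookup_minus)
  have "0 \<le> Poly_Mapping.lookup (\<alpha> - \<beta> i) t" for t
    using *[of t] by (auto split: if_splits)
  then show "nonneg (\<alpha> - \<beta> i)"
    by (simp add: nonneg_def)
  show "L \<subseteq> S i"
  proof
    fix t assume "t \<in> L"
    with *[of t] have "Poly_Mapping.lookup (\<alpha> - \<beta> i) t \<noteq> 0" by auto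
    then show "t \<in> S i" by (simp add: sigma_def in_keys_iff)
  qed
qed

text \<open>Identifies the exponent used in \<open>Delta\<close> and \<open>chi_at\<close> with what
  is left for position \<open>j\<close> once \<open>S j - \<tau>\<close> is given to the Koszul
  factor.\<close>

lemma excess_add:
  assumes "\<tau> \<subseteq> S j"
  shows "ind_vec \<tau> + excess \<alpha> j = deg (S j - \<tau>) - \<beta> j"
  using assms by (intro poly_mapping_eqI) (auto simp: excess_def lookup_add lookup_minus)

lemma Delta_iff:
  assumes "j \<in> {1..s}"
  shows "\<tau> \<in> Delta \<alpha> j \<longleftrightarrow> \<tau> \<subseteq> S j \<and> j \<in> standard (deg (S j - \<tau>))"
proof (cases "nonneg (\<alpha> - \<beta> j) \<and> \<tau> \<subseteq> S j")
  case True
  have excess: "nonneg (excess \<alpha> j)"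
    using True unfolding nonneg_def excess_def sigma_def
    by (auto simp: lookup_minus in_keys_iff) (smt (verit))
  have ind: "nonneg (ind_vec \<tau> :: 'n \<Rightarrow>\<^sub>0 int)"
    by (simp add: nonneg_def)
  have "\<tau> \<union> Poly_Mapping.keys (excess \<alpha> j) = Poly_Mapping.keys (ind_vec \<tau> + excess \<alpha> j)"
    using keys_add_nonneg[OF ind excess] by simp
  then show ?thesis
    using True Delta_I_iff[OF assms nonneg_add[OF ind excess]] excess_add[of \<tau> j]
    by (simp add: Delta_def)
next
  case False
  then show ?thesis
    using nonneg_degree(1) by (auto simp: Delta_def standard_def rows_def)
qed

lemma nonface_not_Delta_I:
  assumes "j \<in> {1..s}" "nonneg (\<alpha> - \<beta> j)" "\<rho> \<subseteq> S j" "\<rho> \<notin> Delta \<alpha> j"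
  shows "nonneg (ind_vec \<rho> + excess \<alpha> j)" "Poly_Mapping.keys (ind_vec \<rho> + excess \<alpha> j) \<notin> Delta_I j"
proof -
  have excess: "nonneg (excess \<alpha> j)"
    using assms(2) unfolding nonneg_def excess_def sigma_def
    by (auto simp: lookup_minus in_keys_iff) (smt (verit))
  have ind: "nonneg (ind_vec \<rho> :: 'n \<Rightarrow>\<^sub>0 int)"
    by (simp add: nonneg_def)
  show *: "nonneg (ind_vec \<rho> + excess \<alpha> j)"
    by (rule nonneg_add[OF ind excess])
  show "Poly_Mapping.keys (ind_vec \<rho> + excess \<alpha> j) \<notin> Delta_I j"
    using assms keys_add_nonneg[OF ind excess] by (simp add: Delta_def)
qed

text \<open>Checked at each \<open>t\<close>. If \<open>\<alpha>\<close> is at least 2 at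
  \<open>t\<close>, then \<open>t\<close> lies in both supports and both sides ask whether
  \<open>t \<in> \<rho>\<close>. If it is 1, then \<open>t\<close> lies in a support exactly when
  the corresponding \<open>\<beta>\<close> is 0 there. If it is 0, then \<open>t\<close> is in
  neither support.\<close>

lemma face_shift_eq:
  assumes "nonneg (\<alpha> - \<beta> j)" "i \<in> {1..s}" "j \<in> {1..s}" "\<rho> \<subseteq> S j"
    and "nonneg (deg (S j - \<rho>) - \<beta> i)"
  shows "face_shift \<alpha> \<rho> j i = S i - (S j - \<rho>)" "S j - \<rho> \<subseteq> S i"
proof -
  show "S j - \<rho> \<subseteq> S i"
    by (rule nonneg_degree(2)[OF assms(5)])
  show "face_shift \<alpha> \<rho> j i = S i - (S j - \<rho>)"
  proof (rule Set.set_eqI)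
    fix t
    have "Poly_Mapping.lookup (\<beta> j) t \<in> {0, 1}" "Poly_Mapping.lookup (\<beta> i) t \<in> {0, 1}"
      using zero_one_\<beta> assms(2,3) by (auto simp: zero_one_vec_def)
    moreover have "Poly_Mapping.lookup (\<beta> j) t \<le> Poly_Mapping.lookup \<alpha> t"
      "Poly_Mapping.lookup (\<beta> i) t \<le> Poly_Mapping.lookup \<alpha> t"
      using assms(1) nonneg_degree(1)[OF assms(5)] by (auto simp: nonneg_def lookup_minus)
    moreover have "t \<in> \<rho> \<Longrightarrow> t \<in> S j" using assms(4) by blast
    ultimately show "t \<in> face_shift \<alpha> \<rho> j i \<longleftrightarrow> t \<in> S i - (S j - \<rho>)"
      by (auto simp: face_shift_def Let_def sigma_def in_keys_iff lookup_minus)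
  qed
qed

subsection \<open>Coordinates of cochains\<close>

text \<open>Indexed by the Koszul degree \<open>p\<close>, so that the differential lowers it by one
  and the shift depending on \<open>j\<close> disappears.\<close>

definition cochain_basis :: "int \<Rightarrow> (nat \<times> 'n set) set" where
  "cochain_basis p = {(j, \<tau>). j \<in> {1..s} \<and> \<tau> \<subseteq> S j \<and> j \<in> standard (deg (S j - \<tau>)) \<and> S j - \<tau> \<in> koszul_basis p}"

text \<open>Complements in \<open>S j\<close> absorb the summand \<open>card (S j)\<close> of the
  shift.\<close>

lemma C_eq: "C \<alpha> t = free_module (cochain_basis (koszul_index \<alpha> t))"
proof -
  have "int (card \<tau>) = t + shift \<alpha> j + 1 \<longleftrightarrow> int (card (S j - \<tau>)) = koszul_index \<alpha> t"
    if "\<tau> \<subseteq> S j" for \<tau> j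
    using that card_mono[OF _ that]
    by (auto simp: card_Diff_subset shift_def koszul_index_def of_nat_diff)
  then have "(SIGMA j:{1..s}. faces (Delta \<alpha> j) (t + shift \<alpha> j)) = cochain_basis (koszul_index \<alpha> t)"
    by (auto simp: faces_def cochain_basis_def koszul_basis_def Delta_iff)
  then show ?thesis by (simp add: C_def)
qed

lemma finite_cochain_basis [simp]: "finite (cochain_basis p)"
  by (rule finite_subset[of _ "{1..s} \<times> UNIV"]) (auto simp: cochain_basis_def)

text \<open>The cochain \<open>x\<close> corresponds to the sum over \<open>L\<close> of the elements of multidegree \<open>deg L\<close>
  with coordinate vectors \<open>component L x\<close>, tensored with \<open>e\<^sub>L\<close>.\<close>

definition component :: "'n set \<Rightarrow> (nat \<times> 'n set \<Rightarrow>\<^sub>0 'k) \<Rightarrow> nat \<Rightarrow> 'k" where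
  "component L x j = (if j \<in> {1..s} \<and> L \<subseteq> S j
     then Poly_Mapping.lookup x (j, S j - L) * sgn_set (S j - L) (S j) else 0)"

lemma component_add: "component L (x + y) = (\<lambda>j. component L x j + component L y j)"
  and component_pscale: "component L (pscale r x) = (\<lambda>j. r * component L x j)"
  and component_zero [simp]: "component L 0 = (\<lambda>j. 0)"
  by (auto simp: component_def fun_eq_iff lookup_add algebra_simps)

lemma component_sum: "component L (\<Sum>i\<in>A. x i) = (\<lambda>j. \<Sum>i\<in>A. component L (x i) j)"
  by (induction A rule: infinite_finite_induct) (simp_all add: component_add)

lemma component_single:
  assumes "j \<in> {1..s}" "\<tau> \<subseteq> S j"
  shows "component L (Poly_Mapping.single (j, \<tau>) r) =
    (\<lambda>i. if i = j \<and> S j - \<tau> = L then r * sgn_set \<tau> (S j) else 0)"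
proof
  fix i
  have "j = i \<and> \<tau> = S i - L \<and> L \<subseteq> S i \<longleftrightarrow> i = j \<and> S j - \<tau> = L"
    using assms(2) by blast
  then show "component L (Poly_Mapping.single (j, \<tau>) r) i =
    (if i = j \<and> S j - \<tau> = L then r * sgn_set \<tau> (S j) else 0)"
    using assms(1) by (auto simp: component_def lookup_single when_def)
qed

lemma component_standard:
  assumes "Poly_Mapping.keys x \<subseteq> cochain_basis p" "component L x j \<noteq> 0"
  shows "j \<in> standard (deg L) \<and> L \<in> koszul_basis p"
proof -
  have "(j, S j - L) \<in> cochain_basis p" "L \<subseteq> S j"
    using assms by (auto simp: component_def in_keys_iff split: if_splits)
  then show ?thesis
    by (auto simp: cochain_basis_def double_diff)
qed

lemma component_inject:
  assumes "Poly_Mapping.keys x \<subseteq> cochain_basis p"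
    and "\<And>L. L \<in> koszul_basis p \<Longrightarrow> component L x = (\<lambda>j. 0)"
  shows "x = 0"
proof (rule ccontr)
  assume "x \<noteq> 0"
  then obtain j \<tau> where x: "(j, \<tau>) \<in> Poly_Mapping.keys x"
    by (metis keys_eq_empty ex_in_conv surj_pair)
  then have j: "j \<in> {1..s}" "\<tau> \<subseteq> S j" "S j - \<tau> \<in> koszul_basis p"
    using assms(1) by (auto simp: cochain_basis_def)
  have "component (S j - \<tau>) x j = 0"
    using assms(2)[OF j(3)] by simp
  moreover have "component (S j - \<tau>) x j \<noteq> 0"
    using x j by (simp add: component_def double_diff in_keys_iff)
  ultimately show False by simp
qed

lemma component_surject:
  assumes "\<And>L j. L \<in> koszul_basis p \<Longrightarrow> v L j \<noteq> 0 \<Longrightarrow> j \<in> standard (deg L)"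
  obtains x where "Poly_Mapping.keys x \<subseteq> cochain_basis p"
    "\<And>L. L \<in> koszul_basis p \<Longrightarrow> component L x = v L"
proof -
  \<comment> \<open>The sign in \<open>component\<close> is its own inverse, hence the same factor
    here.\<close>
  define x where "x = (\<Sum>(j, \<tau>)\<in>cochain_basis p. Poly_Mapping.single (j, \<tau>) (v (S j - \<tau>) j * sgn_set \<tau> (S j)))"
  have lookup: "Poly_Mapping.lookup x (j, \<tau>) = (if (j, \<tau>) \<in> cochain_basis p then v (S j - \<tau>) j * sgn_set \<tau> (S j) else 0)" for j \<tau>
  proof -
    have "Poly_Mapping.lookup x (j, \<tau>) = (\<Sum>b\<in>cochain_basis p. if b = (j, \<tau>) then v (S j - \<tau>) j * sgn_set \<tau> (S j) else 0)"
      unfolding x_def lookup_sum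
      by (intro sum.cong refl) (auto simp: lookup_single when_def split: prod.splits)
    then show ?thesis by simp
  qed
  have "component L x j = v L j" if L: "L \<in> koszul_basis p" for L j
  proof (cases "j \<in> standard (deg L)")
    case True
    then have "L \<subseteq> S j" "j \<in> {1..s}"
      using nonneg_degree(2) by (auto simp: standard_def rows_def)
    with True L show ?thesis
      by (simp add: component_def lookup cochain_basis_def double_diff mult.assoc)
  next
    case False
    then have "v L j = 0" using assms[OF L] by blast
    moreover have "(j, S j - L) \<notin> cochain_basis p" if "L \<subseteq> S j"
      using False that by (auto simp: cochain_basis_def double_diff)
    ultimately show ?thesis
      by (simp add: component_def lookup)
  qed
  moreover have "Poly_Mapping.keys x \<subseteq> cochain_basis p"
    using lookup by (auto simp: in_keys_iff split: if_splits)
  ultimately show thesis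
    using that by blast
qed

subsection \<open>The differentials agree\<close>

definition delta_basis :: "nat \<Rightarrow> 'n set \<Rightarrow> (nat \<times> 'n set \<Rightarrow>\<^sub>0 'k)" where
  "delta_basis j \<tau> = lin_ext (\<lambda>\<rho>. basis_elt (j, \<rho>)) (coboundary (S j) (Delta \<alpha> j) \<tau>) + chi \<alpha> j \<tau>"

lemma delta_eq: "delta \<alpha> = lin_ext (\<lambda>(j, \<tau>). delta_basis j \<tau>)"
  by (simp add: delta_def delta_basis_def)

lemma delta_basis_eq:
  "delta_basis j \<tau> = (\<Sum>w\<in>face_ext (S j) (Delta \<alpha> j) \<tau>.
      Poly_Mapping.single (j, insert w \<tau>) (sgn_elt w (insert w \<tau>)))
    + (\<Sum>w\<in>nonface_ext (S j) (Delta \<alpha> j) \<tau>. chi_at \<alpha> j \<tau> w)"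
  by (simp add: delta_basis_def coboundary_def lin_ext_sum chi_def pscale_basis_elt)

context
  fixes j \<tau> w
  assumes j: "j \<in> {1..s}" and \<tau>: "\<tau> \<in> Delta \<alpha> j" and w: "w \<in> nonface_ext (S j) (Delta \<alpha> j) \<tau>"
begin

lemma chi_at_face:
  shows "insert w \<tau> \<subseteq> S j" "nonneg (\<alpha> - \<beta> j)" "S j - insert w \<tau> = (S j - \<tau>) - {w}"
  using j \<tau> w nonneg_degree(1)[of "S j - \<tau>" j]
  by (auto simp: nonface_ext_def Delta_iff standard_def rows_def)

lemma chi_at_rcoef:
  shows "rcoef j (ind_vec (insert w \<tau>) + excess \<alpha> j) i \<noteq> 0 \<Longrightarrow>
      1 \<le> i \<and> i < j \<and> i \<in> standard (deg (S j - insert w \<tau>))"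
    and "(\<lambda>i. (if i = j then 1 else 0) - rcoef j (ind_vec (insert w \<tau>) + excess \<alpha> j) i)
      \<in> colspace (deg (S j - insert w \<tau>))"
proof -
  have "insert w \<tau> \<notin> Delta \<alpha> j" using w by (simp add: nonface_ext_def)
  note b = nonface_not_Delta_I[OF j chi_at_face(2,1) this]
  show "rcoef j (ind_vec (insert w \<tau>) + excess \<alpha> j) i \<noteq> 0 \<Longrightarrow>
      1 \<le> i \<and> i < j \<and> i \<in> standard (deg (S j - insert w \<tau>))"
    "(\<lambda>i. (if i = j then 1 else 0) - rcoef j (ind_vec (insert w \<tau>) + excess \<alpha> j) i)
      \<in> colspace (deg (S j - insert w \<tau>))"
    using rcoef[OF j b] unfolding excess_add[OF chi_at_face(1)] by simp_all
qed

text \<open>Reduction preserves the degree, so the target face has the same Koszul set as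
  \<open>insert w \<tau>\<close>, now as a complement in \<open>S i\<close>.\<close>

lemma chi_at_face_shift:
  assumes "rcoef j (ind_vec (insert w \<tau>) + excess \<alpha> j) i \<noteq> 0"
  shows "i \<in> {1..s}" "face_shift \<alpha> (insert w \<tau>) j i \<subseteq> S i"
    "S i - face_shift \<alpha> (insert w \<tau>) j i = S j - insert w \<tau>"
proof -
  have i: "i \<in> {1..s}" "nonneg (deg (S j - insert w \<tau>) - \<beta> i)"
    using chi_at_rcoef(1)[OF assms] by (auto simp: standard_def rows_def)
  then show "i \<in> {1..s}" "face_shift \<alpha> (insert w \<tau>) j i \<subseteq> S i"
    "S i - face_shift \<alpha> (insert w \<tau>) j i = S j - insert w \<tau>"
    using face_shift_eq[OF chi_at_face(2) i(1) j chi_at_face(1) i(2)] by auto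
qed

lemma keys_chi_at:
  assumes "S j - \<tau> \<in> koszul_basis p"
  shows "Poly_Mapping.keys (chi_at \<alpha> j \<tau> w) \<subseteq> cochain_basis (p - 1)"
proof -
  have "w \<in> S j - \<tau>" using w by (auto simp: nonface_ext_def)
  then have "S j - insert w \<tau> \<in> koszul_basis (p - 1)"
    using koszul_basis_insert[of w "S j - insert w \<tau>" p] assms
    unfolding chi_at_face(3) by (simp add: insert_absorb)
  then have "(i, face_shift \<alpha> (insert w \<tau>) j i) \<in> cochain_basis (p - 1)"
    if "rcoef j (ind_vec (insert w \<tau>) + excess \<alpha> j) i \<noteq> 0" for i
    using chi_at_face_shift[OF that] chi_at_rcoef(1)[OF that] by (simp add: cochain_basis_def)
  then show ?thesis
    unfolding chi_at_def Let_def
    by (intro order_trans[OF keys_sum] UN_least) auto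
qed

text \<open>The denominator in \<open>chi_at\<close> cancels the sign with which
  \<open>component\<close> weights the target face, leaving a sign independent of
  \<open>i\<close>.\<close>

lemma component_chi_at:
  "component L (chi_at \<alpha> j \<tau> w) = (\<lambda>i. if S j - insert w \<tau> = L
    then sgn_elt w (insert w \<tau>) * sgn_set (insert w \<tau>) (S j) * rcoef j (ind_vec (insert w \<tau>) + excess \<alpha> j) i else 0)"
proof
  fix i
  let ?r = "rcoef j (ind_vec (insert w \<tau>) + excess \<alpha> j)"
  let ?f = "\<lambda>i. face_shift \<alpha> (insert w \<tau>) j i"
  let ?c = "\<lambda>i. sgn_elt w (insert w \<tau>) * ?r i * (sgn_set (insert w \<tau>) (S j) / sgn_set (?f i) (S i)) :: 'k"
  have "component L (chi_at \<alpha> j \<tau> w) i =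
    (\<Sum>i'\<in>{i'. 1 \<le> i' \<and> i' < j \<and> ?r i' \<noteq> 0}. component L (Poly_Mapping.single (i', ?f i') (?c i')) i)"
    by (simp add: chi_at_def Let_def component_sum)
  also have "\<dots> = (\<Sum>i'\<in>{i'. 1 \<le> i' \<and> i' < j \<and> ?r i' \<noteq> 0}. if i' = i then
      (if S j - insert w \<tau> = L then ?c i * sgn_set (?f i) (S i) else 0) else 0)"
  proof (intro sum.cong refl)
    fix i' assume "i' \<in> {i'. 1 \<le> i' \<and> i' < j \<and> ?r i' \<noteq> 0}"
    then have "?r i' \<noteq> 0" by simp
    note f = chi_at_face_shift[OF this]
    show "component L (Poly_Mapping.single (i', ?f i') (?c i')) i = (if i' = i then
      (if S j - insert w \<tau> = L then ?c i * sgn_set (?f i) (S i) else 0) else 0)"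
      using f(3) by (auto simp: component_single[OF f(1,2)])
  qed
  also have "\<dots> = (if S j - insert w \<tau> = L then sgn_elt w (insert w \<tau>) * sgn_set (insert w \<tau>) (S j) * ?r i else 0)"
    using chi_at_rcoef(1)[of i] by (auto simp: sum.delta mult_ac)
  finally show "component L (chi_at \<alpha> j \<tau> w) i =
    (if S j - insert w \<tau> = L then sgn_elt w (insert w \<tau>) * sgn_set (insert w \<tau>) (S j) * ?r i else 0)" .
qed

end

lemma keys_delta:
  assumes "Poly_Mapping.keys x \<subseteq> cochain_basis p"
  shows "Poly_Mapping.keys (delta \<alpha> x) \<subseteq> cochain_basis (p - 1)"
  unfolding delta_eq
proof (rule keys_lin_ext)
  fix b assume "b \<in> Poly_Mapping.keys x"
  then obtain j \<tau> where b: "b = (j, \<tau>)" and j: "j \<in> {1..s}" "\<tau> \<subseteq> S j" "j \<in> standard (deg (S j - \<tau>))"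
    "S j - \<tau> \<in> koszul_basis p"
    using assms by (auto simp: cochain_basis_def)
  then have \<tau>: "\<tau> \<in> Delta \<alpha> j" by (simp add: Delta_iff)
  have "(j, insert w \<tau>) \<in> cochain_basis (p - 1)" if "w \<in> face_ext (S j) (Delta \<alpha> j) \<tau>" for w
  proof -
    have w: "w \<in> S j - \<tau>" "insert w \<tau> \<in> Delta \<alpha> j" using that by (auto simp: face_ext_def)
    then have "S j - insert w \<tau> \<in> koszul_basis (p - 1)"
      using koszul_basis_insert[of w "S j - insert w \<tau>" p] j(4)
      by (metis Diff_iff Diff_insert insertCI insert_Diff)
    then show ?thesis
      using w j(1) by (simp add: cochain_basis_def Delta_iff)
  qed
  then have "Poly_Mapping.keys (delta_basis j \<tau>) \<subseteq> cochain_basis (p - 1)"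
    unfolding delta_basis_eq using keys_chi_at[OF j(1) \<tau> _ j(4)]
    by (intro order_trans[OF keys_add] Un_least order_trans[OF keys_sum] UN_least) auto
  then show "Poly_Mapping.keys (case b of (j, \<tau>) \<Rightarrow> delta_basis j \<tau>) \<subseteq> cochain_basis (p - 1)"
    by (simp add: b)
qed

text \<open>At a face extension the two differentials agree exactly. At a non-face extension they
  differ by a multiple of the unit vector at \<open>j\<close> minus its reduction, which lies in the
  column space.\<close>

lemma component_delta_basis:
  assumes j: "j \<in> {1..s}" "\<tau> \<in> Delta \<alpha> j"
  shows "(\<lambda>i. component L (delta_basis j \<tau>) i
      - (\<Sum>t\<in>- L. sgn_elt t (insert t L) * component (insert t L) (Poly_Mapping.single (j, \<tau>) 1) i)) \<in> colspace (deg L)"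
proof -
  define F where "F = face_ext (S j) (Delta \<alpha> j) \<tau>"
  define G where "G = nonface_ext (S j) (Delta \<alpha> j) \<tau>"
  define e where "e i = (if i = j then 1 else 0 :: 'k)" for i
  define r where "r w = rcoef j (ind_vec (insert w \<tau>) + excess \<alpha> j)" for w
  define q where "q w = (sgn_elt w (S j - \<tau>) * sgn_set \<tau> (S j) :: 'k)" for w
  have \<tau>: "\<tau> \<subseteq> S j" using j by (simp add: Delta_iff)
  have FG: "S j - \<tau> = F \<union> G" "F \<inter> G = {}"
    by (auto simp: F_def G_def face_ext_def nonface_ext_def)
  have F: "component L (Poly_Mapping.single (j, insert w \<tau>) (sgn_elt w (insert w \<tau>))) i
      = (if S j - \<tau> - {w} = L then q w * e i else 0)" if "w \<in> F" for w i
  proof -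
    have w: "w \<in> S j - \<tau>" using that FG by blast
    then have "insert w \<tau> \<subseteq> S j" using \<tau> by blast
    moreover have "S j - insert w \<tau> = S j - \<tau> - {w}" by blast
    ultimately show ?thesis
      by (simp add: component_single[OF j(1)] sgn_elt_compare[OF \<tau> w] q_def e_def)
  qed
  have G: "component L (chi_at \<alpha> j \<tau> w) i = (if S j - \<tau> - {w} = L then q w * r w i else 0)" if "w \<in> G" for w i
  proof -
    have w: "w \<in> S j - \<tau>" using that FG by blast
    show ?thesis
      using that chi_at_face(3)[OF j, of w]
      by (simp add: component_chi_at[OF j] sgn_elt_compare[OF \<tau> w] q_def r_def G_def)
  qed
  have "(\<Sum>t\<in>- L. sgn_elt t (insert t L) * component (insert t L) (Poly_Mapping.single (j, \<tau>) 1) i)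
    = (\<Sum>t\<in>UNIV. if t \<notin> L \<and> S j - \<tau> = insert t L then q t * e i else 0)" for i
    by (intro sum.mono_neutral_cong_left) (auto simp: component_single[OF j(1) \<tau>] q_def e_def)
  also have "\<dots> i = (\<Sum>t\<in>F \<union> G. if S j - \<tau> - {t} = L then q t * e i else 0)" for i
    unfolding FG(1)[symmetric] by (intro sum.mono_neutral_cong_right) auto
  also have "\<dots> i = (\<Sum>w\<in>F. if S j - \<tau> - {w} = L then q w * e i else 0)
      + (\<Sum>w\<in>G. if S j - \<tau> - {w} = L then q w * e i else 0)" for i
    using FG(2) by (intro sum.union_disjoint) auto
  finally have rhs: "(\<Sum>t\<in>- L. sgn_elt t (insert t L) * component (insert t L) (Poly_Mapping.single (j, \<tau>) 1) i)
    = (\<Sum>w\<in>F. if S j - \<tau> - {w} = L then q w * e i else 0)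
      + (\<Sum>w\<in>G. if S j - \<tau> - {w} = L then q w * e i else 0)" for i .
  have lhs: "component L (delta_basis j \<tau>) i = (\<Sum>w\<in>F. if S j - \<tau> - {w} = L then q w * e i else 0)
      + (\<Sum>w\<in>G. if S j - \<tau> - {w} = L then q w * r w i else 0)" for i
    unfolding delta_basis_eq component_add component_sum F_def[symmetric] G_def[symmetric]
    by (simp add: F G)
  \<comment> \<open>The minus sign appears because the reduction is on the cochain side and the unit
    vector on the Koszul side.\<close>
  have "(\<lambda>i. - (if S j - \<tau> - {w} = L then q w else 0) * (e i - r w i)) \<in> colspace (deg L)" if "w \<in> G" for w
  proof (cases "S j - \<tau> - {w} = L")
    case True
    then show ?thesis
      using chi_at_rcoef(2)[OF j, of w] chi_at_face(3)[OF j, of w] that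
      unfolding G_def[symmetric] e_def r_def by (intro colspace_scale) simp
  qed simp
  then have "(\<lambda>i. \<Sum>w\<in>G. - (if S j - \<tau> - {w} = L then q w else 0) * (e i - r w i)) \<in> colspace (deg L)"
    by (rule colspace_sum)
  also have "(\<lambda>i. \<Sum>w\<in>G. - (if S j - \<tau> - {w} = L then q w else 0) * (e i - r w i))
    = (\<lambda>i. component L (delta_basis j \<tau>) i
      - (\<Sum>t\<in>- L. sgn_elt t (insert t L) * component (insert t L) (Poly_Mapping.single (j, \<tau>) 1) i))"
    unfolding lhs rhs by (auto simp: fun_eq_iff algebra_simps simp flip: sum_subtractf intro!: sum.cong)
  finally show ?thesis .
qed

lemma component_delta:
  assumes "Poly_Mapping.keys x \<subseteq> cochain_basis p"
  shows "(\<lambda>i. component L (delta \<alpha> x) i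
      - (\<Sum>t\<in>- L. sgn_elt t (insert t L) * component (insert t L) x i)) \<in> colspace (deg L)"
  using assms
proof (induction x rule: poly_mapping_induct_keys)
  case zero
  show ?case by (simp add: delta_eq)
next
  case (single b r)
  obtain j \<tau> where b: "b = (j, \<tau>)" by (cases b)
  have "j \<in> {1..s}" "\<tau> \<in> Delta \<alpha> j"
    using single by (auto simp: b cochain_basis_def Delta_iff)
  from colspace_scale[OF component_delta_basis[OF this], of r L]
  have "(\<lambda>i. component L (pscale r (delta_basis j \<tau>)) i
      - (\<Sum>t\<in>- L. sgn_elt t (insert t L) * component (insert t L) (pscale r (Poly_Mapping.single (j, \<tau>) 1)) i)) \<in> colspace (deg L)"
    unfolding component_pscale by (simp add: right_diff_distrib sum_distrib_left mult.left_commute)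
  then show ?case
    by (simp add: delta_eq b)
next
  case (add x y)
  from colspace_add[OF this] show ?case
    by (simp add: delta_eq lin_ext_add component_add algebra_simps sum.distrib)
qed

subsection \<open>The comparison map\<close>

text \<open>Otherwise the simplifier turns \<open>{1..s}\<close> into \<open>{Suc 0..s}\<close>, after which the facts of
  \<^locale>\<open>free_tensor\<close> instantiated with \<open>{1..s}\<close> no longer match.\<close>

declare One_nat_def [simp del]

definition comparison_basis ::
  "nat \<Rightarrow> 'n set \<Rightarrow> ((nat \<Rightarrow>\<^sub>0 ('n, 'k) mpoly) set \<times> ('n set \<Rightarrow>\<^sub>0 ('n, 'k) mpoly) \<Rightarrow>\<^sub>0 ('n, 'k) mpoly)" where
  "comparison_basis j \<tau> = basis_elt (mon_cls (deg (S j - \<tau>) - \<beta> j) j, basis_elt (S j - \<tau>))"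

text \<open>Not a \<open>lin_ext\<close>, since the coefficients pass from the field to constant
  polynomials. Summing over a fixed finite index set makes linearity immediate.\<close>

definition comparison ::
  "(nat \<times> 'n set \<Rightarrow>\<^sub>0 'k) \<Rightarrow> ((nat \<Rightarrow>\<^sub>0 ('n, 'k) mpoly) set \<times> ('n set \<Rightarrow>\<^sub>0 ('n, 'k) mpoly) \<Rightarrow>\<^sub>0 ('n, 'k) mpoly)" where
  "comparison x = (\<Sum>b\<in>{1..s} \<times> UNIV. pscale (Poly_Mapping.single 0 (Poly_Mapping.lookup x b * sgn_set (snd b) (S (fst b))))
     (comparison_basis (fst b) (snd b)))"

lemma comparison_add: "comparison (x + y) = comparison x + comparison y"
  by (simp add: comparison_def lookup_add distrib_right single_add pscale_add_left sum.distrib)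

lemma comparison_zero [simp]: "comparison 0 = 0"
  by (simp add: comparison_def)

lemma comparison_pscale: "comparison (pscale r x) = pscale (Poly_Mapping.single 0 r) (comparison x)"
  by (simp add: comparison_def pscale_sum_right mult_single mult.assoc)

lemma comparison_single:
  assumes "j \<in> {1..s}"
  shows "comparison (Poly_Mapping.single (j, \<tau>) r) =
    pscale (Poly_Mapping.single 0 (r * sgn_set \<tau> (S j))) (comparison_basis j \<tau>)"
proof -
  have "comparison (Poly_Mapping.single (j, \<tau>) r) = (\<Sum>b\<in>{1..s} \<times> UNIV. if b = (j, \<tau>)
    then pscale (Poly_Mapping.single 0 (r * sgn_set \<tau> (S j))) (comparison_basis j \<tau>) else 0)"
    unfolding comparison_def by (intro sum.cong refl) (auto simp: lookup_single when_def)
  also have "\<dots> = pscale (Poly_Mapping.single 0 (r * sgn_set \<tau> (S j))) (comparison_basis j \<tau>)"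
    using assms by simp
  finally show ?thesis .
qed

lemma mon_cls_eq: "mon_cls b j = M.coset (Poly_Mapping.single j (xpow (to_nat b)))"
  by (simp add: mon_cls_def cls_eq)

lemma keys_comparison_basis:
  assumes "(j, \<tau>) \<in> cochain_basis p"
  shows "Poly_Mapping.keys (comparison_basis j \<tau>) \<subseteq> tensor_carrier p"
proof -
  have j: "{j} \<subseteq> {1..s}" "S j - \<tau> \<in> koszul_basis p"
    using assms by (auto simp: cochain_basis_def)
  then have "M.coset (Poly_Mapping.single j (xpow (to_nat (deg (S j - \<tau>) - \<beta> j)))) \<in> carrier M.Q"
    by (intro M.coset_in_carrier) simp
  with j(2) show ?thesis
    unfolding comparison_basis_def mon_cls_eq by (simp add: keys_basis_elt)
qed

lemma keys_comparison:
  assumes "Poly_Mapping.keys x \<subseteq> cochain_basis p"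
  shows "Poly_Mapping.keys (comparison x) \<subseteq> tensor_carrier p"
  using assms
proof (induction x rule: poly_mapping_induct_keys)
  case (single b r)
  then obtain j \<tau> where b: "b = (j, \<tau>)" "(j, \<tau>) \<in> cochain_basis p" by (cases b) auto
  then have j: "j \<in> {1..s}" by (simp add: cochain_basis_def)
  show ?case
    unfolding b(1) comparison_single[OF j]
    by (rule order_trans[OF keys_pscale keys_comparison_basis[OF b(2)]])
next
  case (add x y)
  then show ?case
    unfolding comparison_add by (intro order_trans[OF keys_add] Un_least)
qed simp

section \<open>Coordinates of comparison images\<close>

lemma lam_comparison_basis:
  assumes "(j, \<tau>) \<in> cochain_basis p"
  shows "lam (comparison_basis j \<tau>) L - homog (deg L) (\<lambda>i. if i = j \<and> S j - \<tau> = L then 1 else 0) \<in> im_phi"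
proof -
  interpret T: free_tensor "{1..s}" im_phi "koszul_basis p :: 'n set set" by (rule free_tensor_koszul)
  have j: "j \<in> {1..s}" "nonneg (deg (S j - \<tau>) - \<beta> j)"
    using assms by (auto simp: cochain_basis_def standard_def rows_def)
  show ?thesis
  proof (cases "S j - \<tau> = L")
    case True
    have "Poly_Mapping.single j (xpow (to_nat (deg L - \<beta> j))) = homog (deg L) (\<lambda>i. if i = j then 1 else 0)"
      using homog_support[OF j(1), of "to_nat (deg L - \<beta> j)" 1] j(2) True by (simp add: to_int_to_nat)
    moreover have "{j} \<subseteq> {1..s}" using j(1) by simp
    then have "Poly_Mapping.keys (Poly_Mapping.single j (xpow (to_nat (deg L - \<beta> j))) :: nat \<Rightarrow>\<^sub>0 ('n, 'k) mpoly) \<subseteq> {1..s}"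
      by simp
    note M.rep_coset[OF this]
    moreover have "lam (comparison_basis j \<tau>) L = M.rep (M.coset (Poly_Mapping.single j (xpow (to_nat (deg L - \<beta> j)))))"
      by (simp add: comparison_basis_def T.Lam_basis_elt mon_cls_eq True basis_elt_def[of L])
    ultimately show ?thesis
      using True by simp
  next
    case False
    then have "lam (comparison_basis j \<tau>) L = 0"
      by (simp add: comparison_basis_def T.Lam_basis_elt) (simp add: basis_elt_def lookup_single)
    with False show ?thesis by simp
  qed
qed

text \<open>Turns questions about tensors in the image into questions about the scalar vectors
  \<open>component L x\<close> modulo \<open>colspace (deg L)\<close>.\<close>

lemma lam_comparison:
  assumes "Poly_Mapping.keys x \<subseteq> cochain_basis p"
  shows "lam (comparison x) L - homog (deg L) (component L x) \<in> im_phi"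
  using assms
proof (induction x rule: poly_mapping_induct_keys)
  interpret T: free_tensor "{1..s}" im_phi "koszul_basis p :: 'n set set" by (rule free_tensor_koszul)
  {
    case zero
    show ?case by (simp add: T.Lam_zero)
  next
    case (single b r)
    then obtain j \<tau> where b: "b = (j, \<tau>)" "(j, \<tau>) \<in> cochain_basis p" by (cases b) auto
    then have j: "j \<in> {1..s}" "\<tau> \<subseteq> S j" by (simp_all add: cochain_basis_def)
    let ?q = "r * sgn_set \<tau> (S j)"
    have "component L (Poly_Mapping.single (j, \<tau>) r) = (\<lambda>i. ?q * (if i = j \<and> S j - \<tau> = L then 1 else 0))"
      using component_single[OF j, of L r] by (auto simp: fun_eq_iff)
    then show ?case
      using M.N_pscale[OF lam_comparison_basis[OF b(2)], of "Poly_Mapping.single 0 ?q" L]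
      unfolding b(1) comparison_single[OF j(1)] T.Lam_pscale
      by (simp only: pscale_diff_right pscale_homog_scalar)
  next
    case (add x y)
    from M.N_add[OF this] show ?case
      by (simp add: comparison_add component_add T.Lam_add homog_add algebra_simps)
  }
qed

text \<open>The basis element \<open>L\<close> already has degree \<open>ind_vec L\<close>, which
  leaves \<open>deg L\<close> for its coordinate; this can hold only modulo \<open>im_phi\<close>,
  as \<open>rep\<close> need not respect degrees.\<close>

definition homogeneous where
  "homogeneous p z \<longleftrightarrow> Poly_Mapping.keys z \<subseteq> tensor_carrier p \<and>
    (\<forall>L. \<exists>v. (\<forall>i. v i \<noteq> 0 \<longrightarrow> i \<in> rows (deg L)) \<and> lam z L - homog (deg L) v \<in> im_phi)"

text \<open>The factor \<open>x_t\<close> in the Koszul differential raises degree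
  \<open>deg (insert t L)\<close> to \<open>deg L\<close>.\<close>

lemma diff_rep_homog:
  assumes "\<And>t. t \<notin> L \<Longrightarrow> (\<forall>i. v t i \<noteq> 0 \<longrightarrow> i \<in> rows (deg (insert t L)))"
    and "\<And>t. t \<notin> L \<Longrightarrow> lam z (insert t L) - homog (deg (insert t L)) (v t) \<in> im_phi"
  shows "lam (diff_rep z) L - homog (deg L) (\<lambda>i. \<Sum>t\<in>- L. sgn_elt t (insert t L) * v t i) \<in> im_phi"
proof -
  have *: "pscale (Poly_Mapping.single (Poly_Mapping.single t 1) (sgn_elt t (insert t L))) (homog (deg (insert t L)) (v t))
    = homog (deg L) (\<lambda>i. sgn_elt t (insert t L) * v t i)" if "t \<notin> L" for t
  proof -
    have eq: "deg (insert t L) + to_int (Poly_Mapping.single t 1) = deg L"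
      using that by (intro poly_mapping_eqI) (auto simp: lookup_add lookup_minus lookup_single when_def)
    have "v t i \<noteq> 0 \<Longrightarrow> i \<in> rows (deg (insert t L))" for i
      using assms(1)[OF that] by blast
    then show ?thesis
      unfolding eq[symmetric] by (rule pscale_homog)
  qed
  have "lam (diff_rep z) L - homog (deg L) (\<lambda>i. \<Sum>t\<in>- L. sgn_elt t (insert t L) * v t i)
    = (\<Sum>t\<in>- L. pscale (Poly_Mapping.single (Poly_Mapping.single t 1) (sgn_elt t (insert t L)))
        (lam z (insert t L) - homog (deg (insert t L)) (v t)))"
    unfolding lam_diff_rep homog_sum sum_subtractf[symmetric]
    by (intro sum.cong refl) (simp add: pscale_diff_right *)
  also have "\<dots> \<in> im_phi"
    using assms(2) by (intro M.N_sum M.N_pscale) simp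
  finally show ?thesis .
qed

text \<open>Surjectivity: reducing every coordinate to standard positions produces exactly the
  components of a cochain.\<close>

lemma homogeneous_eq_comparison:
  assumes "homogeneous p z"
  obtains x where "Poly_Mapping.keys x \<subseteq> cochain_basis p" "tcoset p z = tcoset p (comparison x)"
proof -
  interpret T: free_tensor "{1..s}" im_phi "koszul_basis p :: 'n set set" by (rule free_tensor_koszul)
  have "\<exists>v'. (\<forall>i. v' i \<noteq> 0 \<longrightarrow> i \<in> standard (deg L)) \<and> lam z L - homog (deg L) v' \<in> im_phi" for L
  proof -
    obtain v where v: "\<And>i. v i \<noteq> 0 \<Longrightarrow> i \<in> rows (deg L)" "lam z L - homog (deg L) v \<in> im_phi"
      using assms unfolding homogeneous_def by metis
    \<comment> \<open>All rows lie in \<open>{1..s}\<close>, so elimination can start at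
      \<open>Suc s\<close>.\<close>
    have "v i = 0" if "Suc s \<le> i" for i
      using v(1)[of i] that by (auto simp: rows_def)
    from reduce_to_standard[of v, OF v(1) this] obtain v' where
      v': "\<And>i. v' i \<noteq> 0 \<Longrightarrow> i \<in> standard (deg L)" "(\<lambda>i. v i - v' i) \<in> colspace (deg L)"
      by blast
    have "homog (deg L) v - homog (deg L) v' \<in> im_phi"
      using phi_colspace[OF v'(2)] by (simp add: homog_diff)
    from M.N_diff_trans[OF v(2) this] show ?thesis
      using v'(1) by blast
  qed
  then obtain v where v: "\<And>L i. v L i \<noteq> 0 \<Longrightarrow> i \<in> standard (deg L)"
    "\<And>L. lam z L - homog (deg L) (v L) \<in> im_phi"
    by metis
  from component_surject[of p v, OF v(1)] obtain x where
    x: "Poly_Mapping.keys x \<subseteq> cochain_basis p" "\<And>L. L \<in> koszul_basis p \<Longrightarrow> component L x = v L"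
    by blast
  have "lam z L - lam (comparison x) L \<in> im_phi" if "L \<in> koszul_basis p" for L
    using v(2)[of L] lam_comparison[OF x(1), of L] x(2)[OF that]
    by (auto intro: M.N_diff_trans M.N_diff_sym)
  moreover have "Poly_Mapping.keys z \<subseteq> tensor_carrier p"
    using assms by (simp only: homogeneous_def)
  ultimately have "tcoset p z = tcoset p (comparison x)"
    using T.T_coset_eq_iff_Lam[OF _ keys_comparison[OF x(1)]] by blast
  with x(1) show thesis by (rule that)
qed

text \<open>Equal tensors have coordinates congruent modulo \<open>im_phi\<close>, and a vector on
  standard positions is determined by its class modulo the column space.\<close>

lemma comparison_inject:
  assumes "Poly_Mapping.keys x \<subseteq> cochain_basis p" "Poly_Mapping.keys y \<subseteq> cochain_basis p"
    and "tcoset p (comparison x) = tcoset p (comparison y)"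
  shows "x = y"
proof -
  interpret T: free_tensor "{1..s}" im_phi "koszul_basis p :: 'n set set" by (rule free_tensor_koszul)
  have "component L x = component L y" if L: "L \<in> koszul_basis p" for L
  proof (rule standard_unique)
    show "component L x i \<noteq> 0 \<Longrightarrow> i \<in> standard (deg L)"
      "component L y i \<noteq> 0 \<Longrightarrow> i \<in> standard (deg L)" for i
      using component_standard assms by blast+
    have "lam (comparison x) L - lam (comparison y) L \<in> im_phi"
      using assms(3) T.T_coset_eq_iff_Lam[OF keys_comparison keys_comparison] assms(1,2) L by blast
    then have "homog (deg L) (component L x) - homog (deg L) (component L y) \<in> im_phi"
      using M.N_diff_sym[OF lam_comparison[OF assms(1), of L]] lam_comparison[OF assms(2), of L]
      by (blast intro: M.N_diff_trans)
    then have "homog (deg L) (\<lambda>i. component L x i - component L y i) \<in> im_phi"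
      by (simp only: homog_diff)
    moreover have "i \<in> rows (deg L)" if "component L x i - component L y i \<noteq> 0" for i
    proof -
      from that have "component L x i \<noteq> 0 \<or> component L y i \<noteq> 0" by auto
      then show ?thesis
        using component_standard assms(1,2) by (auto simp: standard_def)
    qed
    ultimately show "(\<lambda>i. component L x i - component L y i) \<in> colspace (deg L)"
      using homog_in_im_phi_iff[of "\<lambda>i. component L x i - component L y i" "deg L"] by blast
  qed
  then have "component L (x - y) = (\<lambda>j. 0)" if "L \<in> koszul_basis p" for L
    using component_add[of L "x - y" y] that by (simp add: fun_eq_iff)
  moreover have "Poly_Mapping.keys (x - y) \<subseteq> cochain_basis p"
    by (rule keys_diff_subset[OF assms(1,2)])
  ultimately have "x - y = 0"
    by (intro component_inject)
  then show ?thesis by simp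
qed

lemma comparison_delta:
  assumes "Poly_Mapping.keys x \<subseteq> cochain_basis p"
  shows "tcoset (p - 1) (comparison (delta \<alpha> x)) = tcoset (p - 1) (diff_rep (comparison x))"
proof -
  interpret T: free_tensor "{1..s}" im_phi "koszul_basis (p - 1) :: 'n set set" by (rule free_tensor_koszul)
  note delta = keys_delta[OF assms]
  have "lam (comparison (delta \<alpha> x)) L - lam (diff_rep (comparison x)) L \<in> im_phi" for L
  proof -
    let ?w = "\<lambda>i. \<Sum>t\<in>- L. sgn_elt t (insert t L) * component (insert t L) x i"
    have "\<forall>i. component (insert t L) x i \<noteq> 0 \<longrightarrow> i \<in> rows (deg (insert t L))" for t
      using component_standard[OF assms] by (auto simp: standard_def)
    then have "lam (diff_rep (comparison x)) L - homog (deg L) ?w \<in> im_phi"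
      by (intro diff_rep_homog lam_comparison[OF assms])
    moreover have "homog (deg L) (component L (delta \<alpha> x)) - homog (deg L) ?w \<in> im_phi"
      using phi_colspace[OF component_delta[OF assms, of L]] by (simp add: homog_diff)
    moreover have "lam (comparison (delta \<alpha> x)) L - homog (deg L) (component L (delta \<alpha> x)) \<in> im_phi"
      by (rule lam_comparison[OF delta])
    ultimately show ?thesis
      by (blast intro: M.N_diff_trans M.N_diff_sym)
  qed
  then show ?thesis
    using T.T_coset_eq_iff_Lam[OF keys_comparison[OF delta] keys_diff_rep[OF keys_comparison[OF assms]]]
    by blast
qed

subsection \<open>The homogeneous component of the tensor product\<close>

definition generators where
  "generators p = {pure_tensor M_A (koszul p) X y | X y \<mu> \<nu>.
     X \<in> M_A_grading \<mu> \<and> y \<in> koszul_grading p \<nu> \<and> \<mu> + \<nu> = \<alpha>}"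

definition component_carrier where
  "component_carrier p = LinearCombinations.module.span class_ring (restrict_scalars (tensor p)) (generators p)"

lemma MK_eq: "MK \<alpha> t = (restrict_scalars (tensor (koszul_index \<alpha> t)))\<lparr>carrier := component_carrier (koszul_index \<alpha> t)\<rparr>"
  by (simp add: MK_def Let_def tensor_component_def tensor_product_koszul component_carrier_def generators_def)

lemma pure_tensor_eq: "pure_tensor M_A (koszul p) X y = tcoset p (basis_elt (X, y))"
  by (simp only: pure_tensor_def M_A_eq koszul_def)

lemma M_A_grading_homog:
  assumes "X \<in> M_A_grading \<mu>"
  obtains v where "\<And>i. v i \<noteq> 0 \<Longrightarrow> i \<in> rows \<mu>" "X = M.coset (homog \<mu> v)"
proof -
  from assms obtain f where f: "f \<in> free_component {1..s} \<beta> \<mu>" "X = M.coset f"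
    by (auto simp: M_A_grading_def cls_eq)
  have eq: "f = homog \<mu> (coord \<mu> f)"
  proof (rule poly_mapping_eqI)
    fix i
    have deg: "to_int u = \<mu> - \<beta> i" if "u \<in> Poly_Mapping.keys (Poly_Mapping.lookup f i)" for u
    proof -
      from that have "i \<in> Poly_Mapping.keys f" by (auto simp: in_keys_iff)
      with f(1) that show ?thesis by (auto simp: free_component_def algebra_simps)
    qed
    show "Poly_Mapping.lookup f i = Poly_Mapping.lookup (homog \<mu> (coord \<mu> f)) i"
    proof (cases "i \<in> rows \<mu>")
      case True
      then show ?thesis
        using homogeneous_poly[OF deg] by (simp add: lookup_homog coord_def)
    next
      case False
      have "Poly_Mapping.keys (Poly_Mapping.lookup f i) = {}"
      proof (rule ccontr)
        assume "Poly_Mapping.keys (Poly_Mapping.lookup f i) \<noteq> {}"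
        then obtain u where u: "u \<in> Poly_Mapping.keys (Poly_Mapping.lookup f i)" by blast
        then have "i \<in> Poly_Mapping.keys f" by (auto simp: in_keys_iff)
        then have "i \<in> {1..s}"
          using f(1) unfolding free_component_def by blast
        with deg[OF u] False show False
          by (auto simp: rows_def simp flip: deg[OF u])
      qed
      with False show ?thesis by (simp add: lookup_homog)
    qed
  qed
  show thesis
  proof (rule that)
    show "coord \<mu> f i \<noteq> 0 \<Longrightarrow> i \<in> rows \<mu>" for i
      by (simp add: coord_def split: if_splits)
    show "X = M.coset (homog \<mu> (coord \<mu> f))"
      unfolding eq[symmetric] by (rule f(2))
  qed
qed

text \<open>The coefficient of \<open>y\<close> at \<open>L\<close> is a scalar times the monomial
  of degree \<open>\<nu> - ind_vec L\<close>; together with degree \<open>\<mu>\<close> on the left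
  this gives \<open>deg L\<close>.\<close>

lemma homogeneous_generator:
  assumes "X \<in> M_A_grading \<mu>" "y \<in> koszul_grading p \<nu>" "\<mu> + \<nu> = \<alpha>"
  shows "homogeneous p (basis_elt (X, y))"
  unfolding homogeneous_def
proof (intro conjI allI)
  interpret T: free_tensor "{1..s}" im_phi "koszul_basis p :: 'n set set" by (rule free_tensor_koszul)
  obtain v where v: "\<And>i. v i \<noteq> 0 \<Longrightarrow> i \<in> rows \<mu>" "X = M.coset (homog \<mu> v)"
    using M_A_grading_homog[OF assms(1)] by blast
  have y: "Poly_Mapping.keys y \<subseteq> koszul_basis p"
    using assms(2) by (simp add: koszul_grading_def free_component_def)
  have "X \<in> carrier M.Q"
    unfolding v(2) by (rule M.coset_in_carrier[OF keys_homog])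
  with y show "Poly_Mapping.keys (basis_elt (X, y)) \<subseteq> tensor_carrier p"
    by (simp add: keys_basis_elt)
  fix L
  let ?q = "Poly_Mapping.lookup y L"
  have deg: "to_int u = \<nu> - ind_vec L" if "u \<in> Poly_Mapping.keys ?q" for u
  proof -
    from that have "L \<in> Poly_Mapping.keys y" by (auto simp: in_keys_iff)
    with assms(2) that show ?thesis by (auto simp: koszul_grading_def free_component_def algebra_simps)
  qed
  have rep: "lam (basis_elt (X, y)) L - pscale ?q (homog \<mu> v) \<in> im_phi"
    using M.N_pscale[OF M.rep_coset[OF keys_homog], of ?q \<mu> v]
    by (simp add: T.Lam_basis_elt v(2) pscale_diff_right)
  show "\<exists>v. (\<forall>i. v i \<noteq> 0 \<longrightarrow> i \<in> rows (deg L)) \<and> lam (basis_elt (X, y)) L - homog (deg L) v \<in> im_phi"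
  \<comment> \<open>A zero coefficient is treated separately, since then
    \<open>\<nu> - ind_vec L\<close> may have negative entries and is not an exponent.\<close>
  proof (cases "?q = 0")
    case True
    with rep show ?thesis by (intro exI[of _ "\<lambda>i. 0"]) simp
  next
    case False
    then obtain u where u: "u \<in> Poly_Mapping.keys ?q" by (metis keys_eq_empty ex_in_conv)
    define r where "r = Poly_Mapping.lookup ?q u"
    have u': "to_nat (\<nu> - ind_vec L) = u"
      using deg[OF u] to_nat_to_int by metis
    have q: "?q = Poly_Mapping.single u r"
      using homogeneous_poly[of ?q "\<nu> - ind_vec L", OF deg] by (simp add: u' r_def)
    have \<mu>: "\<mu> + to_int u = deg L"
      using deg[OF u] assms(3) by (auto simp: algebra_simps)
    have "i \<in> rows (deg L)" if "r * v i \<noteq> 0" for i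
      using that v(1)[of i] rows_add[of \<mu> u] by (auto simp: \<mu>)
    moreover have "pscale ?q (homog \<mu> v) = homog (deg L) (\<lambda>i. r * v i)"
      unfolding q by (simp add: pscale_homog[OF v(1)] \<mu>)
    ultimately show ?thesis
      using rep by (intro exI[of _ "\<lambda>i. r * v i"]) simp
  qed
qed

section \<open>The degree component as the image of the comparison map\<close>

lemma module_tensor: "Module.module class_ring (restrict_scalars (tensor p))"
proof -
  interpret T: free_tensor "{1..s}" im_phi "koszul_basis p :: 'n set set" by (rule free_tensor_koszul)
  show ?thesis by (rule module_restrict_scalars[OF T.T.module_Q])
qed

lemma generators_carrier: "generators p \<subseteq> carrier (restrict_scalars (tensor p))"
proof
  interpret T: free_tensor "{1..s}" im_phi "koszul_basis p :: 'n set set" by (rule free_tensor_koszul)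
  fix X assume "X \<in> generators p"
  then obtain z where "homogeneous p z" "X = tcoset p z"
    using homogeneous_generator unfolding generators_def pure_tensor_eq by blast
  then show "X \<in> carrier (restrict_scalars (tensor p))"
    unfolding restrict_scalars_simps homogeneous_def using T.T.coset_in_carrier by blast
qed

lemma component_carrier_homogeneous:
  assumes "X \<in> component_carrier p"
  shows "\<exists>z. homogeneous p z \<and> X = tcoset p z"
proof (rule span_induct_gen[OF module_tensor generators_carrier assms[unfolded component_carrier_def]])
  interpret T: free_tensor "{1..s}" im_phi "koszul_basis p :: 'n set set" by (rule free_tensor_koszul)
  show "\<exists>z. homogeneous p z \<and> \<zero>\<^bsub>restrict_scalars (tensor p)\<^esub> = tcoset p z"
    unfolding restrict_scalars_simps T.T.Q_zero
    by (intro exI[of _ 0]) (auto simp: homogeneous_def T.Lam_zero intro!: exI[of _ "\<lambda>i. 0"])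
next
  interpret T: free_tensor "{1..s}" im_phi "koszul_basis p :: 'n set set" by (rule free_tensor_koszul)
  fix X Y assume "\<exists>z. homogeneous p z \<and> X = tcoset p z" "\<exists>z. homogeneous p z \<and> Y = tcoset p z"
  then obtain z z' where z: "homogeneous p z" "X = tcoset p z" "homogeneous p z'" "Y = tcoset p z'"
    by blast
  have "homogeneous p (z + z')"
    unfolding homogeneous_def
  proof (intro conjI allI)
    show "Poly_Mapping.keys (z + z') \<subseteq> tensor_carrier p"
      using z by (intro order_trans[OF keys_add] Un_least) (simp_all only: homogeneous_def)
    fix L
    obtain v v' where v: "\<forall>i. v i \<noteq> 0 \<longrightarrow> i \<in> rows (deg L)" "lam z L - homog (deg L) v \<in> im_phi"
      "\<forall>i. v' i \<noteq> 0 \<longrightarrow> i \<in> rows (deg L)" "lam z' L - homog (deg L) v' \<in> im_phi"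
      using z unfolding homogeneous_def by metis
    have "lam (z + z') L - homog (deg L) (\<lambda>i. v i + v' i) \<in> im_phi"
      using M.N_add[OF v(2,4)] by (simp add: T.Lam_add homog_add algebra_simps)
    moreover have "\<forall>i. v i + v' i \<noteq> 0 \<longrightarrow> i \<in> rows (deg L)"
      using v(1,3) by (metis add.right_neutral)
    ultimately show "\<exists>v. (\<forall>i. v i \<noteq> 0 \<longrightarrow> i \<in> rows (deg L)) \<and> lam (z + z') L - homog (deg L) v \<in> im_phi"
      by (intro exI[of _ "\<lambda>i. v i + v' i"] conjI)
  qed
  then show "\<exists>z. homogeneous p z \<and> X \<oplus>\<^bsub>restrict_scalars (tensor p)\<^esub> Y = tcoset p z"
    unfolding restrict_scalars_simps z T.T.Q_add by blast
next
  interpret T: free_tensor "{1..s}" im_phi "koszul_basis p :: 'n set set" by (rule free_tensor_koszul)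
  fix r X assume "\<exists>z. homogeneous p z \<and> X = tcoset p z"
  then obtain z where z: "homogeneous p z" "X = tcoset p z" by blast
  have "homogeneous p (pscale (Poly_Mapping.single 0 r) z)"
    unfolding homogeneous_def
  proof (intro conjI allI)
    show "Poly_Mapping.keys (pscale (Poly_Mapping.single 0 r) z) \<subseteq> tensor_carrier p"
      using z by (intro order_trans[OF keys_pscale]) (simp only: homogeneous_def)
    fix L
    obtain v where v: "\<forall>i. v i \<noteq> 0 \<longrightarrow> i \<in> rows (deg L)" "lam z L - homog (deg L) v \<in> im_phi"
      using z unfolding homogeneous_def by metis
    have "lam (pscale (Poly_Mapping.single 0 r) z) L - homog (deg L) (\<lambda>i. r * v i) \<in> im_phi"
      using M.N_pscale[OF v(2), of "Poly_Mapping.single 0 r"]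
      by (simp add: T.Lam_pscale pscale_diff_right pscale_homog_scalar)
    with v(1) show "\<exists>v. (\<forall>i. v i \<noteq> 0 \<longrightarrow> i \<in> rows (deg L))
        \<and> lam (pscale (Poly_Mapping.single 0 r) z) L - homog (deg L) v \<in> im_phi"
      by (intro exI[of _ "\<lambda>i. r * v i"]) auto
  qed
  then show "\<exists>z. homogeneous p z \<and> r \<odot>\<^bsub>restrict_scalars (tensor p)\<^esub> X = tcoset p z"
    unfolding restrict_scalars_simps z T.T.Q_smult by blast
next
  fix X assume "X \<in> generators p"
  then show "\<exists>z. homogeneous p z \<and> X = tcoset p z"
    using homogeneous_generator unfolding generators_def pure_tensor_eq by blast
qed

lemma component_carrier_submodule:
  "LinearCombinations.submodule class_ring (component_carrier p) (restrict_scalars (tensor p))"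
  unfolding component_carrier_def
  by (rule LinearCombinations.module.span_is_submodule[OF module_tensor generators_carrier])

lemma comparison_basis_generator:
  assumes "(j, \<tau>) \<in> cochain_basis p"
  shows "tcoset p (comparison_basis j \<tau>) \<in> generators p"
proof -
  let ?L = "S j - \<tau>"
  have j: "j \<in> {1..s}" "nonneg (deg ?L - \<beta> j)" "?L \<in> koszul_basis p"
    using assms by (auto simp: cochain_basis_def standard_def rows_def)
  have "mon_cls (deg ?L - \<beta> j) j \<in> M_A_grading (deg ?L)"
    using j unfolding M_A_grading_def mon_cls_def
    by (intro imageI) (simp add: free_component_def to_int_to_nat)
  moreover have "basis_elt ?L \<in> koszul_grading p (ind_vec ?L)"
  proof -
    have "to_int 0 = (0 :: 'n \<Rightarrow>\<^sub>0 int)" by (rule poly_mapping_eqI) simp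
    with j(3) show ?thesis
      by (simp add: koszul_grading_def free_component_def basis_elt_def)
  qed
  ultimately show ?thesis
    unfolding generators_def pure_tensor_eq comparison_basis_def
    by (intro CollectI exI conjI) (rule refl, assumption, assumption, simp)
qed

lemma comparison_carrier:
  assumes "Poly_Mapping.keys x \<subseteq> cochain_basis p"
  shows "tcoset p (comparison x) \<in> component_carrier p"
  using assms
proof (induction x rule: poly_mapping_induct_keys)
  interpret T: free_tensor "{1..s}" im_phi "koszul_basis p :: 'n set set" by (rule free_tensor_koszul)
  interpret sub: LinearCombinations.submodule class_ring "component_carrier p" "restrict_scalars (tensor p)"
    by (rule component_carrier_submodule)
  {
    case zero
    show ?case
      using sub.zero_closed unfolding restrict_scalars_simps T.T.Q_zero comparison_zero .
  next
    case (single b r)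
    then obtain j \<tau> where b: "b = (j, \<tau>)" "(j, \<tau>) \<in> cochain_basis p" by (cases b) auto
    then have j: "j \<in> {1..s}" by (simp add: cochain_basis_def)
    have "tcoset p (comparison_basis j \<tau>) \<in> component_carrier p"
      using LinearCombinations.module.in_own_span[OF module_tensor generators_carrier]
        comparison_basis_generator[OF b(2)] unfolding component_carrier_def by blast
    from sub.smult_closed[OF _ this, of "r * sgn_set \<tau> (S j)"] show ?case
      unfolding b(1) comparison_single[OF j] restrict_scalars_simps T.T.Q_smult by simp
  next
    case (add x y)
    from sub.m_closed[OF this] show ?case
      unfolding comparison_add restrict_scalars_simps T.T.Q_add .
  }
qed

lemma component_carrier_eq:
  "component_carrier p = (\<lambda>x. tcoset p (comparison x)) ` {x. Poly_Mapping.keys x \<subseteq> cochain_basis p}"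
proof (rule subset_antisym; rule subsetI)
  fix X assume "X \<in> component_carrier p"
  then obtain z where z: "homogeneous p z" "X = tcoset p z"
    using component_carrier_homogeneous by blast
  from homogeneous_eq_comparison[OF z(1)] obtain x
    where "Poly_Mapping.keys x \<subseteq> cochain_basis p" "tcoset p z = tcoset p (comparison x)" .
  with z(2) show "X \<in> (\<lambda>x. tcoset p (comparison x)) ` {x. Poly_Mapping.keys x \<subseteq> cochain_basis p}"
    by blast
qed (use comparison_carrier in blast)

subsection \<open>The isomorphism of complexes\<close>

lemma koszul_index_Suc: "koszul_index \<alpha> (t + 1) = koszul_index \<alpha> t - 1"
  by (simp add: koszul_index_def)

definition comparison_map where
  "comparison_map t x = tcoset (koszul_index \<alpha> t) (comparison x)"

section \<open>Transport of structure along the comparison map\<close>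

lemma MK_diff_comparison_map:
  assumes "x \<in> carrier (C \<alpha> t)"
  shows "MK_diff \<alpha> t (comparison_map t x) = comparison_map (t + 1) (delta \<alpha> x)"
proof -
  have x: "Poly_Mapping.keys x \<subseteq> cochain_basis (koszul_index \<alpha> t)"
    using assms by (simp add: C_eq)
  show ?thesis
    unfolding comparison_map_def koszul_index_Suc comparison_delta[OF x] MK_diff_def
    by (rule tensor_map_tcoset[OF keys_comparison[OF x]])
qed

lemma delta_add: "delta \<alpha> (x + y) = delta \<alpha> x + delta \<alpha> y"
  and delta_pscale: "delta \<alpha> (pscale r x) = pscale r (delta \<alpha> x)"
  by (simp_all add: delta_eq lin_ext_add lin_ext_pscale)

lemma C_simps:
  "carrier (C \<alpha> t) = {x. Poly_Mapping.keys x \<subseteq> cochain_basis (koszul_index \<alpha> t)}"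
  "add (C \<alpha> t) = (+)" "zero (C \<alpha> t) = 0" "Module.smult (C \<alpha> t) = pscale"
  by (simp_all add: C_eq)

text \<open>Every element of the degree component is a comparison image, so computations in
  \<open>MK\<close> can be carried out on cochains.\<close>

lemma MK_simps:
  "carrier (MK \<alpha> t) = comparison_map t ` carrier (C \<alpha> t)"
  "comparison_map t x \<oplus>\<^bsub>MK \<alpha> t\<^esub> comparison_map t y
    = comparison_map t (x + y)"
  "r \<odot>\<^bsub>MK \<alpha> t\<^esub> comparison_map t x = comparison_map t (pscale r x)"
  "zero (MK \<alpha> t) = comparison_map t 0"
proof -
  let ?p = "koszul_index \<alpha> t"
  interpret T: free_tensor "{1..s}" im_phi "koszul_basis ?p :: 'n set set" by (rule free_tensor_koszul)
  have ops: "carrier (MK \<alpha> t) = component_carrier ?p" "add (MK \<alpha> t) = add (tensor ?p)"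
    "zero (MK \<alpha> t) = zero (tensor ?p)"
    "\<And>X. r \<odot>\<^bsub>MK \<alpha> t\<^esub> X = Poly_Mapping.single 0 r \<odot>\<^bsub>tensor ?p\<^esub> X"
    by (simp_all add: MK_eq restrict_scalars_def)
  show "carrier (MK \<alpha> t) = comparison_map t ` carrier (C \<alpha> t)"
    unfolding ops component_carrier_eq C_simps comparison_map_def[abs_def] ..
  show "comparison_map t x \<oplus>\<^bsub>MK \<alpha> t\<^esub> comparison_map t y = comparison_map t (x + y)"
    "r \<odot>\<^bsub>MK \<alpha> t\<^esub> comparison_map t x = comparison_map t (pscale r x)"
    "zero (MK \<alpha> t) = comparison_map t 0"
    unfolding ops comparison_map_def T.T.Q_simps comparison_add comparison_pscale comparison_zero by (rule refl)+
qed

text \<open>The comparison image of the square is the class of the squared Koszul differential,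
  which is zero; injectivity then gives the claim.\<close>

lemma delta_delta:
  assumes "Poly_Mapping.keys x \<subseteq> cochain_basis p"
  shows "delta \<alpha> (delta \<alpha> x) = 0"
proof (rule comparison_inject)
  interpret T: free_tensor "{1..s}" im_phi "koszul_basis (p - 1 - 1) :: 'n set set" by (rule free_tensor_koszul)
  interpret T': free_tensor "{1..s}" im_phi "koszul_basis (p - 1) :: 'n set set" by (rule free_tensor_koszul)
  note d = keys_delta[OF assms]
  show "Poly_Mapping.keys (delta \<alpha> (delta \<alpha> x)) \<subseteq> cochain_basis (p - 1 - 1)"
    by (rule keys_delta[OF d])
  have "comparison (delta \<alpha> x) - diff_rep (comparison x) \<in> tensor_kernel M.Q (free_module (koszul_basis (p - 1)))"
    using comparison_delta[OF assms] unfolding T'.T.coset_eq_iff .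
  from diff_rep_kernel[OF this]
  have "tcoset (p - 1 - 1) (diff_rep (comparison (delta \<alpha> x))) = tcoset (p - 1 - 1) (diff_rep (diff_rep (comparison x)))"
    unfolding T.T.coset_eq_iff by (simp add: diff_rep_def lin_ext_diff)
  also have "\<dots> = tcoset (p - 1 - 1) (comparison 0)"
    using diff_rep_diff_rep[OF keys_comparison[OF assms]] unfolding T.T.coset_eq_iff by simp
  finally show "tcoset (p - 1 - 1) (comparison (delta \<alpha> (delta \<alpha> x))) = tcoset (p - 1 - 1) (comparison 0)"
    unfolding comparison_delta[OF d] .
qed simp

lemma cochain_complex_C: "cochain_complex (C \<alpha>) (\<lambda>_. delta \<alpha>)"
  unfolding cochain_complex_def
proof (intro allI conjI ballI)
  fix t
  show "vectorspace class_ring (C \<alpha> t)"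
    unfolding C_eq by (rule vectorspaceI[OF module_free_module])
  show "delta \<alpha> \<in> LinearCombinations.module_hom class_ring (C \<alpha> t) (C \<alpha> (t + 1))"
    unfolding LinearCombinations.module_hom_def C_simps koszul_index_Suc
    using keys_delta by (auto simp: delta_add delta_pscale)
  fix x assume "x \<in> carrier (C \<alpha> t)"
  then show "delta \<alpha> (delta \<alpha> x) = \<zero>\<^bsub>C \<alpha> (t + 1 + 1)\<^esub>"
    unfolding C_simps using delta_delta by blast
qed

lemma delta_carrier: "x \<in> carrier (C \<alpha> t) \<Longrightarrow> delta \<alpha> x \<in> carrier (C \<alpha> (t + 1))"
  using keys_delta by (simp add: C_simps koszul_index_Suc)

text \<open>Since elements and differential are comparison images, the square-zero property is
  pulled back from the cochains.\<close>

lemma cochain_complex_MK: "cochain_complex (MK \<alpha>) (MK_diff \<alpha>)"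
  unfolding cochain_complex_def
proof (intro allI conjI ballI)
  fix t
  interpret RS: vectorspace class_ring "restrict_scalars (tensor (koszul_index \<alpha> t))"
    by (rule vectorspaceI[OF module_tensor])
  show "vectorspace class_ring (MK \<alpha> t)"
    unfolding MK_eq
    by (rule RS.subspace_is_vs) (intro subspace.intro RS.vectorspace_axioms component_carrier_submodule)
  note diff = MK_diff_comparison_map
  have closed: "x + y \<in> carrier (C \<alpha> t)" "pscale r x \<in> carrier (C \<alpha> t)"
    if "x \<in> carrier (C \<alpha> t)" "y \<in> carrier (C \<alpha> t)" for x y r
    using that keys_add[of x y] keys_pscale[of r x] unfolding C_simps by blast+
  show "MK_diff \<alpha> t \<in> LinearCombinations.module_hom class_ring (MK \<alpha> t) (MK \<alpha> (t + 1))"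
    unfolding LinearCombinations.module_hom_def MK_simps(1)
    using delta_carrier closed
    by (auto simp: diff MK_simps(2-4) delta_add delta_pscale)
  fix X assume "X \<in> carrier (MK \<alpha> t)"
  then obtain x where x: "x \<in> carrier (C \<alpha> t)" "X = comparison_map t x"
    unfolding MK_simps by blast
  have "delta \<alpha> (delta \<alpha> x) = 0"
    using x(1) delta_delta unfolding C_simps by blast
  then show "MK_diff \<alpha> (t + 1) (MK_diff \<alpha> t X) = \<zero>\<^bsub>MK \<alpha> (t + 1 + 1)\<^esub>"
    unfolding x(2) MK_simps(4) by (simp only: diff[OF x(1)] diff[OF delta_carrier[OF x(1)]])
qed

lemma cochain_isomorphic_C_MK: "cochain_isomorphic (C \<alpha>) (\<lambda>_. delta \<alpha>) (MK \<alpha>) (MK_diff \<alpha>)"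
  unfolding cochain_isomorphic_def
proof (intro conjI cochain_complex_C cochain_complex_MK exI allI ballI)
  fix t
  show "comparison_map t \<in> LinearCombinations.module_hom class_ring (C \<alpha> t) (MK \<alpha> t)"
    unfolding LinearCombinations.module_hom_def MK_simps(1) by (auto simp: MK_simps(2-3) C_simps(2-4))
  have "inj_on (comparison_map t) (carrier (C \<alpha> t))"
    unfolding C_simps comparison_map_def by (rule inj_onI) (use comparison_inject in blast)
  then show "bij_betw (comparison_map t) (carrier (C \<alpha> t)) (carrier (MK \<alpha> t))"
    unfolding MK_simps(1) by (rule inj_on_imp_bij_betw)
  fix x assume "x \<in> carrier (C \<alpha> t)"
  then show "comparison_map (t + 1) (delta \<alpha> x) = MK_diff \<alpha> t (comparison_map t x)"
    by (simp only: MK_diff_comparison_map)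
qed

end

theorem theorem4p6:
  fixes mle :: "('n::{finite,linorder} \<Rightarrow>\<^sub>0 nat) \<Rightarrow> ('n \<Rightarrow>\<^sub>0 nat) \<Rightarrow> bool"
    and c :: "nat \<Rightarrow> nat \<Rightarrow> 'k::field_char_0"
    and a :: "nat \<Rightarrow> nat \<Rightarrow> ('n \<Rightarrow>\<^sub>0 nat)"
    and s l :: nat
    and \<gamma> \<beta> :: "nat \<Rightarrow> ('n \<Rightarrow>\<^sub>0 int)"
    and \<alpha> :: "'n \<Rightarrow>\<^sub>0 int"
  assumes "monomial_order mle"
    and "multigraded c a s l"
    and "squarefree_matrix c a s l"
    and "squarefree_solution c a s l \<gamma> \<beta>"
  shows "cochain_complex (monomial_presentation.C mle c a s l \<beta> \<alpha>)
           (\<lambda>_. monomial_presentation.delta mle c a s l \<beta> \<alpha>)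
       \<and> cochain_isomorphic (monomial_presentation.C mle c a s l \<beta> \<alpha>)
           (\<lambda>_. monomial_presentation.delta mle c a s l \<beta> \<alpha>)
           (monomial_presentation.MK c a s l \<beta> \<alpha>)
           (monomial_presentation.MK_diff c a s l \<beta> \<alpha>)"
proof -
  interpret squarefree_degree mle c a s l \<beta> \<gamma> \<alpha>
    by unfold_locales (fact assms)+
  show ?thesis
    using cochain_complex_C cochain_isomorphic_C_MK by blast
qed

end
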